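(* Assume the weight $w=e^{-\varphi}$ belongs to $\mathcal{E}$, where $\varphi\in\mathcal{W}_0$ is radial and $\rho\in\mathcal{L}_0$ satisfies $\frac{1}{\sqrt{\Delta\varphi}}\asymp\rho$ on $\mathbb{D}$. Moreover, let $\nu\in\widehat{\mathcal{D}}$ and define the weights $\omega=w^2$ and $v=w\,\widehat{\nu}^{\,t}\rho^\sigma$, where $t\in\{-1,0,1\}$ and $\sigma$ is any real number. Then the projection $P_\omega$ is bounded from $L^\infty_v$ onto $H^\infty_v$.
   Context: Let $\mathbb{D}$ be the open unit disc of $\mathbb{C}$, $\mathcal{H}(\mathbb{D})$ the space of analytic functions in $\mathbb{D}$, and $dA(z)=\frac{dx\,dy}{\pi}$ the normalized area measure. For positive functions, $A\asymp B$ means that there is a constant $C\geq 1$ with $C^{-1}B\le A\le CB$. A continuous function $\rho:\mathbb{D}\to\mathbb{R}$ belongs to the class $\mathcal{L}_0$ if $\lim_{|z|\to1}\rho(z)=0$, $\sup_{z,\zeta\in\mathbb{D},\,z\ne\zeta}\frac{|\rho(z)-\rho(\zeta)|}{|z-\zeta|}<\infty$, and for every $\varepsilon>0$ there is a compact set $E\subset\mathbb{D}$ such that $|\rho(z)-\rho(\zeta)|\le\varepsilon|z-\zeta|$ whenever $z,\zeta\in\mathbb{D}\setminus E$. A twice continuously differentiable, real valued subharmonic function $\varphi$ on $\mathbb{D}$ belongs to the class $\mathcal{W}_0$ if $\Delta\varphi>0$ and there exists $\rho\in\mathcal{L}_0$ such that $\frac{1}{\sqrt{\Delta\varphi}}\asymp\rho$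 on $\mathbb{D}$. A weight belongs to the class $\mathcal{E}$ if it is of the form $e^{-\varphi}$ for some radial function $\varphi\in\mathcal{W}_0$. A radial weight is a nonnegative function $\nu\in L^1([0,1))$, extended to $\mathbb{D}$ by $\nu(z)=\nu(|z|)$; write $\widehat{\nu}(z)=\widehat{\nu}(|z|)=\int_{|z|}^1\nu(s)\,ds$, assumed positive for all $z\in\mathbb{D}$. A radial weight $\nu$ belongs to $\widehat{\mathcal{D}}$ if there is $C>0$ such that $\widehat{\nu}(r)\le C\,\widehat{\nu}\left(\frac{1+r}{2}\right)$ as $r\to1^-$ (i.e. for all $r<1$ close enough to $1$). For a radial weight $\omega$ with moments $\omega_x=\int_0^1 r^x\omega(r)\,dr$, the Bergman projection is $$P_\omega(f)(z)=\int_{\mathbb{D}}f(\zeta)\,\overline{B^\omega_z(\zeta)}\,\omega(\zeta)\,dA(\zeta),\qquad B^\omega_z(\zeta)=\sum_{n=0}^\infty\frac{(\overline{z}\zeta)^n}{2\omega_{2n+1}},$$ where $B^\omega_z$ is the reproducing kernel of the Bergman space $A^2_\omega=L^2(\mathbb{D},\omega\,dA)\cap\mathcal{H}(\mathbb{D})$. For a positive continuous function $v$ on $\mathbb{D}$, $L^\infty_v$ is the space of measurable $f:\mathbb{D}\to\mathbb{C}$ with $\|f\|_{\infty,v}=\operatorname{ess\,sup}_{z\in\mathbb{D}}|f(z)|v(z)<\infty$, and $H^\infty_v=L^\infty_v\cap\mathcal{H}(\mathbb{D})$. "Bounded from $L^\infty_v$ onto $H^\infty_v$" means that the integral operator $P_\omega$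 maps $L^\infty_v$ boundedly into $H^\infty_v$ and surjectively onto $H^\infty_v$. *)

theory Defs
  imports "HOL-Probability.Essential_Supremum" "HOL-Complex_Analysis.Complex_Analysis"
begin

text \<open>
  Functions on the unit disc are represented by total functions on the complex plane; all the
  notions below depend only on their values inside the disc.
\<close>

abbreviation unit_disc :: "complex set" where
  "unit_disc \<equiv> ball 0 1"

definition radial :: "(complex \<Rightarrow> 'a) \<Rightarrow> bool" where
  "radial f \<longleftrightarrow> (\<forall>z\<in>unit_disc. f z = f (of_real (norm z)))"

definition comparable_on :: "'a set \<Rightarrow> ('a \<Rightarrow> real) \<Rightarrow> ('a \<Rightarrow> real) \<Rightarrow> bool" where
  "comparable_on S A B \<longleftrightarrow> (\<exists>C\<ge>1. \<forall>z\<in>S. B z / C \<le> A z \<and> A z \<le> C * B z)"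


subsection \<open>Smoothness, Laplacian, subharmonicity\<close>

definition C1_on :: "complex set \<Rightarrow> (complex \<Rightarrow> real) \<Rightarrow> bool" where
  "C1_on S f \<longleftrightarrow> (\<forall>z\<in>S. f differentiable (at z)) \<and>
     (\<forall>h. continuous_on S (\<lambda>z. frechet_derivative f (at z) h))"

definition C2_on :: "complex set \<Rightarrow> (complex \<Rightarrow> real) \<Rightarrow> bool" where
  "C2_on S f \<longleftrightarrow> C1_on S f \<and> (\<forall>h. C1_on S (\<lambda>z. frechet_derivative f (at z) h))"

text \<open>The vectors \<open>1\<close> and \<open>\<i>\<close> are the two coordinate directions of the plane.\<close>

definition laplacian :: "(complex \<Rightarrow> real) \<Rightarrow> complex \<Rightarrow> real" where
  "laplacian f z =
     frechet_derivative (\<lambda>w. frechet_derivative f (at w) 1) (at z) 1 +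
     frechet_derivative (\<lambda>w. frechet_derivative f (at w) \<i>) (at z) \<i>"

text \<open>
  Upper semicontinuity and the sub-mean value property. A real-valued subharmonic function is
  integrable over every circle bounding a closed disc contained in its domain.
\<close>

definition subharmonic_on :: "complex set \<Rightarrow> (complex \<Rightarrow> real) \<Rightarrow> bool" where
  "subharmonic_on S f \<longleftrightarrow>
     (\<forall>z\<in>S. \<forall>c>f z. eventually (\<lambda>w. f w < c) (at z within S)) \<and>
     (\<forall>z r. 0 < r \<longrightarrow> cball z r \<subseteq> S \<longrightarrow>
        set_integrable lebesgue {0..2 * pi} (\<lambda>t. f (z + of_real r * cis t)) \<and>
        f z \<le> (LINT t:{0..2 * pi}|lebesgue. f (z + of_real r * cis t)) / (2 * pi))"


subsection \<open>The classes of weights\<close>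

definition class_L0 :: "(complex \<Rightarrow> real) set" where
  "class_L0 = {\<rho>. continuous_on unit_disc \<rho> \<and>
     (\<rho> \<longlongrightarrow> 0) (filtercomap norm (at_left 1)) \<and>
     (\<exists>L. L-lipschitz_on unit_disc \<rho>) \<and>
     (\<forall>\<epsilon>>0. \<exists>E. compact E \<and> E \<subseteq> unit_disc \<and> \<epsilon>-lipschitz_on (unit_disc - E) \<rho>)}"

definition class_W0 :: "(complex \<Rightarrow> real) set" where
  "class_W0 = {\<phi>. C2_on unit_disc \<phi> \<and> subharmonic_on unit_disc \<phi> \<and>
     (\<forall>z\<in>unit_disc. laplacian \<phi> z > 0) \<and>
     (\<exists>\<rho>\<in>class_L0. comparable_on unit_disc (\<lambda>z. 1 / sqrt (laplacian \<phi> z)) \<rho>)}"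

definition class_E :: "(complex \<Rightarrow> real) set" where
  "class_E = {w. \<exists>\<phi>\<in>class_W0. radial \<phi> \<and> (\<forall>z\<in>unit_disc. w z = exp (- \<phi> z))}"

definition tail :: "(complex \<Rightarrow> real) \<Rightarrow> complex \<Rightarrow> real" where
  "tail \<nu> z = (LINT s:{norm z..<1}|lebesgue. \<nu> (of_real s))"

definition radial_weight :: "(complex \<Rightarrow> real) \<Rightarrow> bool" where
  "radial_weight \<nu> \<longleftrightarrow> radial \<nu> \<and> (\<forall>z\<in>unit_disc. 0 \<le> \<nu> z) \<and>
     set_integrable lebesgue {0..<1} (\<lambda>s. \<nu> (of_real s)) \<and>
     (\<forall>z\<in>unit_disc. 0 < tail \<nu> z)"

definition class_D_hat :: "(complex \<Rightarrow> real) set" where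
  "class_D_hat = {\<nu>. radial_weight \<nu> \<and>
     (\<exists>C>0. \<forall>\<^sub>F r in at_left 1. tail \<nu> (of_real r) \<le> C * tail \<nu> (of_real ((1 + r) / 2)))}"


subsection \<open>The Bergman projection\<close>

definition moment :: "(complex \<Rightarrow> real) \<Rightarrow> real \<Rightarrow> real" where
  "moment \<omega> x = (LINT r:{0..<1}|lebesgue. r powr x * \<omega> (of_real r))"

definition bergman_kernel :: "(complex \<Rightarrow> real) \<Rightarrow> complex \<Rightarrow> complex \<Rightarrow> complex" where
  "bergman_kernel \<omega> z \<zeta> =
     (\<Sum>n. (cnj z * \<zeta>) ^ n / of_real (2 * moment \<omega> (of_nat (2 * n + 1))))"

definition bergman_integrand ::
    "(complex \<Rightarrow> real) \<Rightarrow> (complex \<Rightarrow> complex) \<Rightarrow> complex \<Rightarrow> complex \<Rightarrow> complex" where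
  "bergman_integrand \<omega> f z \<zeta> = f \<zeta> * cnj (bergman_kernel \<omega> z \<zeta>) * of_real (\<omega> \<zeta>)"

text \<open>The factor \<open>1 / pi\<close> normalizes the area measure of the disc to total mass one.\<close>

definition bergman_proj ::
    "(complex \<Rightarrow> real) \<Rightarrow> (complex \<Rightarrow> complex) \<Rightarrow> complex \<Rightarrow> complex" where
  "bergman_proj \<omega> f z = (LINT \<zeta>:unit_disc|lebesgue. bergman_integrand \<omega> f z \<zeta>) / of_real pi"


subsection \<open>Weighted sup-norm spaces\<close>

definition Linf_norm :: "(complex \<Rightarrow> real) \<Rightarrow> (complex \<Rightarrow> complex) \<Rightarrow> ereal" where
  "Linf_norm v f = esssup (lebesgue_on unit_disc) (\<lambda>z. ereal (norm (f z) * v z))"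

definition Linf :: "(complex \<Rightarrow> real) \<Rightarrow> (complex \<Rightarrow> complex) set" where
  "Linf v = {f. f \<in> borel_measurable (lebesgue_on unit_disc) \<and> Linf_norm v f < \<infinity>}"

definition Hinf :: "(complex \<Rightarrow> real) \<Rightarrow> (complex \<Rightarrow> complex) set" where
  "Hinf v = {f \<in> Linf v. f holomorphic_on unit_disc}"

text \<open>
  The integrability clause says that the integral operator is defined on the whole space:
  the Bochner integral of a non-integrable function is \<open>0\<close> by convention. Two elements of
  \<open>Hinf v\<close> are the same function on the disc iff they agree there, hence the form of the
  surjectivity clause.
\<close>

definition bergman_proj_bounded_onto ::
    "(complex \<Rightarrow> real) \<Rightarrow> (complex \<Rightarrow> real) \<Rightarrow> bool" where
  "bergman_proj_bounded_onto \<omega> v \<longleftrightarrow>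
     (\<forall>f\<in>Linf v. \<forall>z\<in>unit_disc. set_integrable lebesgue unit_disc (bergman_integrand \<omega> f z)) \<and>
     (\<forall>f\<in>Linf v. bergman_proj \<omega> f \<in> Hinf v) \<and>
     (\<exists>C::real. \<forall>f\<in>Linf v. Linf_norm v (bergman_proj \<omega> f) \<le> ereal C * Linf_norm v f) \<and>
     (\<forall>g\<in>Hinf v. \<exists>f\<in>Linf v. \<forall>z\<in>unit_disc. bergman_proj \<omega> f z = g z)"

end

theory Submission
  imports Defs
begin

text \<open>
  Since \<open>\<omega>\<close> is radial, the kernel is a power series whose coefficients are given by the moments of
  \<open>\<omega>\<close>, so no \<open>\<partial>\<close>-bar estimates are needed. In the coordinate \<open>\<tau> r = \<integral>\<^bsub>[0,r]\<^esub> 1 / p\<close> on the radius, where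
  \<open>p = \<rho>\<close>, the function \<open>r\<^bsup>2n+1\<^esup> \<omega> r\<close> decays exponentially away from its peak. Laplace's
  method then bounds the moments, the coefficients \<open>c n\<close> of the weighted kernel on the circles of
  radii \<open>r\<close> and \<open>s\<close>, and their differences \<open>c (n + 1) - c n\<close>. Bounding an \<open>L\<^sup>1\<close> norm on the circle by
  the \<open>L\<^sup>2\<close> norms of the function and of its differences gives
  \<open>w z w \<zeta> \<integral> \<bar>B z \<zeta>\<bar> d\<theta> \<le> K / p r \<cdot> exp (- a \<bar>\<tau> r - \<tau> s\<bar>)\<close>.
  The factors \<open>\<nu>\<close>-tail and \<open>\<rho>\<close> grow and decay more slowly in \<open>\<tau>\<close> than any exponential, so the
  weighted kernel is integrable in \<open>\<zeta>\<close> uniformly in \<open>z\<close>, which is boundedness. Orthogonality of the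
  monomials shows that \<open>P\<close> is the identity on \<open>Hinf v\<close>, hence onto.
\<close>

text \<open>Where the exponents come from: away from the origin \<open>\<psi>\<close> grows at rate
  about \<open>1 / p\<close> in \<tau>, so about \<open>1 / p\<close> indices have their peak within
  unit \<tau>-distance of a given radius, each with a weighted coefficient of size
  \<open>1 / p\<close>. The triangle inequality would bound the circle means by
  \<open>1 / p^2\<close>, one factor too many. Neighbouring coefficients differ only by O(1), so the
  squares sum to \<open>1 / p^3\<close> and the squared differences to \<open>1 / p\<close>;
  interpolation at the angular scale \<open>p r\<close> gives \<open>1 / p\<close>, which
  \<open>d\<tau> = ds / p\<close> absorbs. The decay rate \<open>A\<close> is fixed by the constants
  of the Laplacian, so every transfer of \<open>p\<close>, of distances or of \<open>H\<close>
  between two radii must cost an arbitrarily small rate. The vanishing Lipschitz constants of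
  \<open>class_L0\<close> provide this for \<open>p\<close>; they also give
  \<open>p r = o(1 - r)\<close>, which makes the polynomial losses of a doubling tail slow.
  Estimates of increments in the radius are stated as monotonicity of an auxiliary function, so that
  only derivatives on open intervals enter.\<close>

lemma deriv_nonneg_imp_le:
  fixes f :: "real \<Rightarrow> real"
  assumes "a \<le> b" "continuous_on {a..b} f"
    and "\<And>x. a < x \<Longrightarrow> x < b \<Longrightarrow> (f has_real_derivative f' x) (at x)"
    and "\<And>x. a < x \<Longrightarrow> x < b \<Longrightarrow> 0 \<le> f' x"
  shows "f a \<le> f b"
  using assms by (intro DERIV_nonneg_imp_increasing_open[of a b f]) blast+

section \<open>Slowly varying functions\<close>

text \<open>
  On \<open>[0, 1)\<close>, \<open>p\<close> is \<open>\<rho>\<close>, \<open>u\<close> is \<open>\<phi>\<close> and \<open>D\<close> is the Laplacian of \<open>\<phi>\<close>; with \<open>\<psi> r = r u' r\<close>, the last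
  assumption is the polar form of the Laplacian of a radial function.
\<close>

locale radial_profile =
  fixes p u \<psi> D :: "real \<Rightarrow> real" and L c0 C0 :: real
  assumes p_pos: "\<And>r. 0 \<le> r \<Longrightarrow> r < 1 \<Longrightarrow> 0 < p r"
    and L_pos: "0 < L"
    and p_lip: "\<And>r s. 0 \<le> r \<Longrightarrow> r < 1 \<Longrightarrow> 0 \<le> s \<Longrightarrow> s < 1 \<Longrightarrow> \<bar>p r - p s\<bar> \<le> L * \<bar>r - s\<bar>"
    and p_lim: "(p \<longlongrightarrow> 0) (at_left 1)"
    and p_small_lip: "\<And>e. 0 < e \<Longrightarrow> \<exists>R. 0 \<le> R \<and> R < 1 \<and>
          (\<forall>r s. R \<le> r \<longrightarrow> r < 1 \<longrightarrow> R \<le> s \<longrightarrow> s < 1 \<longrightarrow> \<bar>p r - p s\<bar> \<le> e * \<bar>r - s\<bar>)"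
    and c0_pos: "0 < c0"
    and D_lower: "\<And>r. 0 \<le> r \<Longrightarrow> r < 1 \<Longrightarrow> c0 / (p r)\<^sup>2 \<le> D r"
    and D_upper: "\<And>r. 0 \<le> r \<Longrightarrow> r < 1 \<Longrightarrow> D r \<le> C0 / (p r)\<^sup>2"
    and u_cont: "continuous_on {0..<1} u"
    and u_deriv: "\<And>r. 0 < r \<Longrightarrow> r < 1 \<Longrightarrow> (u has_real_derivative \<psi> r / r) (at r)"
    and psi_cont: "continuous_on {0..<1} \<psi>"
    and psi_0: "\<psi> 0 = 0"
    and psi_deriv: "\<And>r. 0 < r \<Longrightarrow> r < 1 \<Longrightarrow> (\<psi> has_real_derivative r * D r) (at r)"
begin

lemma p_cont: "continuous_on {0..<1} p"
proof -
  have "L-lipschitz_on {0..<1} p"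
    using p_lip L_pos by (intro lipschitz_onI) (auto simp: dist_real_def)
  then show ?thesis by (rule lipschitz_on_continuous_on)
qed

lemma p_cont': "S \<subseteq> {0..<1} \<Longrightarrow> continuous_on S p"
  using continuous_on_subset p_cont by blast

lemma D_pos: "0 \<le> r \<Longrightarrow> r < 1 \<Longrightarrow> 0 < D r"
  using D_lower[of r] p_pos[of r] c0_pos by (intro less_le_trans[OF _ D_lower]) auto

lemma C0_pos: "0 < C0"
proof -
  have "0 < C0 / (p 0)\<^sup>2" using D_upper[of 0] D_pos[of 0] by linarith
  then show ?thesis using p_pos[of 0] by (simp add: zero_less_divide_iff)
qed

text \<open>Let \<open>s\<close> tend to 1 in the Lipschitz estimate, where \<open>p s\<close> tends
  to 0. With small \<open>e\<close> this makes \<open>1 / p\<close> exceed any multiple of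
  \<open>1 / (1 - r)\<close> near the boundary, which is how powers of \<open>1 - r\<close> become
  slow in \<tau>.\<close>

lemma p_le_if_lip:
  assumes "0 \<le> R" "\<And>r s. R \<le> r \<Longrightarrow> r < 1 \<Longrightarrow> R \<le> s \<Longrightarrow> s < 1 \<Longrightarrow> \<bar>p r - p s\<bar> \<le> e * \<bar>r - s\<bar>"
    and "R \<le> r" "r < 1"
  shows "p r \<le> e * (1 - r)"
proof (rule tendsto_le[OF trivial_limit_at_left_real])
  have "((\<lambda>s. p s + e * (s - r)) \<longlongrightarrow> 0 + e * (1 - r)) (at_left 1)"
    by (intro tendsto_intros p_lim)
  then show "((\<lambda>s. p s + e * (s - r)) \<longlongrightarrow> e * (1 - r)) (at_left 1)" by simp
  show "((\<lambda>s. p r) \<longlongrightarrow> p r) (at_left 1)" by simp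
  have "\<forall>\<^sub>F s in at_left 1. s \<in> {r<..<1}"
    by (rule eventually_at_left_real) (use assms in auto)
  then show "\<forall>\<^sub>F s in at_left 1. p r \<le> p s + e * (s - r)"
  proof eventually_elim
    case (elim s)
    then have "\<bar>p r - p s\<bar> \<le> e * \<bar>r - s\<bar>" using assms by (intro assms(2)) auto
    also have "\<bar>r - s\<bar> = s - r" using elim by simp
    finally show ?case by linarith
  qed
qed

lemma p_le: "0 \<le> r \<Longrightarrow> r < 1 \<Longrightarrow> p r \<le> L * (1 - r)"
  by (rule p_le_if_lip[of 0]) (use p_lip in auto)

lemma p_le_L: "0 \<le> r \<Longrightarrow> r < 1 \<Longrightarrow> p r \<le> L"
  using p_le[of r] L_pos mult_left_mono[of "1 - r" 1 L] by linarith

section \<open>The radial coordinate adapted to the weight, and functions slow in it\<close>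

definition \<tau> :: "real \<Rightarrow> real" where "\<tau> r = integral {0..r} (\<lambda>x. 1 / p x)"

lemma inv_p_cont: "S \<subseteq> {0..<1} \<Longrightarrow> continuous_on S (\<lambda>x. 1 / p x)"
  using p_pos by (intro continuous_intros p_cont') force+

lemma tau_cont_Icc: "b < 1 \<Longrightarrow> continuous_on {0..b} \<tau>"
  unfolding \<tau>_def
  by (intro indefinite_integral_continuous_1 integrable_continuous_real inv_p_cont) auto

lemma tau_cont: "S \<subseteq> {0..b} \<Longrightarrow> b < 1 \<Longrightarrow> continuous_on S \<tau>"
  using tau_cont_Icc continuous_on_subset by blast

lemma tau_deriv:
  assumes "0 < r" "r < 1"
  shows "(\<tau> has_real_derivative 1 / p r) (at r)"
proof -
  have "(\<tau> has_real_derivative 1 / p r) (at r within {0..(1+r)/2})"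
    unfolding \<tau>_def using assms
    by (intro integral_has_real_derivative inv_p_cont) auto
  moreover have "at r within {0..(1+r)/2} = at r"
    by (rule at_within_interior) (use assms in \<open>auto simp: interior_atLeastAtMost_real\<close>)
  ultimately show ?thesis by simp
qed

lemma tau_cont_Ico: "continuous_on {0..<1} \<tau>"
proof -
  have "continuous_on (\<Union>b\<in>{0<..<1}. {0..<b}) \<tau>"
  proof (rule continuous_on_eq_continuous_within[THEN iffD2, rule_format])
    fix x :: real assume "x \<in> (\<Union>b\<in>{0<..<1}. {0..<b})"
    then have x: "0 \<le> x" "x < 1" by auto
    have "continuous (at x within {0..(1+x)/2}) \<tau>"
      using tau_cont_Icc[of "(1+x)/2"] x by (auto simp: continuous_on_eq_continuous_within)
    moreover have "at x within {0..(1+x)/2} = at x within (\<Union>b\<in>{0<..<1}. {0..<b})"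
    proof (rule at_within_nhd[of x "{..<(1+x)/2}"])
      show "{0..(1+x)/2} \<inter> {..<(1+x)/2} - {x} = (\<Union>b\<in>{0<..<1}. {0..<b}) \<inter> {..<(1+x)/2} - {x}"
        using x by (auto intro!: bexI[of _ "(1+x)/2"])
    qed (use x in auto)
    ultimately show "continuous (at x within (\<Union>b\<in>{0<..<1}. {0..<b})) \<tau>" by simp
  qed
  moreover have "(\<Union>b\<in>{0<..<1}. {0..<b}) = {0..<1::real}"
  proof safe
    fix x :: real assume "x \<in> {0..<1}"
    then show "x \<in> (\<Union>b\<in>{0<..<1}. {0..<b})" by (auto intro!: bexI[of _ "(1+x)/2"])
  qed auto
  ultimately show ?thesis by simp
qed

lemma tau_mono: "0 \<le> a \<Longrightarrow> a \<le> b \<Longrightarrow> b < 1 \<Longrightarrow> \<tau> a \<le> \<tau> b"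
  by (rule deriv_nonneg_imp_le[where f' = "\<lambda>x. 1 / p x"])
     (auto intro!: tau_cont[of _ b] tau_deriv less_imp_le[OF p_pos])

text \<open>Sub-exponential growth and decay, at every rate, in the coordinate \<open>\<tau>\<close>.\<close>

definition slow :: "(real \<Rightarrow> real) \<Rightarrow> bool" where
  "slow H \<longleftrightarrow> (\<forall>r\<in>{0..<1}. 0 < H r) \<and>
     (\<forall>\<eta>>0. \<exists>C>0. \<forall>r\<in>{0..<1}. \<forall>s\<in>{0..<1}. H r \<le> C * exp (\<eta> * \<bar>\<tau> r - \<tau> s\<bar>) * H s)"

lemma slow_pos: "slow H \<Longrightarrow> 0 \<le> r \<Longrightarrow> r < 1 \<Longrightarrow> 0 < H r"
  by (auto simp: slow_def)

lemma slowE: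
  assumes "slow H" "0 < \<eta>"
  obtains C where "0 < C"
    "\<And>r s. 0 \<le> r \<Longrightarrow> r < 1 \<Longrightarrow> 0 \<le> s \<Longrightarrow> s < 1 \<Longrightarrow> H r \<le> C * exp (\<eta> * \<bar>\<tau> r - \<tau> s\<bar>) * H s"
  using assms unfolding slow_def by (metis atLeastLessThan_iff)

text \<open>Pairs in \<open>[0, R]\<close> cost the ratio \<open>M / m\<close>, pairs beyond
  \<open>R\<close> are covered by \<open>bnd\<close>, and a pair on both sides of \<open>R\<close>
  is joined through \<open>R\<close>. Since \<open>R\<close> may depend on the rate, only the
  behaviour near 1 has to be examined.\<close>

lemma slowI:
  assumes pos: "\<And>r. 0 \<le> r \<Longrightarrow> r < 1 \<Longrightarrow> 0 < H r"
    and bdd: "\<And>R. 0 \<le> R \<Longrightarrow> R < 1 \<Longrightarrow> \<exists>m M. 0 < m \<and> (\<forall>r\<in>{0..R}. m \<le> H r \<and> H r \<le> M)"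
    and bnd: "\<And>\<eta>. 0 < \<eta> \<Longrightarrow> \<exists>R C. 0 \<le> R \<and> R < 1 \<and> 0 < C \<and> (\<forall>r s. R \<le> r \<longrightarrow> r \<le> s \<longrightarrow> s < 1 \<longrightarrow>
              H r \<le> C * exp (\<eta> * (\<tau> s - \<tau> r)) * H s \<and> H s \<le> C * exp (\<eta> * (\<tau> s - \<tau> r)) * H r)"
  shows "slow H"
  unfolding slow_def
proof (intro conjI ballI allI impI)
  fix \<eta> :: real assume \<eta>: "0 < \<eta>"
  from bnd[OF this] obtain R C where R: "0 \<le> R" "R < 1" and C: "0 < C"
    and near: "\<And>r s. R \<le> r \<Longrightarrow> r \<le> s \<Longrightarrow> s < 1 \<Longrightarrow> H r \<le> C * exp (\<eta> * (\<tau> s - \<tau> r)) * H s"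
      "\<And>r s. R \<le> r \<Longrightarrow> r \<le> s \<Longrightarrow> s < 1 \<Longrightarrow> H s \<le> C * exp (\<eta> * (\<tau> s - \<tau> r)) * H r" by blast
  from bdd[OF R] obtain m M where m: "0 < m" and mM: "\<And>r. 0 \<le> r \<Longrightarrow> r \<le> R \<Longrightarrow> m \<le> H r \<and> H r \<le> M"
    by force
  have M: "m \<le> M" using mM[of 0] R by auto
  have ratio: "H r \<le> M / m * H s" if "0 \<le> r" "r \<le> R" "0 \<le> s" "s \<le> R" for r s
  proof -
    have "H r \<le> M / m * m" using mM[of r] that m by simp
    also have "\<dots> \<le> M / m * H s" using mM[of s] that m M by (intro mult_left_mono) auto
    finally show ?thesis .
  qed
  have MM: "1 \<le> M / m" using m M by simp
  \<comment> \<open>Chosen to dominate \<open>M / m\<close>, \<open>C\<close> and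
    \<open>C * (M / m)\<close>, the constants of the three cases below.\<close>
  define K where "K = (C + 1) * (M / m)"
  have Kgen: "Q \<le> (C + 1) * Q \<and> C \<le> (C + 1) * Q \<and> C * Q \<le> (C + 1) * Q" if "1 \<le> Q" for Q
  proof -
    have "C * 1 \<le> C * Q" by (rule mult_left_mono) (use C that in auto)
    moreover have "(C + 1) * Q = C * Q + Q" by (simp add: distrib_right)
    ultimately show ?thesis using C that by linarith
  qed
  have K: "M / m \<le> K" "C \<le> K" "C * (M / m) \<le> K"
    unfolding K_def using Kgen[OF MM] by blast+
  have main: "H r \<le> K * exp (\<eta> * (\<tau> s - \<tau> r)) * H s \<and> H s \<le> K * exp (\<eta> * (\<tau> s - \<tau> r)) * H r"
    if rs: "0 \<le> r" "r \<le> s" "s < 1" for r s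
  proof -
    have H: "0 < H r" "0 < H s" using pos rs by auto
    have e: "1 \<le> exp (\<eta> * (\<tau> s - \<tau> r))" using tau_mono rs \<eta> by auto
    consider "s \<le> R" | "R \<le> r" | "r \<le> R" "R \<le> s" by linarith
    then show ?thesis
    proof cases
      case 1
      have *: "M / m * x \<le> K * exp (\<eta> * (\<tau> s - \<tau> r)) * x" if "0 < x" for x
        using K(1) MM that mult_mono[OF K(1) e] by (intro mult_right_mono) auto
      show ?thesis using ratio[of r s] ratio[of s r] 1 rs *[OF H(2)] *[OF H(1)] by linarith
    next
      case 2
      have *: "C * exp (\<eta> * (\<tau> s - \<tau> r)) * x \<le> K * exp (\<eta> * (\<tau> s - \<tau> r)) * x" if "0 < x" for x
        using K that by (intro mult_right_mono) auto
      show ?thesis using near[OF 2 rs(2,3)] *[OF H(2)] *[OF H(1)] by linarith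
    next
      case 3
      have t: "exp (\<eta> * (\<tau> s - \<tau> R)) \<le> exp (\<eta> * (\<tau> s - \<tau> r))"
        using tau_mono[of r R] 3 rs R \<eta> by auto
      have *: "C * exp (\<eta> * (\<tau> s - \<tau> R)) * (M / m * x) \<le> K * exp (\<eta> * (\<tau> s - \<tau> r)) * x" if "0 < x" for x
      proof -
        have "C * exp (\<eta> * (\<tau> s - \<tau> R)) * (M / m * x) = C * (M / m) * exp (\<eta> * (\<tau> s - \<tau> R)) * x" by simp
        also have "\<dots> \<le> K * exp (\<eta> * (\<tau> s - \<tau> r)) * x"
          using K t C MM that by (intro mult_right_mono mult_mono) auto
        finally show ?thesis .
      qed
      have "H r \<le> M / m * H R" using ratio[of r R] 3 rs R by auto
      also have "\<dots> \<le> M / m * (C * exp (\<eta> * (\<tau> s - \<tau> R)) * H s)"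
        using near(1)[of R s] 3 rs MM by (intro mult_left_mono) auto
      finally have 1: "H r \<le> C * exp (\<eta> * (\<tau> s - \<tau> R)) * (M / m * H s)" by (simp add: mult_ac)
      have "H s \<le> C * exp (\<eta> * (\<tau> s - \<tau> R)) * H R" using near(2)[of R s] 3 rs by auto
      also have "\<dots> \<le> C * exp (\<eta> * (\<tau> s - \<tau> R)) * (M / m * H r)"
        using ratio[of R r] 3 rs R C by (intro mult_left_mono) auto
      finally show ?thesis using 1 *[OF H(2)] *[OF H(1)] by linarith
    qed
  qed
  show "\<exists>C>0. \<forall>r\<in>{0..<1}. \<forall>s\<in>{0..<1}. H r \<le> C * exp (\<eta> * \<bar>\<tau> r - \<tau> s\<bar>) * H s"
  proof (intro exI[of _ K] conjI ballI)
    show "0 < K" using K C by linarith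
    fix r s :: real assume "r \<in> {0..<1}" "s \<in> {0..<1}"
    then show "H r \<le> K * exp (\<eta> * \<bar>\<tau> r - \<tau> s\<bar>) * H s"
      using main[of r s] main[of s r] tau_mono[of r s] tau_mono[of s r]
      by (cases "r \<le> s") (auto simp: abs_if not_less split: if_splits)
  qed
qed (use pos in auto)

lemma slow_mult:
  assumes "slow f" "slow g"
  shows "slow (\<lambda>r. f r * g r)"
  unfolding slow_def
proof (intro conjI ballI allI impI)
  fix \<eta> :: real assume \<eta>: "0 < \<eta>"
  obtain C where C: "0 < C" "\<And>r s. 0 \<le> r \<Longrightarrow> r < 1 \<Longrightarrow> 0 \<le> s \<Longrightarrow> s < 1 \<Longrightarrow> f r \<le> C * exp (\<eta>/2 * \<bar>\<tau> r - \<tau> s\<bar>) * f s"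
    using slowE[OF assms(1), of "\<eta>/2"] \<eta> by auto
  obtain B where B: "0 < B" "\<And>r s. 0 \<le> r \<Longrightarrow> r < 1 \<Longrightarrow> 0 \<le> s \<Longrightarrow> s < 1 \<Longrightarrow> g r \<le> B * exp (\<eta>/2 * \<bar>\<tau> r - \<tau> s\<bar>) * g s"
    using slowE[OF assms(2), of "\<eta>/2"] \<eta> by auto
  show "\<exists>C>0. \<forall>r\<in>{0..<1}. \<forall>s\<in>{0..<1}. f r * g r \<le> C * exp (\<eta> * \<bar>\<tau> r - \<tau> s\<bar>) * (f s * g s)"
  proof (intro exI[of _ "C * B"] conjI ballI)
    fix r s :: real assume rs: "r \<in> {0..<1}" "s \<in> {0..<1}"
    have "f r * g r \<le> (C * exp (\<eta>/2 * \<bar>\<tau> r - \<tau> s\<bar>) * f s) * (B * exp (\<eta>/2 * \<bar>\<tau> r - \<tau> s\<bar>) * g s)"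
      using rs C B slow_pos[OF assms(1)] slow_pos[OF assms(2)]
      by (intro mult_mono) (auto intro!: mult_nonneg_nonneg less_imp_le)
    also have "\<dots> = C * B * (exp (\<eta>/2 * \<bar>\<tau> r - \<tau> s\<bar>) * exp (\<eta>/2 * \<bar>\<tau> r - \<tau> s\<bar>)) * (f s * g s)" by simp
    also have "exp (\<eta>/2 * \<bar>\<tau> r - \<tau> s\<bar>) * exp (\<eta>/2 * \<bar>\<tau> r - \<tau> s\<bar>) = exp (\<eta> * \<bar>\<tau> r - \<tau> s\<bar>)"
      by (simp flip: exp_add)
    finally show "f r * g r \<le> C * B * exp (\<eta> * \<bar>\<tau> r - \<tau> s\<bar>) * (f s * g s)" .
  qed (use C B in auto)
qed (use assms in \<open>auto simp: slow_def\<close>)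

lemma slow_inverse:
  assumes "slow f"
  shows "slow (\<lambda>r. inverse (f r))"
  unfolding slow_def
proof (intro conjI ballI allI impI)
  fix \<eta> :: real assume \<eta>: "0 < \<eta>"
  obtain C where C: "0 < C" "\<And>r s. 0 \<le> r \<Longrightarrow> r < 1 \<Longrightarrow> 0 \<le> s \<Longrightarrow> s < 1 \<Longrightarrow> f r \<le> C * exp (\<eta> * \<bar>\<tau> r - \<tau> s\<bar>) * f s"
    using slowE[OF assms(1), of "\<eta>"] \<eta> by auto
  show "\<exists>C>0. \<forall>r\<in>{0..<1}. \<forall>s\<in>{0..<1}. inverse (f r) \<le> C * exp (\<eta> * \<bar>\<tau> r - \<tau> s\<bar>) * inverse (f s)"
  proof (intro exI[of _ C] conjI ballI)
    fix r s :: real assume rs: "r \<in> {0..<1}" "s \<in> {0..<1}"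
    then have "f s \<le> C * exp (\<eta> * \<bar>\<tau> r - \<tau> s\<bar>) * f r"
      using C(2)[of s r] by (simp add: abs_minus_commute)
    then show "inverse (f r) \<le> C * exp (\<eta> * \<bar>\<tau> r - \<tau> s\<bar>) * inverse (f s)"
      using slow_pos[OF assms, of r] slow_pos[OF assms, of s] rs by (simp add: field_simps)
  qed (use C in auto)
qed (use assms in \<open>auto simp: slow_def\<close>)

lemma slow_const: "0 < c \<Longrightarrow> slow (\<lambda>r. c)"
  unfolding slow_def by (auto intro!: exI[of _ 1])

lemma slow_powr_nonneg:
  assumes "slow f" "0 < a"
  shows "slow (\<lambda>r. f r powr a)"
  unfolding slow_def
proof (intro conjI ballI allI impI)
  fix \<eta> :: real assume \<eta>: "0 < \<eta>"
  obtain C where C: "0 < C" "\<And>r s. 0 \<le> r \<Longrightarrow> r < 1 \<Longrightarrow> 0 \<le> s \<Longrightarrow> s < 1 \<Longrightarrow> f r \<le> C * exp (\<eta>/a * \<bar>\<tau> r - \<tau> s\<bar>) * f s"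
    using slowE[OF assms(1), of "\<eta>/a"] \<eta> assms by auto
  show "\<exists>C>0. \<forall>r\<in>{0..<1}. \<forall>s\<in>{0..<1}. f r powr a \<le> C * exp (\<eta> * \<bar>\<tau> r - \<tau> s\<bar>) * f s powr a"
  proof (intro exI[of _ "C powr a"] conjI ballI)
    fix r s :: real assume rs: "r \<in> {0..<1}" "s \<in> {0..<1}"
    then have "f r powr a \<le> (C * exp (\<eta>/a * \<bar>\<tau> r - \<tau> s\<bar>) * f s) powr a"
      using C(2)[of r s] assms slow_pos[OF assms(1), of r] by (intro powr_mono2) auto
    also have "\<dots> = C powr a * exp (\<eta> * \<bar>\<tau> r - \<tau> s\<bar>) * f s powr a"
      using C(1) assms slow_pos[OF assms(1), of s] rs by (simp add: powr_mult exp_powr_real)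
    finally show "f r powr a \<le> C powr a * exp (\<eta> * \<bar>\<tau> r - \<tau> s\<bar>) * f s powr a" .
  qed (use C in auto)
qed (use slow_pos[OF assms(1)] in fastforce)

lemma slow_cong:
  assumes "\<And>r. 0 \<le> r \<Longrightarrow> r < 1 \<Longrightarrow> f r = g r"
  shows "slow f \<longleftrightarrow> slow g"
  unfolding slow_def using assms by auto

lemma slow_powr:
  assumes "slow f"
  shows "slow (\<lambda>r. f r powr a)"
proof -
  consider "a = 0" | "a > 0" | "a < 0" by linarith
  then show ?thesis
  proof cases
    case 1
    have "slow (\<lambda>r. f r powr a) \<longleftrightarrow> slow (\<lambda>r. 1)"
      using 1 slow_pos[OF assms] by (intro slow_cong) force
    then show ?thesis using slow_const[of 1] by simp
  next
    case 2
    then show ?thesis using slow_powr_nonneg assms by blast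
  next
    case 3
    then have "slow (\<lambda>r. inverse (f r powr (-a)))"
      using slow_powr_nonneg[OF assms, of "-a"] slow_inverse by auto
    then show ?thesis by (simp add: powr_minus)
  qed
qed

text \<open>A Gronwall argument: if \<open>p\<close> is \<open>e\<close>-Lipschitz, then \<open>1 / p x\<close> dominates the logarithmic
  derivative of the affine majorant of \<open>p\<close>, divided by \<open>e\<close>.\<close>

lemma p_ratio_if_lip:
  assumes "0 \<le> R" "0 < e"
    "\<And>r s. R \<le> r \<Longrightarrow> r < 1 \<Longrightarrow> R \<le> s \<Longrightarrow> s < 1 \<Longrightarrow> \<bar>p r - p s\<bar> \<le> e * \<bar>r - s\<bar>"
    and "R \<le> a" "a \<le> b" "b < 1"
  shows "p a \<le> exp (e * (\<tau> b - \<tau> a)) * p b" "p b \<le> exp (e * (\<tau> b - \<tau> a)) * p a"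
proof -
  have pp: "0 < p a" "0 < p b" using p_pos assms by auto
  have "e * \<tau> a - ln (p a + e * (a - a)) \<le> e * \<tau> b - ln (p a + e * (b - a))"
  proof (rule deriv_nonneg_imp_le[where f = "\<lambda>x. e * \<tau> x - ln (p a + e * (x - a))"
        and f' = "\<lambda>x. e * (1 / p x) - e / (p a + e * (x - a))"])
    show "continuous_on {a..b} (\<lambda>x. e * \<tau> x - ln (p a + e * (x - a)))"
      using assms pp by (intro continuous_intros tau_cont[of _ b]) (auto simp: add_pos_nonneg add_nonneg_eq_0_iff)
    fix x assume x: "a < x" "x < b"
    have pos: "0 < p a + e * (x - a)" using x pp assms by (intro add_pos_nonneg) auto
    show "((\<lambda>x. e * \<tau> x - ln (p a + e * (x - a))) has_real_derivative
             e * (1 / p x) - e / (p a + e * (x - a))) (at x)"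
      using x assms pos by (auto intro!: derivative_eq_intros tau_deriv)
    have "p x \<le> p a + e * (x - a)" using assms(3)[of x a] x assms by auto
    then show "0 \<le> e * (1 / p x) - e / (p a + e * (x - a))"
      using p_pos[of x] x assms by (auto intro!: divide_left_mono mult_pos_pos pos)
  qed (use assms in auto)
  then have "ln (p a + e * (b - a)) \<le> e * (\<tau> b - \<tau> a) + ln (p a)" by (simp add: algebra_simps)
  then have "p a + e * (b - a) \<le> exp (e * (\<tau> b - \<tau> a) + ln (p a))"
    using pp assms by (subst ln_le_cancel_iff[symmetric]) (auto intro!: add_pos_nonneg)
  moreover have "p b \<le> p a + e * (b - a)" using assms(3)[of b a] assms by auto
  ultimately show "p b \<le> exp (e * (\<tau> b - \<tau> a)) * p a" using pp by (simp add: exp_add)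
  \<comment> \<open>Mirror image: seen from \<open>b\<close>, the affine majorant is
    \<open>p b + e * (b - x)\<close>, whose logarithm decreases.\<close>
  have "e * \<tau> a + ln (p b + e * (b - a)) \<le> e * \<tau> b + ln (p b + e * (b - b))"
  proof (rule deriv_nonneg_imp_le[where f = "\<lambda>x. e * \<tau> x + ln (p b + e * (b - x))"
        and f' = "\<lambda>x. e * (1 / p x) - e / (p b + e * (b - x))"])
    show "continuous_on {a..b} (\<lambda>x. e * \<tau> x + ln (p b + e * (b - x)))"
      using assms pp by (intro continuous_intros tau_cont[of _ b]) (auto simp: add_pos_nonneg add_nonneg_eq_0_iff)
    fix x assume x: "a < x" "x < b"
    have pos: "0 < p b + e * (b - x)" using x pp assms by (intro add_pos_nonneg) auto
    show "((\<lambda>x. e * \<tau> x + ln (p b + e * (b - x))) has_real_derivative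
             e * (1 / p x) - e / (p b + e * (b - x))) (at x)"
      using x assms pos by (auto intro!: derivative_eq_intros tau_deriv)
    have "p x \<le> p b + e * (b - x)" using assms(3)[of x b] x assms by auto
    then show "0 \<le> e * (1 / p x) - e / (p b + e * (b - x))"
      using p_pos[of x] x assms by (auto intro!: divide_left_mono mult_pos_pos pos)
  qed (use assms in auto)
  then have "ln (p b + e * (b - a)) \<le> e * (\<tau> b - \<tau> a) + ln (p b)" by (simp add: algebra_simps)
  then have "p b + e * (b - a) \<le> exp (e * (\<tau> b - \<tau> a) + ln (p b))"
    using pp assms by (subst ln_le_cancel_iff[symmetric]) (auto intro!: add_pos_nonneg)
  moreover have "p a \<le> p b + e * (b - a)" using assms(3)[of b a] assms by auto
  ultimately show "p a \<le> exp (e * (\<tau> b - \<tau> a)) * p b" using pp by (simp add: exp_add)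
qed

text \<open>Rate \<open>\<eta>\<close> is reached by working where \<open>p\<close> is
  \<open>\<eta>\<close>-Lipschitz; the compact exceptional sets in \<open>class_L0\<close> enter
  here.\<close>

lemma slow_p: "slow p"
proof (rule slowI)
  fix R :: real assume R: "0 \<le> R" "R < 1"
  have "continuous_on {0..R} p" using R by (intro p_cont') auto
  then obtain x where x: "x \<in> {0..R}" "\<And>y. y \<in> {0..R} \<Longrightarrow> p x \<le> p y"
    using continuous_attains_inf[of "{0..R}" p] R by auto
  then show "\<exists>m M. 0 < m \<and> (\<forall>r\<in>{0..R}. m \<le> p r \<and> p r \<le> M)"
    using p_le_L R by (intro exI[of _ "p x"] exI[of _ L]) (auto intro!: p_pos)
next
  fix \<eta> :: real assume \<eta>: "0 < \<eta>"
  obtain R where "0 \<le> R" "R < 1" "\<And>r s. R \<le> r \<Longrightarrow> r < 1 \<Longrightarrow> R \<le> s \<Longrightarrow> s < 1 \<Longrightarrow> \<bar>p r - p s\<bar> \<le> \<eta> * \<bar>r - s\<bar>"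
    using p_small_lip[OF \<eta>] by blast
  then show "\<exists>R C. 0 \<le> R \<and> R < 1 \<and> 0 < C \<and> (\<forall>r s. R \<le> r \<longrightarrow> r \<le> s \<longrightarrow> s < 1 \<longrightarrow>
              p r \<le> C * exp (\<eta> * (\<tau> s - \<tau> r)) * p s \<and> p s \<le> C * exp (\<eta> * (\<tau> s - \<tau> r)) * p r)"
    using p_ratio_if_lip[of R \<eta>] \<eta> by (intro exI[of _ R] exI[of _ 1]) auto
qed (rule p_pos)

end

section \<open>Moments of the weight\<close>

text \<open>A bounded increasing function whose derivative dominates
  \<open>exp (- \<bar>y\<bar>) / 4\<close>. As a comparison primitive it bounds integrals and sums
  of two-sided exponentials without splitting at the centre.\<close>

definition sigmoid :: "real \<Rightarrow> real" where "sigmoid y = 1 / (1 + exp (- y))"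

lemma sigmoid_bounds: "0 \<le> sigmoid y" "sigmoid y \<le> 1"
  by (auto simp: sigmoid_def divide_simps add_pos_pos)

lemma sigmoid_deriv: "(sigmoid has_real_derivative exp (- y) / (1 + exp (- y))\<^sup>2) (at y)"
proof -
  have "1 + exp (- y) \<noteq> 0" using exp_gt_zero[of "-y"] by linarith
  then show ?thesis unfolding sigmoid_def
    by (auto intro!: derivative_eq_intros simp: power2_eq_square)
qed

text \<open>The derivative is even in \<open>y\<close>, and for \<open>y \<ge> 0\<close> its
  denominator is at most 4.\<close>

lemma sigmoid_deriv_ge: "exp (- \<bar>y\<bar>) \<le> 4 * (exp (- y) / (1 + exp (- y))\<^sup>2)" for y :: real
proof -
  have *: "exp (- z) \<le> 4 * (exp (- z) / (1 + exp (- z))\<^sup>2)" if "0 \<le> z" for z :: real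
  proof -
    have "(1 + exp (- z))\<^sup>2 \<le> 2\<^sup>2" using that by (intro power_mono) (auto simp: add_nonneg_nonneg)
    then have "(1 + exp (- z))\<^sup>2 * exp (- z) \<le> 4 * exp (- z)" by (intro mult_right_mono) auto
    moreover have "0 < (1 + exp (- z))\<^sup>2" using exp_gt_zero[of "-z"] by (intro zero_less_power) linarith
    ultimately show ?thesis by (simp add: field_simps)
  qed
  have sym: "exp y / (1 + exp y)\<^sup>2 = exp (- y) / (1 + exp (- y))\<^sup>2"
    by (simp add: exp_minus field_simps power2_eq_square add_pos_pos add_eq_0_iff)
  show ?thesis using *[of y] *[of "-y"] sym by (cases "0 \<le> y") auto
qed

text \<open>The fundamental theorem is applied on compact intervals exhausting
  \<open>(a, b)\<close>, because \<open>G\<close> need not extend continuously to the end points; a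
  uniform bound on its increments survives monotone convergence.\<close>

lemma nn_integral_deriv_le_borel:
  fixes f G :: "real \<Rightarrow> real"
  assumes f: "f \<in> borel_measurable borel"
    and deriv: "\<And>x. a < x \<Longrightarrow> x < b \<Longrightarrow> (G has_real_derivative f x) (at x)"
    and nn: "\<And>x. a < x \<Longrightarrow> x < b \<Longrightarrow> 0 \<le> f x"
    and bd: "\<And>x y. a < x \<Longrightarrow> x \<le> y \<Longrightarrow> y < b \<Longrightarrow> G y - G x \<le> M"
    and M: "0 \<le> M"
  shows "(\<integral>\<^sup>+x\<in>{a<..<b}. ennreal (f x) \<partial>lborel) \<le> ennreal M"
proof (cases "a < b")
  case True
  \<comment> \<open>The shift by 2 keeps \<open>l n \<le> h n\<close> already for
    \<open>n = 0\<close>.\<close>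
  define l h where "l n = a + (b - a) / (real n + 2)" and "h n = b - (b - a) / (real n + 2)" for n
  have lh: "a < l n" "l n \<le> h n" "h n < b" for n
  proof -
    have "(b - a) / (real n + 2) \<le> (b - a) / 2" using True by (intro divide_left_mono) auto
    moreover have "(b - a) / (real n + 2) > 0" using True by (intro divide_pos_pos) auto
    moreover have "(b - a) / 2 = b / 2 - a / 2" by (simp add: diff_divide_distrib)
    ultimately show "a < l n" "l n \<le> h n" "h n < b" unfolding l_def h_def by linarith+
  qed
  have U: "{a<..<b} = (\<Union>n. {l n..h n})"
  proof safe
    fix x assume "x \<in> {a<..<b}"
    then have x: "a < x" "x < b" by auto
    define e where "e = min (x - a) (b - x)"
    have e: "0 < e" using x by (auto simp: e_def)
    obtain n :: nat where n: "(b - a) / e < real n" using reals_Archimedean2 by blast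
    have "(b - a) / (real n + 2) \<le> e"
      using n e by (simp add: field_simps)
    then show "x \<in> (\<Union>n. {l n..h n})" by (auto simp: l_def h_def e_def intro!: exI[of _ n])
  next
    fix x n assume "x \<in> {l n..h n}" then show "x \<in> {a<..<b}" using lh[of n] by auto
  qed
  have inc: "incseq (\<lambda>n. {l n..h n})"
  proof (rule incseq_SucI)
    fix n
    have "(b - a) / (real (Suc n) + 2) \<le> (b - a) / (real n + 2)" using True by (intro divide_left_mono) auto
    then show "{l n..h n} \<subseteq> {l (Suc n)..h (Suc n)}" by (auto simp: l_def h_def)
  qed
  have "(\<integral>\<^sup>+x\<in>{a<..<b}. ennreal (f x) \<partial>lborel) = (SUP n. \<integral>\<^sup>+x\<in>{l n..h n}. ennreal (f x) \<partial>lborel)"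
  proof -
    have "emeasure (density lborel (\<lambda>x. ennreal (f x))) (\<Union>n. {l n..h n}) =
        (SUP n. emeasure (density lborel (\<lambda>x. ennreal (f x))) {l n..h n})"
      by (rule SUP_emeasure_incseq[symmetric]) (use inc in auto)
    then show ?thesis unfolding U using f by (simp add: emeasure_density)
  qed
  also have "\<dots> \<le> ennreal M"
  proof (rule SUP_least)
    fix n
    have "(\<integral>\<^sup>+x\<in>{l n..h n}. ennreal (f x) \<partial>lborel) = ennreal (G (h n) - G (l n))"
      using lh[of n] by (intro nn_integral_FTC_Icc f DERIV_subset[OF deriv]) (auto intro!: nn)
    also have "\<dots> \<le> ennreal M" using bd lh[of n] by (intro ennreal_leI) auto
    finally show "(\<integral>\<^sup>+x\<in>{l n..h n}. ennreal (f x) \<partial>lborel) \<le> ennreal M" .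
  qed
  finally show ?thesis .
qed auto

lemma nn_integral_deriv_le:
  fixes f G :: "real \<Rightarrow> real"
  assumes f: "continuous_on {a<..<b} f"
    and deriv: "\<And>x. a < x \<Longrightarrow> x < b \<Longrightarrow> (G has_real_derivative f x) (at x)"
    and nn: "\<And>x. a < x \<Longrightarrow> x < b \<Longrightarrow> 0 \<le> f x"
    and bd: "\<And>x y. a < x \<Longrightarrow> x \<le> y \<Longrightarrow> y < b \<Longrightarrow> G y - G x \<le> M"
    and M: "0 \<le> M"
  shows "(\<integral>\<^sup>+x\<in>{a<..<b}. ennreal (f x) \<partial>lborel) \<le> ennreal M"
proof -
  define g where "g x = indicator {a<..<b} x *\<^sub>R f x" for x
  have "(\<integral>\<^sup>+x\<in>{a<..<b}. ennreal (f x) \<partial>lborel) = (\<integral>\<^sup>+x\<in>{a<..<b}. ennreal (g x) \<partial>lborel)"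
    by (intro nn_integral_cong) (auto simp: g_def split: split_indicator)
  also have "\<dots> \<le> ennreal M"
  proof (rule nn_integral_deriv_le_borel[where G = G])
    show "g \<in> borel_measurable borel"
      unfolding g_def by (rule borel_measurable_continuous_on_indicator) (use f in auto)
  qed (use assms in \<open>auto simp: g_def\<close>)
  finally show ?thesis .
qed

section \<open>Growth of \<open>\<psi>\<close> and location of the peaks\<close>

context radial_profile
begin

lemma tau_0: "\<tau> 0 = 0"
  by (simp add: \<tau>_def)

lemma tau_nonneg: "0 \<le> r \<Longrightarrow> r < 1 \<Longrightarrow> 0 \<le> \<tau> r"
  using tau_mono[of 0 r] by (simp add: tau_0)

lemma psi_cont': "S \<subseteq> {0..<1} \<Longrightarrow> continuous_on S \<psi>"
  using continuous_on_subset psi_cont by blast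

lemma psi_less: "0 \<le> a \<Longrightarrow> a < b \<Longrightarrow> b < 1 \<Longrightarrow> \<psi> a < \<psi> b"
  by (rule DERIV_pos_imp_increasing_open) (auto intro!: psi_cont' exI psi_deriv mult_pos_pos D_pos)

lemma psi_mono: "0 \<le> a \<Longrightarrow> a \<le> b \<Longrightarrow> b < 1 \<Longrightarrow> \<psi> a \<le> \<psi> b"
  using psi_less[of a b] by (cases "a = b") auto

lemma psi_nonneg: "0 \<le> r \<Longrightarrow> r < 1 \<Longrightarrow> 0 \<le> \<psi> r"
  using psi_mono[of 0 r] by (simp add: psi_0)

text \<open>From \<open>p x \<le> L * (1 - x)\<close> the derivative \<open>x * D x\<close> is at
  least \<open>K / (1 - x)\<^sup>2\<close> on \<open>[1/2, 1)\<close>, and the primitive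
  \<open>K / (1 - x)\<close> is unbounded. Hence every level \<open>n + 1/2\<close> is
  attained.\<close>

lemma psi_unbounded: "\<exists>r. 0 < r \<and> r < 1 \<and> y \<le> \<psi> r"
proof -
  define K where "K = c0 / (2 * L\<^sup>2)"
  have K: "0 < K" using c0_pos L_pos by (auto simp: K_def)
  have grow: "\<psi> (1/2) - K / (1 - 1/2) \<le> \<psi> r - K / (1 - r)" if r: "1/2 \<le> r" "r < 1" for r
  proof (rule deriv_nonneg_imp_le[where f = "\<lambda>x. \<psi> x - K / (1 - x)" and f' = "\<lambda>x. x * D x - K / (1 - x)\<^sup>2"])
    show "continuous_on {1/2..r} (\<lambda>x. \<psi> x - K / (1 - x))"
      using r by (intro continuous_intros psi_cont') auto
    fix x assume x: "1/2 < x" "x < r"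
    show "((\<lambda>x. \<psi> x - K / (1 - x)) has_real_derivative x * D x - K / (1 - x)\<^sup>2) (at x)"
      using x r by (auto intro!: derivative_eq_intros psi_deriv simp: power2_eq_square)
    have "(p x)\<^sup>2 \<le> (L * (1 - x))\<^sup>2" using p_le[of x] p_pos[of x] x r by (intro power_mono) auto
    then have "c0 / (L * (1 - x))\<^sup>2 \<le> c0 / (p x)\<^sup>2"
      using c0_pos p_pos[of x] x r L_pos by (intro divide_left_mono) auto
    also have "\<dots> \<le> D x" using D_lower x r by auto
    finally have "1/2 * (c0 / (L * (1 - x))\<^sup>2) \<le> x * D x"
      using x r c0_pos D_pos[of x] by (intro mult_mono) auto
    then show "0 \<le> x * D x - K / (1 - x)\<^sup>2" by (simp add: K_def power_mult_distrib)
  qed (use r in auto)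
  \<comment> \<open>\<open>2 * K\<close> is the value of \<open>K / (1 - x)\<close> at
    \<open>1/2\<close>; \<open>r\<close> is then chosen so that \<open>K / (1 - r)\<close> is at
    least \<open>M\<close>.\<close>
  define M where "M = \<bar>y - \<psi> (1/2)\<bar> + 2 * K"
  have M: "0 < M" using K by (auto simp: M_def)
  define r where "r = max (1/2) (1 - K / M)"
  have r: "1/2 \<le> r" "r < 1" using K M by (auto simp: r_def)
  have "1 - r \<le> K / M" by (auto simp: r_def)
  then have "M \<le> K / (1 - r)" using K M r by (simp add: field_simps)
  then have "y \<le> \<psi> r" using grow[OF r] by (auto simp: M_def)
  then show ?thesis using r by (intro exI[of _ r]) auto
qed

text \<open>The maximum point of \<open>r\<^bsup>2n+1\<^esup> exp (-2 u r)\<close>, as \<open>expo_deriv\<close> below shows.\<close>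

definition peak :: "nat \<Rightarrow> real" where
  "peak n = (SOME r. 0 < r \<and> r < 1 \<and> \<psi> r = real n + 1/2)"

lemma peak: "0 < peak n" "peak n < 1" "\<psi> (peak n) = real n + 1/2"
proof -
  obtain b where b: "0 < b" "b < 1" "real n + 1/2 \<le> \<psi> b" using psi_unbounded by blast
  obtain r where r: "0 \<le> r" "r \<le> b" "\<psi> r = real n + 1/2"
    using IVT'[of \<psi> 0 "real n + 1/2" b, OF _ _ _ psi_cont'] b psi_0 by fastforce
  then have "r \<noteq> 0" using psi_0 by auto
  then have "0 < r \<and> r < 1 \<and> \<psi> r = real n + 1/2" using r b by auto
  then have "0 < peak n \<and> peak n < 1 \<and> \<psi> (peak n) = real n + 1/2" unfolding peak_def by (rule someI)
  then show "0 < peak n" "peak n < 1" "\<psi> (peak n) = real n + 1/2" by auto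
qed

lemma peak_less:
  assumes "n < m"
  shows "peak n < peak m"
proof (rule ccontr)
  assume "\<not> peak n < peak m"
  then have "\<psi> (peak m) \<le> \<psi> (peak n)"
    using peak(1)[of m] peak(2)[of n] by (intro psi_mono) auto
  then show False using peak(3)[of m] peak(3)[of n] assms by simp
qed

lemma peak_0_le: "peak 0 \<le> peak n"
  using peak_less[of 0 n] by (cases "n = 0") auto

abbreviation \<tau>p where "\<tau>p n \<equiv> \<tau> (peak n)"

abbreviation pp where "pp n \<equiv> p (peak n)"

lemma pp_pos: "0 < pp n"
  using less_imp_le[OF peak(1)] peak(2) by (intro p_pos)

text \<open>Comparison of \<open>p\<close> at rate 1, fixed once because \<open>A\<close> and
  \<open>B\<close> are built from it. Rate 1 matches the derivative of \<open>exp (\<tau> x)\<close>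
  in the integrations below.\<close>

definition C1 where "C1 = (SOME C. 0 < C \<and> (\<forall>r s. 0 \<le> r \<longrightarrow> r < 1 \<longrightarrow> 0 \<le> s \<longrightarrow> s < 1 \<longrightarrow> p r \<le> C * exp \<bar>\<tau> r - \<tau> s\<bar> * p s))"

lemma C1: "0 < C1" "0 \<le> r \<Longrightarrow> r < 1 \<Longrightarrow> 0 \<le> s \<Longrightarrow> s < 1 \<Longrightarrow> p r \<le> C1 * exp \<bar>\<tau> r - \<tau> s\<bar> * p s"
proof -
  obtain C where "0 < C" "\<And>r s. 0 \<le> r \<Longrightarrow> r < 1 \<Longrightarrow> 0 \<le> s \<Longrightarrow> s < 1 \<Longrightarrow> p r \<le> C * exp (1 * \<bar>\<tau> r - \<tau> s\<bar>) * p s"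
    using slowE[OF slow_p, of 1] by auto
  then have "0 < C \<and> (\<forall>r s. 0 \<le> r \<longrightarrow> r < 1 \<longrightarrow> 0 \<le> s \<longrightarrow> s < 1 \<longrightarrow> p r \<le> C * exp \<bar>\<tau> r - \<tau> s\<bar> * p s)"
    by simp
  then have *: "0 < C1 \<and> (\<forall>r s. 0 \<le> r \<longrightarrow> r < 1 \<longrightarrow> 0 \<le> s \<longrightarrow> s < 1 \<longrightarrow> p r \<le> C1 * exp \<bar>\<tau> r - \<tau> s\<bar> * p s)"
    unfolding C1_def by (rule someI)
  then show "0 < C1" by blast
  show "0 \<le> r \<Longrightarrow> r < 1 \<Longrightarrow> 0 \<le> s \<Longrightarrow> s < 1 \<Longrightarrow> p r \<le> C1 * exp \<bar>\<tau> r - \<tau> s\<bar> * p s"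
    using * by blast
qed

lemma inv_p_le:
  assumes "0 \<le> x" "x < 1" "0 \<le> r" "r < 1"
  shows "1 / p x \<le> C1 * exp \<bar>\<tau> x - \<tau> r\<bar> / p r" "exp (- \<bar>\<tau> x - \<tau> r\<bar>) / (C1 * p r) \<le> 1 / p x"
proof -
  have pos: "0 < p x" "0 < p r" using p_pos assms by auto
  show "1 / p x \<le> C1 * exp \<bar>\<tau> x - \<tau> r\<bar> / p r"
    using C1(2)[of r x] assms pos by (simp add: field_simps abs_minus_commute)
  show "exp (- \<bar>\<tau> x - \<tau> r\<bar>) / (C1 * p r) \<le> 1 / p x"
    using C1(2)[of x r] C1(1) assms pos by (simp add: field_simps exp_minus)
qed

text \<open>\<open>2 * A\<close> is the rate at which \<open>expo n\<close> falls away from its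
  peak, measured in \<tau>. \<open>peak 0\<close> enters as a lower bound for the factor
  \<open>x\<close> in the derivative \<open>x * D x\<close> of \<open>\<psi>\<close> right of the
  first peak; \<open>B\<close> is the constant of the upper bounds.\<close>

definition A where "A = peak 0 * c0 / C1"
definition B where "B = C0 * C1"

lemma AB_pos: "0 < A" "0 < B"
  using peak[of 0] c0_pos C0_pos C1(1) by (auto simp: A_def B_def)

text \<open>Only one of the two factors \<open>1 / p x\<close> in the bound for \<open>D x\<close>
  is moved to the base point \<open>r\<close>; the other is kept because it is the derivative of
  \<tau>, so the product can be integrated explicitly.\<close>

lemma D_lower_scaled:
  assumes "0 \<le> x" "x < 1" "0 \<le> r" "r < 1"
  shows "(c0 / C1) * exp (- \<bar>\<tau> x - \<tau> r\<bar>) / p r * (1 / p x) \<le> D x"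
proof -
  have pos: "0 < p x" "0 < p r" using p_pos assms by auto
  have "c0 * (exp (- \<bar>\<tau> x - \<tau> r\<bar>) / (C1 * p r)) * (1 / p x) \<le> c0 * (1 / p x) * (1 / p x)"
    using inv_p_le(2)[OF assms] c0_pos pos C1(1) by (intro mult_mono) auto
  also have "\<dots> = c0 / (p x)\<^sup>2" by (simp add: power2_eq_square)
  also have "\<dots> \<le> D x" using D_lower assms by auto
  finally show ?thesis by (simp add: field_simps)
qed

lemma D_upper_scaled:
  assumes "0 \<le> x" "x < 1" "0 \<le> r" "r < 1"
  shows "D x \<le> B * exp \<bar>\<tau> x - \<tau> r\<bar> / p r * (1 / p x)"
proof -
  have pos: "0 < p x" "0 < p r" using p_pos assms by auto
  have "D x \<le> C0 / (p x)\<^sup>2" using D_upper assms by auto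
  also have "\<dots> = C0 * (1 / p x) * (1 / p x)" by (simp add: power2_eq_square)
  also have "\<dots> \<le> C0 * (C1 * exp \<bar>\<tau> x - \<tau> r\<bar> / p r) * (1 / p x)"
    using inv_p_le(1)[OF assms] C0_pos pos C1 by (intro mult_mono) auto
  finally show ?thesis by (simp add: B_def mult.assoc)
qed

text \<open>Integrates \<open>D_lower_scaled\<close> from \<open>a\<close> to \<open>r\<close>: the
  derivative of \<open>exp (\<tau> x - \<tau> r)\<close> is this exponential times
  \<open>1 / p x\<close>.\<close>

lemma psi_diff_ge_right:
  assumes "peak 0 \<le> a" "a \<le> r" "r < 1"
  shows "A / p r * (1 - exp (- (\<tau> r - \<tau> a))) \<le> \<psi> r - \<psi> a"
proof -
  have a: "0 < a" using assms peak[of 0] by auto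
  have pr: "0 < p r" using p_pos assms a by auto
  have "\<psi> a - A / p r * exp (\<tau> a - \<tau> r) \<le> \<psi> r - A / p r * exp (\<tau> r - \<tau> r)"
  proof (rule deriv_nonneg_imp_le[where f = "\<lambda>x. \<psi> x - A / p r * exp (\<tau> x - \<tau> r)"
        and f' = "\<lambda>x. x * D x - A / p r * (exp (\<tau> x - \<tau> r) * (1 / p x))"])
    show "continuous_on {a..r} (\<lambda>x. \<psi> x - A / p r * exp (\<tau> x - \<tau> r))"
      using assms a by (intro continuous_intros psi_cont' tau_cont[of _ r]) auto
    fix x assume x: "a < x" "x < r"
    show "((\<lambda>x. \<psi> x - A / p r * exp (\<tau> x - \<tau> r)) has_real_derivative
            x * D x - A / p r * (exp (\<tau> x - \<tau> r) * (1 / p x))) (at x)"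
      using x assms a pr by (auto intro!: derivative_eq_intros psi_deriv tau_deriv simp: field_simps)
    have t: "- \<bar>\<tau> x - \<tau> r\<bar> = \<tau> x - \<tau> r" using tau_mono[of x r] x assms a by auto
    have "peak 0 * ((c0 / C1) * exp (\<tau> x - \<tau> r) / p r * (1 / p x)) \<le> x * D x"
      using D_lower_scaled[of x r, unfolded t] x assms a peak[of 0] D_pos[of x] c0_pos C1(1) pr p_pos[of x]
      by (intro mult_mono) auto
    then show "0 \<le> x * D x - A / p r * (exp (\<tau> x - \<tau> r) * (1 / p x))"
      by (simp add: A_def mult_ac)
  qed (use assms in auto)
  then show ?thesis by (simp add: algebra_simps)
qed

text \<open>The factor \<open>x\<close> of \<open>x * D x\<close> may be small near the origin; here
  \<open>x \<ge> r\<close>, and division by \<open>r\<close> compensates for it. The same quotient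
  occurs in \<open>expo_deriv\<close>.\<close>

lemma psi_diff_ge_left:
  assumes "0 < r" "r \<le> a" "a < 1"
  shows "A / p r * (1 - exp (- (\<tau> a - \<tau> r))) \<le> (\<psi> a - \<psi> r) / r"
proof -
  have pr: "0 < p r" using p_pos assms by auto
  have "\<psi> r + r * (A / p r * exp (\<tau> r - \<tau> r)) \<le> \<psi> a + r * (A / p r * exp (\<tau> r - \<tau> a))"
  proof (rule deriv_nonneg_imp_le[where f = "\<lambda>x. \<psi> x + r * (A / p r * exp (\<tau> r - \<tau> x))"
        and f' = "\<lambda>x. x * D x - r * (A / p r * (exp (\<tau> r - \<tau> x) * (1 / p x)))"])
    show "continuous_on {r..a} (\<lambda>x. \<psi> x + r * (A / p r * exp (\<tau> r - \<tau> x)))"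
      using assms by (intro continuous_intros psi_cont' tau_cont[of _ a]) auto
    fix x assume x: "r < x" "x < a"
    show "((\<lambda>x. \<psi> x + r * (A / p r * exp (\<tau> r - \<tau> x))) has_real_derivative
            x * D x - r * (A / p r * (exp (\<tau> r - \<tau> x) * (1 / p x)))) (at x)"
      using x assms pr by (auto intro!: derivative_eq_intros psi_deriv tau_deriv simp: field_simps)
    have t: "- \<bar>\<tau> x - \<tau> r\<bar> = \<tau> r - \<tau> x" using tau_mono[of r x] x assms by auto
    have px: "0 < p x" using p_pos x assms by auto
    have "peak 0 * ((c0 / C1) * exp (\<tau> r - \<tau> x) / p r * (1 / p x)) \<le> 1 * D x"
      using D_lower_scaled[of x r, unfolded t] x assms peak[of 0] D_pos[of x] c0_pos C1(1) pr px
      by (intro mult_mono) auto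
    then have "A / p r * (exp (\<tau> r - \<tau> x) * (1 / p x)) \<le> D x" by (simp add: A_def mult_ac)
    then have "r * (A / p r * (exp (\<tau> r - \<tau> x) * (1 / p x))) \<le> x * D x"
      using x assms AB_pos pr px by (intro mult_mono) auto
    then show "0 \<le> x * D x - r * (A / p r * (exp (\<tau> r - \<tau> x) * (1 / p x)))" by simp
  qed (use assms in auto)
  then have "r * (A / p r * (1 - exp (\<tau> r - \<tau> a))) \<le> \<psi> a - \<psi> r" by (simp add: algebra_simps)
  then show ?thesis using assms by (simp add: pos_le_divide_eq mult.commute)
qed

lemma psi_diff_le_right:
  assumes "0 \<le> a" "a \<le> r" "r < 1"
  shows "\<psi> r - \<psi> a \<le> B / p r * (exp (\<tau> r - \<tau> a) - 1)"
proof -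
  have pr: "0 < p r" using p_pos assms by auto
  have "- \<psi> a - B / p r * exp (\<tau> r - \<tau> a) \<le> - \<psi> r - B / p r * exp (\<tau> r - \<tau> r)"
  proof (rule deriv_nonneg_imp_le[where f = "\<lambda>x. - \<psi> x - B / p r * exp (\<tau> r - \<tau> x)"
        and f' = "\<lambda>x. B / p r * (exp (\<tau> r - \<tau> x) * (1 / p x)) - x * D x"])
    show "continuous_on {a..r} (\<lambda>x. - \<psi> x - B / p r * exp (\<tau> r - \<tau> x))"
      using assms by (intro continuous_intros psi_cont' tau_cont[of _ r]) auto
    fix x assume x: "a < x" "x < r"
    show "((\<lambda>x. - \<psi> x - B / p r * exp (\<tau> r - \<tau> x)) has_real_derivative
            B / p r * (exp (\<tau> r - \<tau> x) * (1 / p x)) - x * D x) (at x)"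
      using x assms pr by (auto intro!: derivative_eq_intros psi_deriv tau_deriv simp: field_simps)
    have t: "\<bar>\<tau> x - \<tau> r\<bar> = \<tau> r - \<tau> x" using tau_mono[of x r] x assms by auto
    have "x * D x \<le> 1 * (B * exp (\<tau> r - \<tau> x) / p r * (1 / p x))"
      using D_upper_scaled[of x r, unfolded t] x assms D_pos[of x] by (intro mult_mono) auto
    then show "0 \<le> B / p r * (exp (\<tau> r - \<tau> x) * (1 / p x)) - x * D x" by (simp add: mult_ac)
  qed (use assms in auto)
  then show ?thesis by (simp add: algebra_simps)
qed

section \<open>Shape of the integrand around its peak\<close>

definition expo :: "nat \<Rightarrow> real \<Rightarrow> real" where
  "expo n r = (2 * real n + 1) * ln r - 2 * u r"

lemma u_cont': "S \<subseteq> {0..<1} \<Longrightarrow> continuous_on S u"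
  using continuous_on_subset u_cont by blast

lemma expo_deriv:
  assumes "0 < r" "r < 1"
  shows "(expo n has_real_derivative 2 * (\<psi> (peak n) - \<psi> r) / r) (at r)"
  unfolding expo_def peak(3) using assms
  by (auto intro!: derivative_eq_intros u_deriv simp: field_simps)

lemma expo_cont: "S \<subseteq> {0<..<1} \<Longrightarrow> continuous_on S (expo n)"
  unfolding expo_def by (intro continuous_intros u_cont') force+

text \<open>With \<open>y = \<tau> r - \<tau>p n\<close>, \<open>psi_diff_ge_right\<close> gives
  slope at most \<open>- 2 * A * (1 - exp (- y))\<close> in \<tau>, whose primitive is
  \<open>- 2 * A * (y + exp (- y))\<close>; its value at \<open>y = 0\<close> accounts for the
  additive \<open>2 * A\<close>.\<close>

lemma expo_le_right:
  assumes "peak n \<le> r" "r < 1"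
  shows "expo n r \<le> expo n (peak n) + 2 * A - 2 * A * (\<tau> r - \<tau>p n)"
proof -
  have pk: "0 < peak n" "peak 0 \<le> peak n" using peak peak_0_le by auto
  have "- expo n (peak n) - 2 * A * (\<tau> (peak n) - \<tau>p n + exp (\<tau>p n - \<tau> (peak n)))
       \<le> - expo n r - 2 * A * (\<tau> r - \<tau>p n + exp (\<tau>p n - \<tau> r))"
  proof (rule deriv_nonneg_imp_le[where f = "\<lambda>x. - expo n x - 2 * A * (\<tau> x - \<tau>p n + exp (\<tau>p n - \<tau> x))"
        and f' = "\<lambda>x. - (2 * (\<psi> (peak n) - \<psi> x) / x) - 2 * (A / p x * (1 - exp (\<tau>p n - \<tau> x)))"])
    show "continuous_on {peak n..r} (\<lambda>x. - expo n x - 2 * A * (\<tau> x - \<tau>p n + exp (\<tau>p n - \<tau> x)))"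
      using assms pk by (intro continuous_intros expo_cont tau_cont[of _ r]) auto
    fix x assume x: "peak n < x" "x < r"
    have px: "0 < p x" using p_pos x assms pk by auto
    show "((\<lambda>x. - expo n x - 2 * A * (\<tau> x - \<tau>p n + exp (\<tau>p n - \<tau> x))) has_real_derivative
            - (2 * (\<psi> (peak n) - \<psi> x) / x) - 2 * (A / p x * (1 - exp (\<tau>p n - \<tau> x)))) (at x)"
      using x assms pk px by (auto intro!: derivative_eq_intros expo_deriv tau_deriv simp: field_simps)
    have "A / p x * (1 - exp (\<tau>p n - \<tau> x)) \<le> \<psi> x - \<psi> (peak n)"
      using psi_diff_ge_right[of "peak n" x] x assms pk by auto
    also have "\<dots> \<le> (\<psi> x - \<psi> (peak n)) / x"
      using psi_mono[of "peak n" x] x assms pk by (auto simp: pos_le_divide_eq intro: mult_left_le)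
    finally show "0 \<le> - (2 * (\<psi> (peak n) - \<psi> x) / x) - 2 * (A / p x * (1 - exp (\<tau>p n - \<tau> x)))"
      by (simp add: diff_divide_distrib right_diff_distrib)
  qed (use assms in auto)
  moreover have "0 \<le> A * exp (\<tau>p n - \<tau> r)" using AB_pos by simp
  ultimately show ?thesis by (simp add: algebra_simps)
qed

lemma expo_le_left:
  assumes "0 < r" "r \<le> peak n"
  shows "expo n r \<le> expo n (peak n) + 2 * A - 2 * A * (\<tau>p n - \<tau> r)"
proof -
  have pk: "0 < peak n" "peak n < 1" using peak by auto
  have "expo n r + 2 * A * (\<tau>p n - \<tau> r + exp (\<tau> r - \<tau>p n))
       \<le> expo n (peak n) + 2 * A * (\<tau>p n - \<tau> (peak n) + exp (\<tau> (peak n) - \<tau>p n))"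
  proof (rule deriv_nonneg_imp_le[where f = "\<lambda>x. expo n x + 2 * A * (\<tau>p n - \<tau> x + exp (\<tau> x - \<tau>p n))"
        and f' = "\<lambda>x. 2 * (\<psi> (peak n) - \<psi> x) / x - 2 * (A / p x * (1 - exp (\<tau> x - \<tau>p n)))"])
    show "continuous_on {r..peak n} (\<lambda>x. expo n x + 2 * A * (\<tau>p n - \<tau> x + exp (\<tau> x - \<tau>p n)))"
      using assms pk by (intro continuous_intros expo_cont tau_cont[of _ "peak n"]) auto
    fix x assume x: "r < x" "x < peak n"
    have px: "0 < p x" using p_pos x assms pk by auto
    show "((\<lambda>x. expo n x + 2 * A * (\<tau>p n - \<tau> x + exp (\<tau> x - \<tau>p n))) has_real_derivative
            2 * (\<psi> (peak n) - \<psi> x) / x - 2 * (A / p x * (1 - exp (\<tau> x - \<tau>p n)))) (at x)"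
      using x assms pk px by (auto intro!: derivative_eq_intros expo_deriv tau_deriv simp: field_simps)
    have "A / p x * (1 - exp (\<tau> x - \<tau>p n)) \<le> (\<psi> (peak n) - \<psi> x) / x"
      using psi_diff_ge_left[of x "peak n"] x assms pk by auto
    moreover have "2 * (\<psi> (peak n) - \<psi> x) / x = 2 * ((\<psi> (peak n) - \<psi> x) / x)" by simp
    ultimately show "0 \<le> 2 * (\<psi> (peak n) - \<psi> x) / x - 2 * (A / p x * (1 - exp (\<tau> x - \<tau>p n)))"
      by linarith
  qed (use assms in auto)
  moreover have "0 \<le> A * exp (\<tau> r - \<tau>p n)" using AB_pos by simp
  ultimately show ?thesis by (simp add: algebra_simps)
qed

lemma expo_le:
  assumes "0 < r" "r < 1"
  shows "expo n r \<le> expo n (peak n) + 2 * A - 2 * A * \<bar>\<tau> r - \<tau>p n\<bar>"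
proof (cases "peak n \<le> r")
  case True
  then have "\<bar>\<tau> r - \<tau>p n\<bar> = \<tau> r - \<tau>p n" using tau_mono[of "peak n" r] peak[of n] assms by auto
  then show ?thesis using expo_le_right[of n r] True assms by auto
next
  case False
  then have "\<bar>\<tau> r - \<tau>p n\<bar> = \<tau>p n - \<tau> r" using tau_mono[of r "peak n"] peak[of n] assms by auto
  then show ?thesis using expo_le_left[of r n] False assms by auto
qed

text \<open>The slope in \<tau> is at least \<open>- (2 * B / peak 0) * (exp y - 1)\<close> for
  \<open>y = \<tau> r - \<tau>p n\<close>, so within \<tau>-distance 1 of the peak the logarithmic
  height drops by an amount bounded uniformly in \<open>n\<close>.\<close>

lemma expo_ge_right:
  assumes "peak n \<le> r" "r < 1" "\<tau> r - \<tau>p n \<le> 1"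
  shows "expo n (peak n) - 2 * B * exp 1 / peak 0 \<le> expo n r"
proof -
  have pk: "0 < peak n" "peak 0 \<le> peak n" "0 < peak 0" using peak peak_0_le by auto
  define K where "K = 2 * B / peak 0"
  have K: "0 < K" using AB_pos pk by (simp add: K_def)
  have "expo n (peak n) + K * (exp (\<tau> (peak n) - \<tau>p n) - (\<tau> (peak n) - \<tau>p n))
       \<le> expo n r + K * (exp (\<tau> r - \<tau>p n) - (\<tau> r - \<tau>p n))"
  proof (rule deriv_nonneg_imp_le[where f = "\<lambda>x. expo n x + K * (exp (\<tau> x - \<tau>p n) - (\<tau> x - \<tau>p n))"
        and f' = "\<lambda>x. 2 * (\<psi> (peak n) - \<psi> x) / x + K / p x * (exp (\<tau> x - \<tau>p n) - 1)"])
    show "continuous_on {peak n..r} (\<lambda>x. expo n x + K * (exp (\<tau> x - \<tau>p n) - (\<tau> x - \<tau>p n)))"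
      using assms pk by (intro continuous_intros expo_cont tau_cont[of _ r]) auto
    fix x assume x: "peak n < x" "x < r"
    have px: "0 < p x" using p_pos x assms pk by auto
    show "((\<lambda>x. expo n x + K * (exp (\<tau> x - \<tau>p n) - (\<tau> x - \<tau>p n))) has_real_derivative
            2 * (\<psi> (peak n) - \<psi> x) / x + K / p x * (exp (\<tau> x - \<tau>p n) - 1)) (at x)"
      using x assms pk px by (auto intro!: derivative_eq_intros expo_deriv tau_deriv simp: field_simps)
    have "(\<psi> x - \<psi> (peak n)) / x \<le> (\<psi> x - \<psi> (peak n)) / peak 0"
      using psi_mono[of "peak n" x] x assms pk by (intro divide_left_mono) auto
    also have "\<dots> \<le> B / p x * (exp (\<tau> x - \<tau>p n) - 1) / peak 0"
      using psi_diff_le_right[of "peak n" x] x assms pk by (intro divide_right_mono) auto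
    finally have "(\<psi> x - \<psi> (peak n)) / x \<le> B / p x * (exp (\<tau> x - \<tau>p n) - 1) / peak 0" .
    moreover have "2 * (\<psi> (peak n) - \<psi> x) / x = - 2 * ((\<psi> x - \<psi> (peak n)) / x)"
      by (simp add: diff_divide_distrib right_diff_distrib)
    moreover have "K / p x * (exp (\<tau> x - \<tau>p n) - 1) = 2 * (B / p x * (exp (\<tau> x - \<tau>p n) - 1) / peak 0)"
      by (simp add: K_def mult_ac)
    ultimately show "0 \<le> 2 * (\<psi> (peak n) - \<psi> x) / x + K / p x * (exp (\<tau> x - \<tau>p n) - 1)"
      by linarith
  qed (use assms in auto)
  moreover have "K * exp (\<tau> r - \<tau>p n) \<le> K * exp 1" using assms K by simp
  moreover have "0 \<le> K * (\<tau> r - \<tau>p n)" using tau_mono[of "peak n" r] assms pk K by simp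
  ultimately have "expo n (peak n) + K \<le> expo n r + K * exp 1" by (simp add: right_diff_distrib)
  then show ?thesis using K by (simp add: K_def mult_ac)
qed

text \<open>Between consecutive peaks \<open>\<psi>\<close> increases by exactly 1. Its least growth
  rate \<open>k\<close> in \<tau> bounds the gap from above, and \<open>psi_diff_le_right\<close>
  bounds it from below by a multiple of \<open>pp n\<close>.\<close>

lemma tau_peak_step:
  obtains T1 K where "0 < T1" "0 < K" "\<And>n. \<tau>p (Suc n) - \<tau>p n \<le> T1"
    "\<And>n. pp n \<le> K * (\<tau>p (Suc n) - \<tau>p n)"
proof -
  define k where "k = peak 0 * c0 / L"
  have k: "0 < k" using peak c0_pos L_pos by (simp add: k_def)
  have pk: "0 < peak n" "peak n < 1" "peak n < peak (Suc n)" "peak 0 \<le> peak n" for n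
    using peak peak_less[of n "Suc n"] peak_0_le by auto
  have mono: "\<tau>p n \<le> \<tau>p (Suc n)" for n using tau_mono pk[of n] pk(2)[of "Suc n"] by auto
  have t: "\<tau>p (Suc n) - \<tau>p n \<le> 1 / k" for n
  proof -
    have "\<psi> (peak n) - k * \<tau>p n \<le> \<psi> (peak (Suc n)) - k * \<tau>p (Suc n)"
    proof (rule deriv_nonneg_imp_le[where f = "\<lambda>x. \<psi> x - k * \<tau> x" and f' = "\<lambda>x. x * D x - k * (1 / p x)"])
      show "continuous_on {peak n..peak (Suc n)} (\<lambda>x. \<psi> x - k * \<tau> x)"
        using pk[of n] pk(2)[of "Suc n"]
        by (intro continuous_intros psi_cont' tau_cont[of _ "peak (Suc n)"]) auto
      fix x assume x: "peak n < x" "x < peak (Suc n)"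
      then have x01: "0 < x" "x < 1" "peak 0 \<le> x" using pk[of n] pk(2)[of "Suc n"] by auto
      show "((\<lambda>x. \<psi> x - k * \<tau> x) has_real_derivative x * D x - k * (1 / p x)) (at x)"
        using x01 by (auto intro!: derivative_eq_intros psi_deriv tau_deriv)
      have px: "0 < p x" "p x \<le> L" using p_pos p_le_L x01 by auto
      have "k * (1 / p x) = peak 0 * (c0 * (1 / L) * (1 / p x))" by (simp add: k_def)
      also have "c0 * (1 / L) * (1 / p x) \<le> c0 * (1 / p x) * (1 / p x)"
        using px c0_pos L_pos by (intro mult_mono frac_le) auto
      also have "\<dots> \<le> D x" using D_lower[of x] x01 by (simp add: power2_eq_square)
      also have "peak 0 * D x \<le> x * D x" using x01 D_pos[of x] by (intro mult_right_mono) auto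
      finally show "0 \<le> x * D x - k * (1 / p x)" using pk(1)[of 0] by simp
    qed (use pk[of n] in auto)
    then show ?thesis using k by (simp add: peak(3) field_simps)
  qed
  define K where "K = C1 * exp (1 / k) * (B * exp (1 / k))"
  have "pp n \<le> K * (\<tau>p (Suc n) - \<tau>p n)" for n
  proof -
    have "1 \<le> B / pp (Suc n) * (exp (\<tau>p (Suc n) - \<tau>p n) - 1)"
      using psi_diff_le_right[of "peak n" "peak (Suc n)"] pk[of n] pk(2)[of "Suc n"] by (simp add: peak(3))
    then have "pp (Suc n) \<le> B * (exp (\<tau>p (Suc n) - \<tau>p n) - 1)" using pp_pos[of "Suc n"] by (simp add: field_simps)
    also have "exp (\<tau>p (Suc n) - \<tau>p n) - 1 \<le> exp (1 / k) * (\<tau>p (Suc n) - \<tau>p n)"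
    proof -
      let ?t = "\<tau>p (Suc n) - \<tau>p n"
      have "exp t - 1 \<le> exp t * t" for t :: real
      proof -
        have "1 + - t \<le> exp (- t)" by (rule exp_ge_add_one_self)
        then have "exp t * (1 - t) \<le> exp t * exp (- t)" by (intro mult_left_mono) auto
        then show ?thesis by (simp add: exp_minus right_diff_distrib)
      qed
      then have "exp ?t - 1 \<le> exp ?t * ?t" .
      also have "\<dots> \<le> exp (1 / k) * ?t" using t[of n] mono[of n] by (intro mult_right_mono) auto
      finally show ?thesis .
    qed
    finally have 1: "pp (Suc n) \<le> B * exp (1 / k) * (\<tau>p (Suc n) - \<tau>p n)" using AB_pos by simp
    \<comment> \<open>The lower bound just found involves \<open>pp (Suc n)\<close>; a gap of at
      most \<open>1 / k\<close> makes it comparable to \<open>pp n\<close>.\<close>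
    have "pp n \<le> C1 * exp \<bar>\<tau>p n - \<tau>p (Suc n)\<bar> * pp (Suc n)"
      using C1(2)[of "peak n" "peak (Suc n)"] pk(1,2)[of n] pk(1,2)[of "Suc n"] by auto
    also have "\<dots> \<le> C1 * exp (1 / k) * pp (Suc n)"
      using t[of n] mono[of n] C1(1) pp_pos[of "Suc n"] by (intro mult_right_mono mult_left_mono) auto
    also have "\<dots> \<le> C1 * exp (1 / k) * (B * exp (1 / k) * (\<tau>p (Suc n) - \<tau>p n))"
      using C1(1) 1 by (intro mult_left_mono) auto
    finally show ?thesis by (simp add: K_def mult_ac)
  qed
  moreover have "0 < K" using C1(1) AB_pos by (simp add: K_def)
  moreover have "0 < 1 / k" using k by simp
  ultimately show ?thesis using t that by blast
qed

text \<open>A Riemann sum argument: \<open>pp n\<close> is at most a multiple of the gap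
  \<open>\<tau>p (Suc n) - \<tau>p n\<close>, so the sum is dominated by the integral of the
  exponential over the line. Comparison with \<open>sigmoid\<close> makes it telescope.\<close>

lemma sum_peak_exp:
  assumes a: "0 < a"
  obtains K where "0 < K" "\<And>T. summable (\<lambda>n. pp n * exp (- (a * \<bar>\<tau>p n - T\<bar>)))"
    "\<And>T. (\<Sum>n. pp n * exp (- (a * \<bar>\<tau>p n - T\<bar>))) \<le> K"
proof -
  obtain T1 K where TK: "0 < T1" "0 < K" "\<And>n. \<tau>p (Suc n) - \<tau>p n \<le> T1"
    "\<And>n. pp n \<le> K * (\<tau>p (Suc n) - \<tau>p n)" by (rule tau_peak_step) blast
  \<comment> \<open>The factor \<open>4 / a\<close> comes from \<open>sigmoid_deriv_ge\<close> and
    the chain rule; \<open>exp (a * T1)\<close> allows the exponential at the left end of a gap to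
    be compared with its value anywhere in the gap.\<close>
  define M where "M = 4 / a * exp (a * T1)"
  have M: "0 < M" using a by (simp add: M_def)
  have mono: "\<tau>p n \<le> \<tau>p (Suc n)" for n using tau_mono peak peak_less[of n "Suc n"] by (simp add: less_imp_le)
  have step: "pp n * exp (- (a * \<bar>\<tau>p n - T\<bar>)) \<le>
      K * M * (sigmoid (a * (\<tau>p (Suc n) - T)) - sigmoid (a * (\<tau>p n - T)))" for n T
  proof -
    let ?e = "exp (- (a * \<bar>\<tau>p n - T\<bar>))"
    let ?g = "\<lambda>y. exp (- y) / (1 + exp (- y))\<^sup>2 :: real"
    have "M * sigmoid (a * (\<tau>p n - T)) - ?e * \<tau>p n \<le>
          M * sigmoid (a * (\<tau>p (Suc n) - T)) - ?e * \<tau>p (Suc n)"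
    proof (rule deriv_nonneg_imp_le[where f = "\<lambda>x. M * sigmoid (a * (x - T)) - ?e * x"
          and f' = "\<lambda>x. M * (?g (a * (x - T)) * a) - ?e"])
      have d: "((\<lambda>x. M * sigmoid (a * (x - T)) - ?e * x) has_real_derivative
               M * (?g (a * (x - T)) * a) - ?e) (at x)" for x
        by (auto intro!: derivative_eq_intros DERIV_chain2[OF sigmoid_deriv])
      then show "((\<lambda>x. M * sigmoid (a * (x - T)) - ?e * x) has_real_derivative
               M * (?g (a * (x - T)) * a) - ?e) (at x)" for x .
      show "continuous_on {\<tau>p n..\<tau>p (Suc n)} (\<lambda>x. M * sigmoid (a * (x - T)) - ?e * x)"
        using d by (intro DERIV_atLeastAtMost_imp_continuous_on) blast
      fix x assume x: "\<tau>p n < x" "x < \<tau>p (Suc n)"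
      have "\<bar>x - T\<bar> \<le> \<bar>\<tau>p n - T\<bar> + T1" using x TK(3)[of n] by linarith
      then have "a * \<bar>x - T\<bar> \<le> a * (\<bar>\<tau>p n - T\<bar> + T1)" using a by (intro mult_left_mono) auto
      then have "?e \<le> exp (a * T1) * exp (- \<bar>a * (x - T)\<bar>)"
        using a by (simp add: abs_mult distrib_left flip: exp_add)
      also have "\<dots> \<le> exp (a * T1) * (4 * ?g (a * (x - T)))"
        using sigmoid_deriv_ge by (intro mult_left_mono) auto
      also have "\<dots> = M * (?g (a * (x - T)) * a)" using a by (simp add: M_def)
      finally show "0 \<le> M * (?g (a * (x - T)) * a) - ?e" by simp
    qed (rule mono)
    then have "(\<tau>p (Suc n) - \<tau>p n) * ?e \<le> M * (sigmoid (a * (\<tau>p (Suc n) - T)) - sigmoid (a * (\<tau>p n - T)))"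
      by (simp add: algebra_simps)
    then have "K * ((\<tau>p (Suc n) - \<tau>p n) * ?e) \<le> K * (M * (sigmoid (a * (\<tau>p (Suc n) - T)) - sigmoid (a * (\<tau>p n - T))))"
      using TK by (intro mult_left_mono) auto
    moreover have "pp n * ?e \<le> K * (\<tau>p (Suc n) - \<tau>p n) * ?e" using TK(4)[of n] by (intro mult_right_mono) auto
    ultimately show ?thesis unfolding mult.assoc by (rule order_trans[rotated])
  qed
  have part: "(\<Sum>n<N. pp n * exp (- (a * \<bar>\<tau>p n - T\<bar>))) \<le> K * M" for N T
  proof -
    have "(\<Sum>n<N. pp n * exp (- (a * \<bar>\<tau>p n - T\<bar>))) \<le>
      (\<Sum>n<N. K * M * (sigmoid (a * (\<tau>p (Suc n) - T)) - sigmoid (a * (\<tau>p n - T))))"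
      by (intro sum_mono step)
    also have "\<dots> = K * M * (sigmoid (a * (\<tau>p N - T)) - sigmoid (a * (\<tau>p 0 - T)))"
      by (subst sum_distrib_left[symmetric], subst sum_lessThan_telescope) simp
    also have "\<dots> \<le> K * M * 1"
      using TK M sigmoid_bounds[of "a * (\<tau>p N - T)"] sigmoid_bounds[of "a * (\<tau>p 0 - T)"]
      by (intro mult_left_mono) auto
    finally show ?thesis by simp
  qed
  have nn: "0 \<le> pp n * exp (- (a * \<bar>\<tau>p n - T\<bar>))" for n T using pp_pos[of n] by simp
  have s: "summable (\<lambda>n. pp n * exp (- (a * \<bar>\<tau>p n - T\<bar>)))" for T
    using part nn by (intro bounded_imp_summable[where B = "K * M"]) (auto simp: lessThan_Suc_atMost[symmetric] simp del: sum.lessThan_Suc)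
  show ?thesis
  proof (rule that[of "K * M"])
    show "(\<Sum>n. pp n * exp (- (a * \<bar>\<tau>p n - T\<bar>))) \<le> K * M" for T
      by (rule suminf_le_const[OF s part])
  qed (use s TK M in auto)
qed

text \<open>Substituting \<open>x = \<tau> s\<close>, with \<open>dx = ds / p s\<close>, leaves the
  integral of a two-sided exponential; the multiple \<open>4 / a\<close> of a sigmoid serves as
  primitive.\<close>

lemma nn_integral_exp_tau_le:
  assumes a: "0 < a"
  shows "(\<integral>\<^sup>+s\<in>{0<..<1}. ennreal (exp (- (a * \<bar>\<tau> s - T\<bar>)) / p s) \<partial>lborel) \<le> ennreal (4 / a)"
proof -
  let ?g = "\<lambda>y. exp (- y) / (1 + exp (- y))\<^sup>2 :: real"
  let ?f = "\<lambda>s. 4 / a * (?g (a * (\<tau> s - T)) * (a * (1 / p s)))"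
  have nz: "(1 + exp (- y))\<^sup>2 \<noteq> 0" for y :: real
    using exp_gt_zero[of "-y"] zero_less_power[of "1 + exp (-y)" 2] by linarith
  have "(\<integral>\<^sup>+s\<in>{0<..<1}. ennreal (exp (- (a * \<bar>\<tau> s - T\<bar>)) / p s) \<partial>lborel)
     \<le> (\<integral>\<^sup>+s\<in>{0<..<1}. ennreal (?f s) \<partial>lborel)"
  proof (rule nn_integral_mono)
    fix s :: real
    have "exp (- (a * \<bar>\<tau> s - T\<bar>)) / p s \<le> ?f s" if "0 < s" "s < 1"
    proof -
      have "exp (- (a * \<bar>\<tau> s - T\<bar>)) \<le> 4 * ?g (a * (\<tau> s - T))"
        using sigmoid_deriv_ge[of "a * (\<tau> s - T)"] a by (simp add: abs_mult)
      then have "exp (- (a * \<bar>\<tau> s - T\<bar>)) / p s \<le> 4 * ?g (a * (\<tau> s - T)) / p s"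
        using p_pos[of s] that by (intro divide_right_mono) auto
      then show ?thesis using a by simp
    qed
    then show "ennreal (exp (- (a * \<bar>\<tau> s - T\<bar>)) / p s) * indicator {0<..<1} s \<le> ennreal (?f s) * indicator {0<..<1} s"
      by (cases "s \<in> {0<..<1}") (simp_all only: indicator_simps mult_1_right mult_zero_right ennreal_leI
            greaterThanLessThan_iff order_refl simp_thms)
  qed
  also have "\<dots> \<le> ennreal (4 / a)"
  proof (rule nn_integral_deriv_le[where G = "\<lambda>s. 4 / a * sigmoid (a * (\<tau> s - T))"])
    show "continuous_on {0<..<1} ?f"
      by (intro continuous_intros continuous_on_subset[OF tau_cont_Ico] inv_p_cont nz ballI) auto
    fix x :: real assume x: "0 < x" "x < 1"
    show "((\<lambda>s. 4 / a * sigmoid (a * (\<tau> s - T))) has_real_derivative ?f x) (at x)"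
      using x by (auto intro!: derivative_eq_intros DERIV_chain2[OF sigmoid_deriv] tau_deriv)
    show "0 \<le> ?f x" using x a p_pos[of x] by simp
  next
    fix x y :: real
    have "4 / a * (sigmoid (a * (\<tau> y - T)) - sigmoid (a * (\<tau> x - T))) \<le> 4 / a * 1"
      using a sigmoid_bounds[of "a * (\<tau> y - T)"] sigmoid_bounds[of "a * (\<tau> x - T)"]
      by (intro mult_left_mono) auto
    then show "4 / a * sigmoid (a * (\<tau> y - T)) - 4 / a * sigmoid (a * (\<tau> x - T)) \<le> 4 / a"
      by (simp add: right_diff_distrib)
  qed (use a in auto)
  finally show ?thesis .
qed

text \<open>Since \<open>dr = p d\<tau>\<close>, and \<open>p\<close> at an intermediate point is at
  most \<open>C * p b\<close> times an exponential of rate \<open>\<eta>\<close>, integration in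
  \<tau> gives the constant \<open>C / \<eta>\<close>.\<close>

lemma dist_le:
  assumes \<eta>: "0 < \<eta>"
  obtains K where "0 < K" "\<And>a b. 0 \<le> a \<Longrightarrow> a < 1 \<Longrightarrow> 0 \<le> b \<Longrightarrow> b < 1 \<Longrightarrow>
    \<bar>a - b\<bar> \<le> K * p b * exp (\<eta> * \<bar>\<tau> a - \<tau> b\<bar>)"
proof -
  obtain C where C: "0 < C" "\<And>r s. 0 \<le> r \<Longrightarrow> r < 1 \<Longrightarrow> 0 \<le> s \<Longrightarrow> s < 1 \<Longrightarrow> p r \<le> C * exp (\<eta> * \<bar>\<tau> r - \<tau> s\<bar>) * p s"
    using slowE[OF slow_p \<eta>] by blast
  show ?thesis
  proof (rule that[of "C / \<eta>"])
    show "0 < C / \<eta>" using C \<eta> by simp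
    fix a b :: real assume ab: "0 \<le> a" "a < 1" "0 \<le> b" "b < 1"
    define K where "K = C / \<eta> * p b"
    have K: "0 < K" using C \<eta> p_pos ab by (simp add: K_def)
    have drv: "1 \<le> K * (exp (\<eta> * \<bar>\<tau> x - \<tau> b\<bar>) * (\<eta> * (1 / p x)))" if "0 < x" "x < 1" for x
      using C(2)[of x b] p_pos[of x] \<eta> that ab by (simp add: K_def field_simps)
    show "\<bar>a - b\<bar> \<le> C / \<eta> * p b * exp (\<eta> * \<bar>\<tau> a - \<tau> b\<bar>)"
    proof (cases "b \<le> a")
      case True
      have "K * exp (\<eta> * (\<tau> b - \<tau> b)) - b \<le> K * exp (\<eta> * (\<tau> a - \<tau> b)) - a"
      proof (rule deriv_nonneg_imp_le[where f = "\<lambda>x. K * exp (\<eta> * (\<tau> x - \<tau> b)) - x"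
            and f' = "\<lambda>x. K * (exp (\<eta> * (\<tau> x - \<tau> b)) * (\<eta> * (1 / p x))) - 1"])
        show "continuous_on {b..a} (\<lambda>x. K * exp (\<eta> * (\<tau> x - \<tau> b)) - x)"
          using ab by (intro continuous_intros tau_cont[of _ a]) auto
        fix x assume x: "b < x" "x < a"
        show "((\<lambda>x. K * exp (\<eta> * (\<tau> x - \<tau> b)) - x) has_real_derivative
            K * (exp (\<eta> * (\<tau> x - \<tau> b)) * (\<eta> * (1 / p x))) - 1) (at x)"
          using x ab by (auto intro!: derivative_eq_intros tau_deriv)
        have "\<bar>\<tau> x - \<tau> b\<bar> = \<tau> x - \<tau> b" using tau_mono[of b x] x ab by auto
        then show "0 \<le> K * (exp (\<eta> * (\<tau> x - \<tau> b)) * (\<eta> * (1 / p x))) - 1"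
          using drv[of x] x ab by simp
      qed (use True in auto)
      moreover have "\<bar>\<tau> a - \<tau> b\<bar> = \<tau> a - \<tau> b" using tau_mono[of b a] True ab by auto
      ultimately show ?thesis using True K by (simp add: K_def)
    next
      case False
      have "- K * exp (\<eta> * (\<tau> b - \<tau> a)) - a \<le> - K * exp (\<eta> * (\<tau> b - \<tau> b)) - b"
      proof (rule deriv_nonneg_imp_le[where f = "\<lambda>x. - K * exp (\<eta> * (\<tau> b - \<tau> x)) - x"
            and f' = "\<lambda>x. K * (exp (\<eta> * (\<tau> b - \<tau> x)) * (\<eta> * (1 / p x))) - 1"])
        show "continuous_on {a..b} (\<lambda>x. - K * exp (\<eta> * (\<tau> b - \<tau> x)) - x)"
          using ab by (intro continuous_intros tau_cont[of _ b]) auto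
        fix x assume x: "a < x" "x < b"
        show "((\<lambda>x. - K * exp (\<eta> * (\<tau> b - \<tau> x)) - x) has_real_derivative
            K * (exp (\<eta> * (\<tau> b - \<tau> x)) * (\<eta> * (1 / p x))) - 1) (at x)"
          using x ab by (auto intro!: derivative_eq_intros tau_deriv)
        have "\<bar>\<tau> x - \<tau> b\<bar> = \<tau> b - \<tau> x" using tau_mono[of x b] x ab by auto
        then show "0 \<le> K * (exp (\<eta> * (\<tau> b - \<tau> x)) * (\<eta> * (1 / p x))) - 1"
          using drv[of x] x ab by simp
      qed (use False in auto)
      moreover have "\<bar>\<tau> a - \<tau> b\<bar> = \<tau> b - \<tau> a" using tau_mono[of a b] False ab by auto
      ultimately show ?thesis using False K by (simp add: K_def)
    qed
  qed
qed

text \<open>The moment of order \<open>2 * n + 1\<close>, taken over the open interval with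
  \<open>lborel\<close>, where continuity of \<open>expo n\<close> gives measurability;
  \<open>moment_eq\<close> identifies it with \<open>moment\<close>.\<close>

definition mom :: "nat \<Rightarrow> real" where
  "mom n = (LINT r:{0<..<1}|lborel. exp (expo n r))"

text \<open>The size predicted by Laplace's method: the height of the integrand at its peak times
  \<open>pp n\<close>, the order of the Euclidean width of a unit \<tau>-interval there.\<close>

definition scale :: "nat \<Rightarrow> real" where
  "scale n = pp n * exp (expo n (peak n))"

lemma scale_pos: "0 < scale n"
  using pp_pos by (simp add: scale_def)

lemma exp_expo_le:
  assumes "0 < r" "r < 1"
  shows "exp (expo n r) \<le> exp (2 * A) * exp (expo n (peak n)) * exp (- (2 * A * \<bar>\<tau> r - \<tau>p n\<bar>))"
  using expo_le[OF assms, of n] by (simp flip: exp_add)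

lemma exp_expo_meas:
  "continuous_on {0<..<1} g \<Longrightarrow> set_borel_measurable lborel {0<..<1} (\<lambda>r. g r * exp (expo n r))"
  unfolding set_borel_measurable_def measurable_lborel2
  by (rule borel_measurable_continuous_on_indicator)
     (auto intro!: continuous_intros expo_cont)

lemma exp_expo_int:
  assumes g: "continuous_on {0<..<1} g" "\<And>r. 0 < r \<Longrightarrow> r < 1 \<Longrightarrow> \<bar>g r\<bar> \<le> M"
  shows "set_integrable lborel {0<..<1} (\<lambda>r. g r * exp (expo n r))"
proof (rule set_integrable_bound)
  show "set_integrable lborel {0<..<1::real} (\<lambda>r. M * (exp (2 * A) * exp (expo n (peak n))))"
    by (simp add: set_integrable_def)
  show "AE x in lborel. x \<in> {0<..<1} \<longrightarrow> norm (g x * exp (expo n x)) \<le> norm (M * (exp (2 * A) * exp (expo n (peak n))))"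
  proof (intro AE_I2 impI)
    fix x :: real assume "x \<in> {0<..<1}"
    then have x: "0 < x" "x < 1" by auto
    have "exp (- (2 * A * \<bar>\<tau> x - \<tau>p n\<bar>)) \<le> 1" using AB_pos by simp
    then have "exp (expo n x) \<le> exp (2 * A) * exp (expo n (peak n)) * 1"
      by (rule order_trans[OF exp_expo_le[OF x, of n] mult_left_mono]) auto
    then have "\<bar>g x\<bar> * exp (expo n x) \<le> M * (exp (2 * A) * exp (expo n (peak n)))"
      using g(2)[OF x] by (intro mult_mono) auto
    also have "\<dots> \<le> \<bar>M\<bar> * (exp (2 * A) * exp (expo n (peak n)))" by (intro mult_right_mono) auto
    finally show "norm (g x * exp (expo n x)) \<le> norm (M * (exp (2 * A) * exp (expo n (peak n))))"
      by (simp add: abs_mult)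
  qed
qed (rule exp_expo_meas[OF g(1)])

lemma mom_int: "set_integrable lborel {0<..<1} (\<lambda>r. exp (expo n r))"
  using exp_expo_int[of "\<lambda>_. 1" 1 n] by simp

lemma mom_Suc: "mom (Suc n) = (LINT r:{0<..<1}|lborel. r\<^sup>2 * exp (expo n r))"
  unfolding mom_def
proof (rule set_lebesgue_integral_cong)
  show "\<forall>x. x \<in> {0<..<1::real} \<longrightarrow> exp (expo (Suc n) x) = x\<^sup>2 * exp (expo n x)"
  proof (intro allI impI)
    fix x :: real assume "x \<in> {0<..<1}"
    then have x: "0 < x" by auto
    have "expo (Suc n) x = 2 * ln x + expo n x" by (simp add: expo_def algebra_simps)
    also have "2 * ln x = ln (x\<^sup>2)" using x by (simp add: ln_realpow)
    finally show "exp (expo (Suc n) x) = x\<^sup>2 * exp (expo n x)" using x by (simp add: exp_add)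
  qed
qed auto

text \<open>Both bounds integrate a factor growing at a small rate against the exponential decay
  away from the peak. In the second this factor is \<open>r\<^sup>2 - (peak n)\<^sup>2\<close>, of
  size \<open>pp n\<close> near the peak: replacing the ratio of consecutive moments by
  \<open>(peak n)\<^sup>2\<close> costs a relative error of order \<open>pp n\<close>.\<close>

lemma expo_moment_bound:
  obtains K where "0 < K" "\<And>n. mom n \<le> K * scale n"
    "\<And>n. \<bar>mom (Suc n) - (peak n)\<^sup>2 * mom n\<bar> \<le> K * pp n * scale n"
proof -
  \<comment> \<open>Of the decay rate \<open>2 * A = 4 * \<eta>\<close>, one \<open>\<eta>\<close>
    pays for replacing \<open>p r\<close> by \<open>pp n\<close>, one for the growth of
    \<open>g\<close>, and at least one remains for the integral.\<close>
  define \<eta> where "\<eta> = A / 2"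
  have \<eta>: "0 < \<eta>" using AB_pos by (simp add: \<eta>_def)
  obtain K1 where K1: "0 < K1" "\<And>a b. 0 \<le> a \<Longrightarrow> a < 1 \<Longrightarrow> 0 \<le> b \<Longrightarrow> b < 1 \<Longrightarrow>
    \<bar>a - b\<bar> \<le> K1 * p b * exp (\<eta> * \<bar>\<tau> a - \<tau> b\<bar>)" using dist_le[OF \<eta>] by blast
  obtain C where C: "0 < C" "\<And>r s. 0 \<le> r \<Longrightarrow> r < 1 \<Longrightarrow> 0 \<le> s \<Longrightarrow> s < 1 \<Longrightarrow> p r \<le> C * exp (\<eta> * \<bar>\<tau> r - \<tau> s\<bar>) * p s"
    using slowE[OF slow_p \<eta>] by blast
  define K2 where "K2 = exp (2 * A) * C"
  have K2: "0 < K2" using C by (simp add: K2_def)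
  have pk: "0 < peak n" "peak n < 1" for n using peak by auto
  have pt: "exp (expo n r) \<le> K2 * scale n * (exp (- ((2 * A - \<eta>) * \<bar>\<tau> r - \<tau>p n\<bar>)) / p r)" if r: "0 < r" "r < 1" for n r
  proof -
    let ?t = "\<bar>\<tau> r - \<tau>p n\<bar>"
    have "1 \<le> C * exp (\<eta> * ?t) * pp n / p r" using C(2)[of r "peak n"] r pk[of n] p_pos[of r] by simp
    then have "exp (2 * A) * exp (expo n (peak n)) * exp (- (2 * A * ?t)) * 1 \<le>
        exp (2 * A) * exp (expo n (peak n)) * exp (- (2 * A * ?t)) * (C * exp (\<eta> * ?t) * pp n / p r)"
      by (intro mult_left_mono) auto
    also have "\<dots> = K2 * scale n * ((exp (- (2 * A * ?t)) * exp (\<eta> * ?t)) / p r)"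
      by (simp add: K2_def scale_def)
    also have "exp (- (2 * A * ?t)) * exp (\<eta> * ?t) = exp (- ((2 * A - \<eta>) * ?t))"
      by (simp add: algebra_simps flip: exp_add)
    finally show ?thesis using exp_expo_le[OF r, of n] by simp
  qed
  \<comment> \<open>\<open>M\<close> is the constant that counts; the crude bound \<open>M'\<close>
    only secures integrability.\<close>
  have main: "(LINT r:{0<..<1}|lborel. g r * exp (expo n r)) \<le> M * K2 * scale n * (4 / \<eta>)"
    if g: "continuous_on {0<..<1} g" and gM: "\<And>r. 0 < r \<Longrightarrow> r < 1 \<Longrightarrow> 0 \<le> g r \<and> g r \<le> M * exp (\<eta> * \<bar>\<tau> r - \<tau>p n\<bar>)"
      and gM2: "\<And>r. 0 < r \<Longrightarrow> r < 1 \<Longrightarrow> g r \<le> M'" and M: "0 \<le> M" for g M M' n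
  proof -
    have M0: "0 \<le> M * K2 * scale n * (4 / \<eta>)" using M K2 scale_pos[of n] \<eta> by simp
    have si: "set_integrable lborel {0<..<1} (\<lambda>r. g r * exp (expo n r))"
      using gM gM2 by (intro exp_expo_int[OF g, where M = M']) auto
    have "ennreal (LINT r:{0<..<1}|lborel. g r * exp (expo n r)) = (\<integral>\<^sup>+r. ennreal (indicator {0<..<1} r *\<^sub>R (g r * exp (expo n r))) \<partial>lborel)"
      unfolding set_lebesgue_integral_def
      by (rule nn_integral_eq_integral[symmetric])
         (use si gM in \<open>auto simp: set_integrable_def split: split_indicator\<close>)
    also have "\<dots> \<le> (\<integral>\<^sup>+r. ennreal (M * K2 * scale n) * (ennreal (exp (- (\<eta> * \<bar>\<tau> r - \<tau>p n\<bar>)) / p r) * indicator {0<..<1} r) \<partial>lborel)"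
    proof (rule nn_integral_mono)
      fix r :: real
      have "g r * exp (expo n r) \<le> M * K2 * scale n * (exp (- (\<eta> * \<bar>\<tau> r - \<tau>p n\<bar>)) / p r)" if r: "0 < r" "r < 1"
      proof -
        let ?t = "\<bar>\<tau> r - \<tau>p n\<bar>"
        have "g r * exp (expo n r) \<le> (M * exp (\<eta> * ?t)) * (K2 * scale n * (exp (- ((2 * A - \<eta>) * ?t)) / p r))"
          using gM[OF r] pt[OF r, of n] M by (intro mult_mono) auto
        also have "\<dots> = M * K2 * scale n * ((exp (\<eta> * ?t) * exp (- ((2 * A - \<eta>) * ?t))) / p r)" by simp
        also have "exp (\<eta> * ?t) * exp (- ((2 * A - \<eta>) * ?t)) = exp (- (2 * \<eta> * ?t))"
          by (simp add: \<eta>_def algebra_simps flip: exp_add)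
        also have "M * K2 * scale n * (exp (- (2 * \<eta> * ?t)) / p r) \<le> M * K2 * scale n * (exp (- (\<eta> * ?t)) / p r)"
          using M K2 scale_pos[of n] \<eta> p_pos[of r] r by (intro mult_left_mono divide_right_mono) auto
        finally show ?thesis .
      qed
      then show "ennreal (indicator {0<..<1} r *\<^sub>R (g r * exp (expo n r))) \<le>
         ennreal (M * K2 * scale n) * (ennreal (exp (- (\<eta> * \<bar>\<tau> r - \<tau>p n\<bar>)) / p r) * indicator {0<..<1} r)"
        using M K2 scale_pos[of n] p_pos[of r]
        by (auto split: split_indicator intro!: ennreal_leI simp: ennreal_mult[symmetric])
    qed
    also have "\<dots> = ennreal (M * K2 * scale n) * (\<integral>\<^sup>+r\<in>{0<..<1}. ennreal (exp (- (\<eta> * \<bar>\<tau> r - \<tau>p n\<bar>)) / p r) \<partial>lborel)"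
    proof (rule nn_integral_cmult)
      have "(\<lambda>r. indicator {0<..<1} r *\<^sub>R (exp (- (\<eta> * \<bar>\<tau> r - \<tau>p n\<bar>)) * (1 / p r))) \<in> borel_measurable borel"
        by (rule borel_measurable_continuous_on_indicator)
           (auto intro!: continuous_intros continuous_on_subset[OF tau_cont_Ico] inv_p_cont simp del: times_divide_eq_right)
      then have "(\<lambda>r. ennreal (indicator {0<..<1} r *\<^sub>R (exp (- (\<eta> * \<bar>\<tau> r - \<tau>p n\<bar>)) * (1 / p r)))) \<in> borel_measurable lborel"
        by simp
      also have "(\<lambda>r. ennreal (indicator {0<..<1} r *\<^sub>R (exp (- (\<eta> * \<bar>\<tau> r - \<tau>p n\<bar>)) * (1 / p r)))) =
        (\<lambda>r. ennreal (exp (- (\<eta> * \<bar>\<tau> r - \<tau>p n\<bar>)) / p r) * indicator {0<..<1} r)"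
        by (auto split: split_indicator)
      finally show "(\<lambda>r. ennreal (exp (- (\<eta> * \<bar>\<tau> r - \<tau>p n\<bar>)) / p r) * indicator {0<..<1} r) \<in> borel_measurable lborel" .
    qed
    also have "\<dots> \<le> ennreal (M * K2 * scale n) * ennreal (4 / \<eta>)"
      by (intro mult_left_mono nn_integral_exp_tau_le \<eta>) auto
    also have "\<dots> = ennreal (M * K2 * scale n * (4 / \<eta>))"
      using M K2 scale_pos[of n] \<eta> by (intro ennreal_mult[symmetric]) auto
    finally show ?thesis using M0 by (simp add: ennreal_le_iff)
  qed
  show ?thesis
  proof (rule that[of "K2 * (4 / \<eta>) + 2 * K1 * K2 * (4 / \<eta>)"])
    show "0 < K2 * (4 / \<eta>) + 2 * K1 * K2 * (4 / \<eta>)" using K1(1) K2 \<eta> by (intro add_pos_pos) auto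
    fix n
    have "mom n \<le> 1 * K2 * scale n * (4 / \<eta>)"
      unfolding mom_def using main[of "\<lambda>_. 1" 1 n 1] \<eta> by simp
    also have "\<dots> = K2 * (4 / \<eta>) * scale n" by simp
    also have "\<dots> \<le> (K2 * (4 / \<eta>) + 2 * K1 * K2 * (4 / \<eta>)) * scale n"
      using K1(1) K2 \<eta> scale_pos[of n] by (intro mult_right_mono) auto
    finally show "mom n \<le> (K2 * (4 / \<eta>) + 2 * K1 * K2 * (4 / \<eta>)) * scale n" .
    have int2: "set_integrable lborel {0<..<1} (\<lambda>r. r\<^sup>2 * exp (expo n r))"
      by (rule exp_expo_int[where M = 1]) (auto intro!: continuous_intros simp: power_le_one)
    have int3: "set_integrable lborel {0<..<1} (\<lambda>r. (peak n)\<^sup>2 * exp (expo n r))"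
      by (rule exp_expo_int[where M = "(peak n)\<^sup>2"]) auto
    have "mom (Suc n) - (peak n)\<^sup>2 * mom n = (LINT r:{0<..<1}|lborel. r\<^sup>2 * exp (expo n r) - (peak n)\<^sup>2 * exp (expo n r))"
      unfolding mom_Suc by (subst set_integral_diff(2)[OF int2 int3]) (simp add: mom_def)
    also have "\<bar>\<dots>\<bar> \<le> (LINT r:{0<..<1}|lborel. \<bar>r\<^sup>2 - (peak n)\<^sup>2\<bar> * exp (expo n r))"
    proof -
      have eq: "\<bar>indicator {0<..<1} r *\<^sub>R (r\<^sup>2 * exp (expo n r) - (peak n)\<^sup>2 * exp (expo n r))\<bar> =
             indicator {0<..<1} r *\<^sub>R (\<bar>r\<^sup>2 - (peak n)\<^sup>2\<bar> * exp (expo n r))" for r :: real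
        by (simp add: abs_mult flip: left_diff_distrib split: split_indicator)
      have "\<bar>LINT r|lborel. indicator {0<..<1} r *\<^sub>R (r\<^sup>2 * exp (expo n r) - (peak n)\<^sup>2 * exp (expo n r))\<bar> \<le>
        (LINT r|lborel. \<bar>indicator {0<..<1} r *\<^sub>R (r\<^sup>2 * exp (expo n r) - (peak n)\<^sup>2 * exp (expo n r))\<bar>)"
        by (rule integral_abs_bound)
      then show ?thesis unfolding set_lebesgue_integral_def eq .
    qed
    also have "\<dots> \<le> (2 * K1 * pp n) * K2 * scale n * (4 / \<eta>)"
    proof (rule main[where M' = 2])
      fix r :: real assume r: "0 < r" "r < 1"
      have e: "\<bar>r\<^sup>2 - (peak n)\<^sup>2\<bar> = \<bar>r - peak n\<bar> * (r + peak n)"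
        using r pk[of n] by (simp add: power2_eq_square square_diff_square_factored abs_mult mult.commute)
      also have "\<dots> \<le> (K1 * pp n * exp (\<eta> * \<bar>\<tau> r - \<tau>p n\<bar>)) * 2"
        using K1(2)[of r "peak n"] r pk[of n] K1(1) pp_pos[of n] by (intro mult_mono) auto
      finally show "0 \<le> \<bar>r\<^sup>2 - (peak n)\<^sup>2\<bar> \<and> \<bar>r\<^sup>2 - (peak n)\<^sup>2\<bar> \<le> 2 * K1 * pp n * exp (\<eta> * \<bar>\<tau> r - \<tau>p n\<bar>)"
        by (simp add: mult_ac)
      have "\<bar>r - peak n\<bar> * (r + peak n) \<le> 1 * 2" using r pk[of n] by (intro mult_mono) auto
      then show "\<bar>r\<^sup>2 - (peak n)\<^sup>2\<bar> \<le> 2" using e by simp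
    qed (use K1(1) pp_pos[of n] in \<open>auto intro!: continuous_intros\<close>)
    also have "\<dots> = (2 * K1 * K2 * (4 / \<eta>)) * pp n * scale n" by simp
    also have "\<dots> \<le> (K2 * (4 / \<eta>) + 2 * K1 * K2 * (4 / \<eta>)) * pp n * scale n"
      using K2 \<eta> scale_pos[of n] pp_pos[of n] by (intro mult_right_mono) auto
    finally show "\<bar>mom (Suc n) - (peak n)\<^sup>2 * mom n\<bar> \<le> (K2 * (4 / \<eta>) + 2 * K1 * K2 * (4 / \<eta>)) * pp n * scale n" .
  qed
qed

lemma square_int: "set_integrable lborel {0<..<1} (\<lambda>r. r\<^sup>2 * exp (expo n r))"
  by (rule exp_expo_int[where M = 1]) (auto intro!: continuous_intros simp: power_le_one)

text \<open>The part of the integral over \<open>[peak n, peak n + \<delta> * pp n]\<close>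
  suffices: there \<open>p \<ge> pp n / 2\<close>, so \<tau> moves by at most 1 and the integrand
  keeps a fixed fraction of its height. The bound for \<open>mom (Suc n)\<close> in terms of
  \<open>scale n\<close> serves the quotient of moments in \<open>kcoeff_diff_le\<close>.\<close>

lemma mom_lower:
  obtains k where "0 < k" "\<And>n. k * scale n \<le> mom n" "\<And>n. k * scale n \<le> mom (Suc n)"
proof -
  \<comment> \<open>\<open>L * \<delta> \<le> 1/2\<close> keeps the interval below 1 and
    \<open>p\<close> above \<open>pp n / 2\<close>; \<open>2 * \<delta> \<le> 1\<close> then limits
    its \<tau>-length to 1.\<close>
  define \<delta> where "\<delta> = 1 / (2 * (L + 1))"
  have \<delta>: "0 < \<delta>" "L * \<delta> \<le> 1/2" "2 * \<delta> \<le> 1" using L_pos by (auto simp: \<delta>_def field_simps)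
  define e where "e = exp (- (2 * B * exp 1 / peak 0))"
  \<comment> \<open>\<open>(peak 0)\<^sup>2\<close> bounds the extra factor \<open>r\<^sup>2\<close>
    of \<open>mom (Suc n)\<close>, \<open>e\<close> the loss of height, and \<open>\<delta>\<close>
    is the width in units of \<open>pp n\<close>.\<close>
  define k where "k = (peak 0)\<^sup>2 * e * \<delta>"
  have k: "0 < k" using peak(1)[of 0] \<delta> by (simp add: k_def e_def)
  have Suc_ge: "k * scale n \<le> mom (Suc n)" for n
  proof -
    have pk: "0 < peak n" "peak n < 1" "peak 0 \<le> peak n" using peak peak_0_le by auto
    define b where "b = peak n + \<delta> * pp n"
    have "\<delta> * pp n \<le> \<delta> * (L * (1 - peak n))" using p_le[of "peak n"] pk \<delta> by (intro mult_left_mono) auto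
    also have "\<dots> = (L * \<delta>) * (1 - peak n)" by simp
    also have "\<dots> \<le> 1/2 * (1 - peak n)" using \<delta> pk by (intro mult_right_mono) auto
    finally have b: "peak n < b" "b < 1" using pk \<delta> pp_pos[of n] by (auto simp: b_def)
    have lower: "e * exp (expo n (peak n)) \<le> exp (expo n r)" if r: "peak n \<le> r" "r \<le> b" for r
    proof -
      have "\<tau> r - 2 / pp n * r \<le> \<tau> (peak n) - 2 / pp n * peak n"
      proof -
        have "- (\<tau> (peak n)) + 2 / pp n * peak n \<le> - \<tau> r + 2 / pp n * r"
        proof (rule deriv_nonneg_imp_le[where f = "\<lambda>x. - \<tau> x + 2 / pp n * x" and f' = "\<lambda>x. - (1 / p x) + 2 / pp n"])
          show "continuous_on {peak n..r} (\<lambda>x. - \<tau> x + 2 / pp n * x)"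
            using r b pk by (intro continuous_intros tau_cont[of _ r]) auto
          fix x assume x: "peak n < x" "x < r"
          show "((\<lambda>x. - \<tau> x + 2 / pp n * x) has_real_derivative - (1 / p x) + 2 / pp n) (at x)"
            using x r b pk pp_pos[of n] by (auto intro!: derivative_eq_intros tau_deriv)
          have "\<bar>p x - pp n\<bar> \<le> L * \<bar>x - peak n\<bar>" using p_lip[of x "peak n"] x r b pk by auto
          also have "\<dots> \<le> L * (\<delta> * pp n)" using x r L_pos by (intro mult_left_mono) (auto simp: b_def)
          also have "\<dots> \<le> 1/2 * pp n" using \<delta>(2) pp_pos[of n] by (simp add: mult.assoc[symmetric] mult_right_mono)
          finally have "pp n / 2 \<le> p x" by linarith
          then have "1 / p x \<le> 1 / (pp n / 2)" using pp_pos[of n] by (intro divide_left_mono) auto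
          then show "0 \<le> - (1 / p x) + 2 / pp n" by simp
        qed (use r in auto)
        then show ?thesis by simp
      qed
      then have "\<tau> r - \<tau>p n \<le> 2 / pp n * (r - peak n)" by (simp add: right_diff_distrib)
      also have "\<dots> \<le> 2 / pp n * (\<delta> * pp n)" using r pp_pos[of n] by (intro mult_left_mono) (auto simp: b_def)
      also have "\<dots> \<le> 1" using \<delta> pp_pos[of n] by simp
      finally have "expo n (peak n) - 2 * B * exp 1 / peak 0 \<le> expo n r"
        using expo_ge_right[of n r] r b by auto
      then have "exp (expo n (peak n) + - (2 * B * exp 1 / peak 0)) \<le> exp (expo n r)" by simp
      then show ?thesis unfolding e_def exp_add by (simp add: mult.commute)
    qed
    have "k * scale n = (LINT r|lborel. indicator {peak n..b} r *\<^sub>R ((peak 0)\<^sup>2 * (e * exp (expo n (peak n)))))"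
      using b by (simp add: k_def scale_def b_def)
    also have "\<dots> \<le> (LINT r|lborel. indicator {0<..<1} r *\<^sub>R (r\<^sup>2 * exp (expo n r)))"
    proof (rule integral_mono)
      show "integrable lborel (\<lambda>r. indicator {0<..<1} r *\<^sub>R (r\<^sup>2 * exp (expo n r)))"
        using square_int by (simp add: set_integrable_def)
      show "integrable lborel (\<lambda>r. indicat_real {peak n..b} r *\<^sub>R ((peak 0)\<^sup>2 * (e * exp (expo n (peak n)))))"
        by (intro integrable_scaleR_left impI integrable_real_indicator) (auto simp: emeasure_lborel_Icc_eq)
      fix r :: real
      have "(peak 0)\<^sup>2 * (e * exp (expo n (peak n))) \<le> r\<^sup>2 * exp (expo n r)" if "peak n \<le> r" "r \<le> b"
        using lower[OF that] that pk peak(1)[of 0] by (intro mult_mono power_mono) (auto simp: e_def)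
      then show "indicat_real {peak n..b} r *\<^sub>R ((peak 0)\<^sup>2 * (e * exp (expo n (peak n)))) \<le>
          indicat_real {0<..<1} r *\<^sub>R (r\<^sup>2 * exp (expo n r))"
        using b pk by (auto split: split_indicator)
    qed
    finally show ?thesis unfolding mom_Suc set_lebesgue_integral_def .
  qed
  have "mom (Suc n) \<le> mom n" for n
    unfolding mom_Suc unfolding mom_def set_lebesgue_integral_def
  proof (rule integral_mono)
    show "integrable lborel (\<lambda>r. indicator {0<..<1} r *\<^sub>R (r\<^sup>2 * exp (expo n r)))"
      using square_int by (simp add: set_integrable_def)
    show "integrable lborel (\<lambda>r. indicator {0<..<1} r *\<^sub>R exp (expo n r))"
      using mom_int by (auto simp: set_integrable_def)
  qed (auto split: split_indicator simp: power_le_one)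
  then have "k * scale n \<le> mom n" for n using Suc_ge[of n] by (meson order_trans)
  with k Suc_ge that show ?thesis by blast
qed

lemma mom_pos: "0 < mom n"
proof -
  obtain k where "0 < k" "\<And>n. k * scale n \<le> mom n" "\<And>n. k * scale n \<le> mom (Suc n)" by (rule mom_lower) blast
  then show ?thesis using scale_pos[of n] mult_pos_pos less_le_trans by blast
qed

lemma u_mono: "0 \<le> a \<Longrightarrow> a \<le> b \<Longrightarrow> b < 1 \<Longrightarrow> u a \<le> u b"
  by (rule deriv_nonneg_imp_le[where f' = "\<lambda>x. \<psi> x / x"])
     (auto intro!: u_cont' u_deriv divide_nonneg_nonneg psi_nonneg)

text \<open>Half of \<open>expo n\<close> is \<open>n * ln r - u r\<close> up to
  \<open>ln r / 2\<close>, so half of \<open>expo_le\<close> applies, with rate \<open>A\<close>.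
  The factor from \<open>ln r / 2\<close> is bounded from \<open>peak 0\<close> on; smaller radii
  are compared with \<open>peak 0\<close>.\<close>

lemma power_exp_u_le:
  obtains K where "0 < K" "\<And>n r. 0 \<le> r \<Longrightarrow> r < 1 \<Longrightarrow>
    r ^ n * exp (- u r) \<le> K * exp (expo n (peak n) / 2) * exp (- (A * \<bar>\<tau> r - \<tau>p n\<bar>))"
proof -
  define q where "q = peak 0"
  have q: "0 < q" "q < 1" using peak[of 0] by (auto simp: q_def)
  \<comment> \<open>Besides the loss from \<open>ln q\<close>, the terms \<open>u q - u 0\<close>
    and \<open>A * \<tau> q\<close> pay for moving a radius below \<open>q\<close> up to
    \<open>q\<close>.\<close>
  define K where "K = exp (A - ln q / 2 + (u q - u 0) + A * \<tau> q)"
  have big: "r ^ n * exp (- u r) \<le> exp (A - ln q / 2) * exp (expo n (peak n) / 2) * exp (- (A * \<bar>\<tau> r - \<tau>p n\<bar>))"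
    if r: "q \<le> r" "r < 1" for r n
  proof -
    have "r ^ n * exp (- u r) = exp (expo n r / 2 - ln r / 2)"
    proof -
      have "expo n r / 2 - ln r / 2 = real n * ln r - u r" by (simp add: expo_def field_simps)
      also have "exp \<dots> = r ^ n * exp (- u r)" using r q
        by (simp add: exp_diff exp_minus exp_of_nat_mult divide_inverse)
      finally show ?thesis by simp
    qed
    also have "\<dots> \<le> exp ((expo n (peak n) + 2 * A - 2 * A * \<bar>\<tau> r - \<tau>p n\<bar>) / 2 - ln q / 2)"
    proof (subst exp_le_cancel_iff, rule diff_mono)
      show "ln q / 2 \<le> ln r / 2" using r q by simp
      show "expo n r / 2 \<le> (expo n (peak n) + 2 * A - 2 * A * \<bar>\<tau> r - \<tau>p n\<bar>) / 2"
        using expo_le[of r n] r q by (intro divide_right_mono) auto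
    qed
    also have "\<dots> = exp (A - ln q / 2) * exp (expo n (peak n) / 2) * exp (- (A * \<bar>\<tau> r - \<tau>p n\<bar>))"
      by (simp add: field_simps flip: exp_add)
    finally show ?thesis .
  qed
  have u: "u 0 \<le> u q" and tq: "0 \<le> \<tau> q" using u_mono tau_nonneg q by auto
  show ?thesis
  proof (rule that[of K])
    show "0 < K" by (simp add: K_def)
    fix r n assume r: "0 \<le> r" "r < (1::real)"
    let ?t = "\<bar>\<tau> r - \<tau>p n\<bar>"
    show "r ^ n * exp (- u r) \<le> K * exp (expo n (peak n) / 2) * exp (- (A * ?t))"
    proof (cases "q \<le> r")
      case True
      have "exp (A - ln q / 2) \<le> K" unfolding K_def using u mult_nonneg_nonneg[OF less_imp_le[OF AB_pos(1)] tq] by simp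
      then have "exp (A - ln q / 2) * exp (expo n (peak n) / 2) * exp (- (A * ?t)) \<le>
         K * exp (expo n (peak n) / 2) * exp (- (A * ?t))" by (intro mult_right_mono) auto
      then show ?thesis using big[OF True r(2), of n] by linarith
    next
      case False
      have tp: "\<tau> q \<le> \<tau>p n" "\<tau> r \<le> \<tau> q" "0 \<le> \<tau> r"
        using tau_mono[of q "peak n"] tau_mono[of r q] q peak_0_le[of n] peak[of n] False r tau_nonneg
        by (auto simp: q_def)
      have "r ^ n * exp (- u r) \<le> q ^ n * exp (- u 0)"
        using False r u_mono[of 0 r] by (intro mult_mono power_mono) auto
      also have "\<dots> = exp (u q - u 0) * (q ^ n * exp (- u q))" by (simp flip: exp_add)
      also have "\<dots> \<le> exp (u q - u 0) * (exp (A - ln q / 2) * exp (expo n (peak n) / 2) * exp (- (A * \<bar>\<tau> q - \<tau>p n\<bar>)))"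
        using big[of q n] q by (intro mult_left_mono) auto
      also have "\<dots> = exp (A - ln q / 2 + (u q - u 0) + A * \<tau> q) * exp (expo n (peak n) / 2) * exp (- (A * \<tau>p n))"
        using tp by (simp add: algebra_simps flip: exp_add)
      also have "\<dots> \<le> K * exp (expo n (peak n) / 2) * exp (- (A * ?t))"
        unfolding K_def using tp AB_pos by (intro mult_left_mono) auto
      finally show ?thesis .
    qed
  qed
qed

section \<open>Coefficients of the reproducing kernel\<close>

text \<open>The \<open>n\<close>-th Fourier coefficient of the kernel on \<open>\<bar>z\<bar> = r\<close>, \<open>\<bar>\<zeta>\<bar> = s\<close>, multiplied by \<open>w z\<close> and \<open>w \<zeta>\<close>.\<close>

definition kcoeff :: "real \<Rightarrow> real \<Rightarrow> nat \<Rightarrow> real" where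
  "kcoeff r s n = r ^ n * exp (- u r) * (s ^ n * exp (- u s)) / (2 * mom n)"

lemma kcoeff_nonneg: "0 \<le> r \<Longrightarrow> 0 \<le> s \<Longrightarrow> 0 \<le> kcoeff r s n"
  using mom_pos[of n] by (simp add: kcoeff_def)

text \<open>The heights \<open>exp (expo n (peak n) / 2)\<close> of the two factors multiply to the
  height contained in \<open>scale n\<close>; only the width \<open>pp n\<close> remains in the
  denominator.\<close>

lemma kcoeff_le:
  obtains K where "0 < K" "\<And>r s n. 0 \<le> r \<Longrightarrow> r < 1 \<Longrightarrow> 0 \<le> s \<Longrightarrow> s < 1 \<Longrightarrow>
    kcoeff r s n \<le> K / pp n * exp (- (A * (\<bar>\<tau> r - \<tau>p n\<bar> + \<bar>\<tau> s - \<tau>p n\<bar>)))"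
proof -
  obtain K where K: "0 < K" "\<And>n r. 0 \<le> r \<Longrightarrow> r < 1 \<Longrightarrow>
    r ^ n * exp (- u r) \<le> K * exp (expo n (peak n) / 2) * exp (- (A * \<bar>\<tau> r - \<tau>p n\<bar>))"
    using power_exp_u_le by blast
  obtain k where k: "0 < k" "\<And>n. k * scale n \<le> mom n" "\<And>n. k * scale n \<le> mom (Suc n)" by (rule mom_lower) blast
  show ?thesis
  proof (rule that[of "K * K / (2 * k)"])
    show "0 < K * K / (2 * k)" using K k by simp
    fix r s :: real and n assume rs: "0 \<le> r" "r < 1" "0 \<le> s" "s < 1"
    note num = mult_mono[OF K(2)[OF rs(1,2), of n] K(2)[OF rs(3,4), of n]]
    have "kcoeff r s n \<le> (K * exp (expo n (peak n) / 2) * exp (- (A * \<bar>\<tau> r - \<tau>p n\<bar>))) *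
        (K * exp (expo n (peak n) / 2) * exp (- (A * \<bar>\<tau> s - \<tau>p n\<bar>))) / (2 * (k * scale n))"
      unfolding kcoeff_def using rs K(1) k(1) k(2)[of n] scale_pos[of n]
      by (intro frac_le num mult_nonneg_nonneg mult_pos_pos zero_le_power exp_ge_zero less_imp_le[OF K(1)])
        simp_all
    also have "\<dots> = K * K / (2 * k) * (exp (expo n (peak n) / 2) * exp (expo n (peak n) / 2)) / scale n *
        (exp (- (A * \<bar>\<tau> r - \<tau>p n\<bar>)) * exp (- (A * \<bar>\<tau> s - \<tau>p n\<bar>)))" by (simp add: field_simps)
    also have "exp (expo n (peak n) / 2) * exp (expo n (peak n) / 2) = exp (expo n (peak n))" by (simp flip: exp_add)
    also have "exp (- (A * \<bar>\<tau> r - \<tau>p n\<bar>)) * exp (- (A * \<bar>\<tau> s - \<tau>p n\<bar>)) =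
        exp (- (A * (\<bar>\<tau> r - \<tau>p n\<bar> + \<bar>\<tau> s - \<tau>p n\<bar>)))" by (simp add: algebra_simps flip: exp_add)
    finally show "kcoeff r s n \<le> K * K / (2 * k) / pp n * exp (- (A * (\<bar>\<tau> r - \<tau>p n\<bar> + \<bar>\<tau> s - \<tau>p n\<bar>)))"
      by (simp add: scale_def)
  qed
qed

text \<open>The difference is \<open>kcoeff r s n\<close> times the relative error of
  \<open>r * s\<close> against \<open>mom (Suc n) / mom n\<close>. Both are
  \<open>(peak n)\<^sup>2\<close> up to order \<open>pp n\<close> near the peak, and this factor
  cancels the \<open>1 / pp n\<close> of \<open>kcoeff_le\<close>.\<close>

lemma kcoeff_diff_le:
  obtains K where "0 < K" "\<And>r s n. 0 \<le> r \<Longrightarrow> r < 1 \<Longrightarrow> 0 \<le> s \<Longrightarrow> s < 1 \<Longrightarrow>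
    \<bar>kcoeff r s (Suc n) - kcoeff r s n\<bar> \<le> K * exp (- (3/4 * A * (\<bar>\<tau> r - \<tau>p n\<bar> + \<bar>\<tau> s - \<tau>p n\<bar>)))"
proof -
  \<comment> \<open>The distances of \<open>r\<close> and \<open>s\<close> from
    \<open>peak n\<close> cost this rate, leaving \<open>3/4\<close> of \<open>A\<close>.\<close>
  define \<eta> where "\<eta> = A / 4"
  have \<eta>: "0 < \<eta>" using AB_pos by (simp add: \<eta>_def)
  obtain Kc where Kc: "0 < Kc" "\<And>r s n. 0 \<le> r \<Longrightarrow> r < 1 \<Longrightarrow> 0 \<le> s \<Longrightarrow> s < 1 \<Longrightarrow>
    kcoeff r s n \<le> Kc / pp n * exp (- (A * (\<bar>\<tau> r - \<tau>p n\<bar> + \<bar>\<tau> s - \<tau>p n\<bar>)))" using kcoeff_le by blast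
  obtain K1 where K1: "0 < K1" "\<And>a b. 0 \<le> a \<Longrightarrow> a < 1 \<Longrightarrow> 0 \<le> b \<Longrightarrow> b < 1 \<Longrightarrow>
    \<bar>a - b\<bar> \<le> K1 * p b * exp (\<eta> * \<bar>\<tau> a - \<tau> b\<bar>)" using dist_le[OF \<eta>] by blast
  obtain K2 where K2: "0 < K2" "\<And>n. mom n \<le> K2 * scale n"
    "\<And>n. \<bar>mom (Suc n) - (peak n)\<^sup>2 * mom n\<bar> \<le> K2 * pp n * scale n" using expo_moment_bound by blast
  obtain k where k: "0 < k" "\<And>n. k * scale n \<le> mom n" "\<And>n. k * scale n \<le> mom (Suc n)" by (rule mom_lower) blast
  define K where "K = Kc * (K2 * (2 * K1 + 1) / k)"
  show ?thesis
  proof (rule that[of K])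
    show "0 < K" unfolding K_def using Kc(1) K1(1) K2(1) k(1)
      by (intro mult_pos_pos divide_pos_pos add_pos_pos) auto
    fix r s :: real and n assume rs: "0 \<le> r" "r < 1" "0 \<le> s" "s < 1"
    have pk: "0 < peak n" "peak n < 1" using peak by auto
    define t t' where "t = \<bar>\<tau> r - \<tau>p n\<bar>" and "t' = \<bar>\<tau> s - \<tau>p n\<bar>"
    have t: "0 \<le> t" "0 \<le> t'" by (auto simp: t_def t'_def)
    have mp: "0 < mom n" "0 < mom (Suc n)" using mom_pos by auto
    have "\<bar>r * s - (peak n)\<^sup>2\<bar> = \<bar>(r - peak n) * s + peak n * (s - peak n)\<bar>"
      by (simp add: algebra_simps power2_eq_square)
    also have "\<dots> \<le> \<bar>r - peak n\<bar> * s + peak n * \<bar>s - peak n\<bar>"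
      using rs pk by (intro order_trans[OF abs_triangle_ineq]) (simp add: abs_mult)
    also have "\<dots> \<le> \<bar>r - peak n\<bar> * 1 + 1 * \<bar>s - peak n\<bar>"
      using rs pk by (intro add_mono mult_mono) auto
    also have "\<dots> \<le> K1 * pp n * exp (\<eta> * t) + K1 * pp n * exp (\<eta> * t')"
      using K1(2)[of r "peak n"] K1(2)[of s "peak n"] rs pk by (simp add: t_def t'_def)
    also have "\<dots> \<le> K1 * pp n * exp (\<eta> * (t + t')) + K1 * pp n * exp (\<eta> * (t + t'))"
      using K1(1) pp_pos[of n] t \<eta> by (intro add_mono mult_left_mono) auto
    finally have d1: "\<bar>r * s - (peak n)\<^sup>2\<bar> \<le> 2 * K1 * pp n * exp (\<eta> * (t + t'))" by simp
    have "\<bar>r * s * mom n - mom (Suc n)\<bar> \<le> \<bar>r * s - (peak n)\<^sup>2\<bar> * mom n + \<bar>mom (Suc n) - (peak n)\<^sup>2 * mom n\<bar>"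
    proof -
      have "r * s * mom n - mom (Suc n) = (r * s - (peak n)\<^sup>2) * mom n - (mom (Suc n) - (peak n)\<^sup>2 * mom n)"
        by (simp add: algebra_simps)
      also have "\<bar>\<dots>\<bar> \<le> \<bar>(r * s - (peak n)\<^sup>2) * mom n\<bar> + \<bar>mom (Suc n) - (peak n)\<^sup>2 * mom n\<bar>"
        by (rule abs_triangle_ineq4)
      finally show ?thesis using mp by (simp add: abs_mult)
    qed
    also have "\<dots> \<le> (2 * K1 * pp n * exp (\<eta> * (t + t'))) * (K2 * scale n) + K2 * pp n * scale n * exp (\<eta> * (t + t'))"
    proof (rule add_mono)
      show "\<bar>r * s - (peak n)\<^sup>2\<bar> * mom n \<le> (2 * K1 * pp n * exp (\<eta> * (t + t'))) * (K2 * scale n)"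
        using mp K1(1) pp_pos[of n] by (intro mult_mono d1 K2(2)) auto
      have "K2 * pp n * scale n * 1 \<le> K2 * pp n * scale n * exp (\<eta> * (t + t'))"
        using K2(1) pp_pos[of n] scale_pos[of n] t \<eta> by (intro mult_left_mono) auto
      then show "\<bar>mom (Suc n) - (peak n)\<^sup>2 * mom n\<bar> \<le> K2 * pp n * scale n * exp (\<eta> * (t + t'))"
        using K2(3)[of n] by linarith
    qed
    also have "\<dots> = K2 * (2 * K1 + 1) * pp n * scale n * exp (\<eta> * (t + t'))" by (simp add: algebra_simps)
    finally have d2: "\<bar>r * s * mom n - mom (Suc n)\<bar> \<le> K2 * (2 * K1 + 1) * pp n * scale n * exp (\<eta> * (t + t'))" .
    have "kcoeff r s (Suc n) = kcoeff r s n * (r * s * mom n / mom (Suc n))"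
      using mp by (simp add: kcoeff_def field_simps)
    then have "kcoeff r s (Suc n) - kcoeff r s n = kcoeff r s n * ((r * s * mom n - mom (Suc n)) / mom (Suc n))"
      using mp by (simp add: diff_divide_distrib right_diff_distrib)
    then have "\<bar>kcoeff r s (Suc n) - kcoeff r s n\<bar> = kcoeff r s n * (\<bar>r * s * mom n - mom (Suc n)\<bar> / mom (Suc n))"
      using mp kcoeff_nonneg[of r s n] rs by (simp add: abs_mult)
    also have "\<dots> \<le> (Kc / pp n * exp (- (A * (t + t')))) *
        (K2 * (2 * K1 + 1) * pp n * scale n * exp (\<eta> * (t + t')) / (k * scale n))"
    proof (rule mult_mono)
      show "kcoeff r s n \<le> Kc / pp n * exp (- (A * (t + t')))" using Kc(2)[OF rs, of n] unfolding t_def t'_def .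
      have "0 \<le> K2 * (2 * K1 + 1) * pp n * scale n * exp (\<eta> * (t + t'))"
        using K2(1) K1(1) pp_pos[of n] scale_pos[of n] by (intro mult_nonneg_nonneg) auto
      then show "\<bar>r * s * mom n - mom (Suc n)\<bar> / mom (Suc n) \<le>
          K2 * (2 * K1 + 1) * pp n * scale n * exp (\<eta> * (t + t')) / (k * scale n)"
        using k(1) scale_pos[of n] by (intro frac_le d2 k(3)) auto
    qed (use mp Kc(1) pp_pos[of n] in \<open>auto intro!: mult_nonneg_nonneg divide_nonneg_nonneg\<close>)
    also have "\<dots> = K * (exp (- (A * (t + t'))) * exp (\<eta> * (t + t')))"
      using pp_pos[of n] scale_pos[of n] by (simp add: K_def)
    also have "exp (- (A * (t + t'))) * exp (\<eta> * (t + t')) = exp (- (3/4 * A * (t + t')))"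
    proof -
      have "- (A * x) + \<eta> * x = - (3/4 * A * x)" for x by (simp add: \<eta>_def field_simps)
      then show ?thesis by (simp flip: exp_add)
    qed
    finally show "\<bar>kcoeff r s (Suc n) - kcoeff r s n\<bar> \<le> K * exp (- (3/4 * A * (\<bar>\<tau> r - \<tau>p n\<bar> + \<bar>\<tau> s - \<tau>p n\<bar>)))"
      by (simp add: t_def t'_def)
  qed
qed

text \<open>\<open>sum_peak_exp\<close> sums \<open>pp n\<close> times an exponential, so each
  summand is written as a power of \<open>1 / pp n\<close> times \<open>pp n\<close>: the power is 3
  for the squares and 1 for the squared differences. Moving these powers to \<open>p r\<close> gives
  the exponents in the statement.\<close>

lemma coeff_bounds:
  obtains K where "0 < K"
    "\<And>r s. 0 \<le> r \<Longrightarrow> r < 1 \<Longrightarrow> 0 \<le> s \<Longrightarrow> s < 1 \<Longrightarrow> summable (kcoeff r s)"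
    "\<And>r s. 0 \<le> r \<Longrightarrow> r < 1 \<Longrightarrow> 0 \<le> s \<Longrightarrow> s < 1 \<Longrightarrow> summable (\<lambda>n. (kcoeff r s n)\<^sup>2) \<and>
       (\<Sum>n. (kcoeff r s n)\<^sup>2) \<le> K / (p r)^3 * exp (- (A * \<bar>\<tau> r - \<tau> s\<bar>))"
    "\<And>r s. 0 \<le> r \<Longrightarrow> r < 1 \<Longrightarrow> 0 \<le> s \<Longrightarrow> s < 1 \<Longrightarrow> summable (\<lambda>n. (kcoeff r s (Suc n) - kcoeff r s n)\<^sup>2) \<and>
       (kcoeff r s 0)\<^sup>2 + (\<Sum>n. (kcoeff r s (Suc n) - kcoeff r s n)\<^sup>2) \<le> K / p r * exp (- (A * \<bar>\<tau> r - \<tau> s\<bar>))"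
proof -
  \<comment> \<open>The unit of the rate budget, \<open>A = 4 * \<eta>\<close>: the squares decay at
    rate \<open>8 * \<eta>\<close>, the squared differences at rate
    \<open>6 * \<eta>\<close>.\<close>
  define \<eta> where "\<eta> = A / 4"
  have \<eta>: "0 < \<eta>" using AB_pos by (simp add: \<eta>_def)
  have A\<eta>: "A = 4 * \<eta>" by (simp add: \<eta>_def)
  obtain C where C: "0 < C" "\<And>r s. 0 \<le> r \<Longrightarrow> r < 1 \<Longrightarrow> 0 \<le> s \<Longrightarrow> s < 1 \<Longrightarrow> p r \<le> C * exp (\<eta> * \<bar>\<tau> r - \<tau> s\<bar>) * p s"
    using slowE[OF slow_p \<eta>] by blast
  obtain K1 where K1: "0 < K1" "\<And>r s n. 0 \<le> r \<Longrightarrow> r < 1 \<Longrightarrow> 0 \<le> s \<Longrightarrow> s < 1 \<Longrightarrow>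
    kcoeff r s n \<le> K1 / pp n * exp (- (A * (\<bar>\<tau> r - \<tau>p n\<bar> + \<bar>\<tau> s - \<tau>p n\<bar>)))" using kcoeff_le by blast
  obtain K2 where K2: "0 < K2" "\<And>r s n. 0 \<le> r \<Longrightarrow> r < 1 \<Longrightarrow> 0 \<le> s \<Longrightarrow> s < 1 \<Longrightarrow>
    \<bar>kcoeff r s (Suc n) - kcoeff r s n\<bar> \<le> K2 * exp (- (3/4 * A * (\<bar>\<tau> r - \<tau>p n\<bar> + \<bar>\<tau> s - \<tau>p n\<bar>)))"
    using kcoeff_diff_le by blast
  obtain S where S: "0 < S" "\<And>T. summable (\<lambda>n. pp n * exp (- (\<eta> * \<bar>\<tau>p n - T\<bar>)))"
    "\<And>T. (\<Sum>n. pp n * exp (- (\<eta> * \<bar>\<tau>p n - T\<bar>))) \<le> S" using sum_peak_exp[OF \<eta>] by blast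
  have pk: "0 \<le> peak n" "peak n < 1" for n using peak(1)[of n] peak(2)[of n] by auto
  have inv: "1 / pp n \<le> C * exp (\<eta> * \<bar>\<tau> r - \<tau>p n\<bar>) / p r" if "0 \<le> r" "r < 1" for r n
    using C(2)[of r "peak n"] pk[of n] that pp_pos[of n] p_pos[of r] by (simp add: field_simps)
  have c_le: "kcoeff r s n \<le> (K1 * C\<^sup>2 / (p r)\<^sup>2) * (pp n * exp (- (\<eta> * \<bar>\<tau>p n - \<tau> r\<bar>)))"
    and c2_le: "(kcoeff r s n)\<^sup>2 \<le> (K1\<^sup>2 * C^3 / (p r)^3 * exp (- (A * \<bar>\<tau> r - \<tau> s\<bar>))) * (pp n * exp (- (\<eta> * \<bar>\<tau>p n - \<tau> r\<bar>)))"
    and d2_le: "(kcoeff r s (Suc n) - kcoeff r s n)\<^sup>2 \<le> (K2\<^sup>2 * C / p r * exp (- (A * \<bar>\<tau> r - \<tau> s\<bar>))) * (pp n * exp (- (\<eta> * \<bar>\<tau>p n - \<tau> r\<bar>)))"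
    and c0_le: "(kcoeff r s n)\<^sup>2 \<le> (K1 / pp n)\<^sup>2 * exp (- (A * \<bar>\<tau> r - \<tau> s\<bar>))"
    if rs: "0 \<le> r" "r < 1" "0 \<le> s" "s < 1" for r s n
  proof -
    define t t' where "t = \<bar>\<tau> r - \<tau>p n\<bar>" and "t' = \<bar>\<tau> s - \<tau>p n\<bar>"
    define z where "z = exp (\<eta> * t)"
    have t: "0 \<le> t" "0 \<le> t'" "\<bar>\<tau>p n - \<tau> r\<bar> = t" and tt: "\<bar>\<tau> r - \<tau> s\<bar> \<le> t + t'" by (auto simp: t_def t'_def)
    have pr: "0 < p r" and pn: "0 < pp n" using p_pos rs pp_pos by auto
    have z: "0 < z" "1 / pp n \<le> C * z / p r" using inv[OF rs(1,2), of n] by (auto simp: z_def t_def)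
    have z0: "0 \<le> 1 / pp n" using pn by simp
    have zp: "z ^ k = exp (real k * \<eta> * t)" for k by (simp add: z_def mult.assoc flip: exp_of_nat_mult)
    have c: "0 \<le> kcoeff r s n" "kcoeff r s n \<le> K1 / pp n * exp (- (A * (t + t')))"
      using kcoeff_nonneg rs K1(2)[OF rs, of n] by (auto simp: t_def t'_def)
    have d: "\<bar>kcoeff r s (Suc n) - kcoeff r s n\<bar> \<le> K2 * exp (- (3/4 * A * (t + t')))"
      using K2(2)[OF rs, of n] by (auto simp: t_def t'_def)
    have p1: "(1 / pp n) ^ k \<le> (C * z / p r) ^ k" for k by (rule power_mono[OF z(2) z0])
    have "kcoeff r s n \<le> K1 * (1 / pp n)\<^sup>2 * pp n * exp (- (A * (t + t')))"
      using c(2) pn by (simp add: power2_eq_square)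
    also have "\<dots> \<le> K1 * (C * z / p r)\<^sup>2 * pp n * exp (- (A * (t + t')))"
      using K1(1) pn p1[of 2] by (intro mult_right_mono mult_left_mono) auto
    also have "\<dots> = (K1 * C\<^sup>2 / (p r)\<^sup>2) * (pp n * (z\<^sup>2 * exp (- (A * (t + t')))))"
      by (simp add: power_mult_distrib power_divide mult_ac)
    also have "\<dots> \<le> (K1 * C\<^sup>2 / (p r)\<^sup>2) * (pp n * exp (- (\<eta> * t)))"
    proof (intro mult_left_mono)
      have "0 \<le> \<eta> * t" "0 \<le> \<eta> * t'" using t \<eta> by auto
      then have "real 2 * \<eta> * t + - (4 * \<eta> * (t + t')) \<le> - (\<eta> * t)" by (simp add: algebra_simps)
      then show "z\<^sup>2 * exp (- (A * (t + t'))) \<le> exp (- (\<eta> * t))"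
        unfolding zp A\<eta> exp_add[symmetric] by simp
    qed (use K1(1) pn in auto)
    finally show "kcoeff r s n \<le> (K1 * C\<^sup>2 / (p r)\<^sup>2) * (pp n * exp (- (\<eta> * \<bar>\<tau>p n - \<tau> r\<bar>)))"
      by (simp only: t)
    have c2: "(kcoeff r s n)\<^sup>2 \<le> (K1 / pp n * exp (- (A * (t + t'))))\<^sup>2" using c by (intro power_mono) auto
    also have "\<dots> = (K1 / pp n)\<^sup>2 * exp (- (2 * A * (t + t')))"
      unfolding power_mult_distrib by (simp flip: exp_of_nat_mult)
    finally have c2: "(kcoeff r s n)\<^sup>2 \<le> (K1 / pp n)\<^sup>2 * exp (- (2 * A * (t + t')))" .
    have "A * \<bar>\<tau> r - \<tau> s\<bar> \<le> A * (t + t')" using tt AB_pos by (intro mult_left_mono) auto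
    moreover have "0 \<le> A * (t + t')" using t AB_pos by simp
    ultimately have "exp (- (2 * A * (t + t'))) \<le> exp (- (A * \<bar>\<tau> r - \<tau> s\<bar>))" by simp
    then have "(K1 / pp n)\<^sup>2 * exp (- (2 * A * (t + t'))) \<le> (K1 / pp n)\<^sup>2 * exp (- (A * \<bar>\<tau> r - \<tau> s\<bar>))"
      by (intro mult_left_mono) auto
    then show "(kcoeff r s n)\<^sup>2 \<le> (K1 / pp n)\<^sup>2 * exp (- (A * \<bar>\<tau> r - \<tau> s\<bar>))" using c2 by linarith
    \<comment> \<open>Budget: \<open>k\<close> units turn powers of \<open>1 / pp n\<close> into
      powers of \<open>1 / p r\<close>, one is kept for the sum over \<open>n\<close>, and four give
      the decay in \<open>\<bar>\<tau> r - \<tau> s\<bar>\<close>. The pairs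
      \<open>k = 3, m = 8\<close> and \<open>k = 1, m = 6\<close> below use it up.\<close>
    have ex: "z ^ k * exp (- (m * \<eta> * (t + t'))) \<le> exp (- (A * \<bar>\<tau> r - \<tau> s\<bar>)) * exp (- (\<eta> * t))"
      if "real k + 5 \<le> m" for k m
    proof -
      have "A * \<bar>\<tau> r - \<tau> s\<bar> \<le> 4 * \<eta> * (t + t')" unfolding A\<eta> using tt \<eta> by (intro mult_left_mono) auto
      moreover have "(real k + 5) * (\<eta> * t) \<le> m * (\<eta> * t)" "5 * (\<eta> * t') \<le> m * (\<eta> * t')"
        using that t \<eta> by (intro mult_right_mono; simp)+
      moreover have "0 \<le> \<eta> * t'" using t \<eta> by simp
      ultimately have "real k * \<eta> * t + - (m * \<eta> * (t + t')) \<le> - (A * \<bar>\<tau> r - \<tau> s\<bar>) + - (\<eta> * t)"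
        by (simp add: algebra_simps)
      then show ?thesis unfolding zp exp_add[symmetric] by simp
    qed
    have "(kcoeff r s n)\<^sup>2 \<le> K1\<^sup>2 * (1 / pp n) ^ 3 * pp n * exp (- (2 * A * (t + t')))"
      using c2 pn by (simp add: power2_eq_square power3_eq_cube)
    also have "\<dots> \<le> K1\<^sup>2 * (C * z / p r) ^ 3 * pp n * exp (- (2 * A * (t + t')))"
      using pn p1[of 3] by (intro mult_right_mono mult_left_mono) auto
    also have "\<dots> = K1\<^sup>2 * C^3 / (p r)^3 * pp n * (z^3 * exp (- (8 * \<eta> * (t + t'))))"
      by (simp add: power_mult_distrib power_divide mult_ac A\<eta>)
    also have "\<dots> \<le> K1\<^sup>2 * C^3 / (p r)^3 * pp n * (exp (- (A * \<bar>\<tau> r - \<tau> s\<bar>)) * exp (- (\<eta> * t)))"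
      using ex[of 3 8] C(1) pr pn by (intro mult_left_mono) auto
    finally show "(kcoeff r s n)\<^sup>2 \<le> (K1\<^sup>2 * C^3 / (p r)^3 * exp (- (A * \<bar>\<tau> r - \<tau> s\<bar>))) * (pp n * exp (- (\<eta> * \<bar>\<tau>p n - \<tau> r\<bar>)))"
      by (simp add: t mult_ac)
    have "(kcoeff r s (Suc n) - kcoeff r s n)\<^sup>2 = \<bar>kcoeff r s (Suc n) - kcoeff r s n\<bar>\<^sup>2" by simp
    also have "\<dots> \<le> (K2 * exp (- (3/4 * A * (t + t'))))\<^sup>2" using d by (intro power_mono) auto
    also have "\<dots> = K2\<^sup>2 * (1 / pp n) ^ 1 * pp n * exp (- (6 * \<eta> * (t + t')))"
      unfolding power_mult_distrib using pn by (simp add: A\<eta> flip: exp_of_nat_mult)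
    also have "\<dots> \<le> K2\<^sup>2 * (C * z / p r) ^ 1 * pp n * exp (- (6 * \<eta> * (t + t')))"
      using pn p1[of 1] by (intro mult_right_mono mult_left_mono) auto
    also have "\<dots> = K2\<^sup>2 * C / p r * pp n * (z^1 * exp (- (6 * \<eta> * (t + t'))))"
      by (simp add: mult_ac)
    also have "\<dots> \<le> K2\<^sup>2 * C / p r * pp n * (exp (- (A * \<bar>\<tau> r - \<tau> s\<bar>)) * exp (- (\<eta> * t)))"
      using ex[of 1 6] C(1) pr pn by (intro mult_left_mono) auto
    finally show "(kcoeff r s (Suc n) - kcoeff r s n)\<^sup>2 \<le> (K2\<^sup>2 * C / p r * exp (- (A * \<bar>\<tau> r - \<tau> s\<bar>))) * (pp n * exp (- (\<eta> * \<bar>\<tau>p n - \<tau> r\<bar>)))"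
      by (simp add: t mult_ac)
  qed
  have summ: "summable f \<and> suminf f \<le> M * S" if "\<And>n. 0 \<le> f n" "\<And>n. f n \<le> M * (pp n * exp (- (\<eta> * \<bar>\<tau>p n - T\<bar>)))" "0 \<le> M" for f M T
  proof
    have s2: "summable (\<lambda>n. M * (pp n * exp (- (\<eta> * \<bar>\<tau>p n - T\<bar>))))" by (intro summable_mult S)
    show s1: "summable f" by (rule summable_comparison_test'[OF s2, of 0]) (use that in auto)
    have "suminf f \<le> (\<Sum>n. M * (pp n * exp (- (\<eta> * \<bar>\<tau>p n - T\<bar>))))" by (intro suminf_le that s1 s2)
    also have "\<dots> = M * (\<Sum>n. pp n * exp (- (\<eta> * \<bar>\<tau>p n - T\<bar>)))" by (rule suminf_mult[OF S(2)])
    also have "\<dots> \<le> M * S" using S(3) that by (intro mult_left_mono) auto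
    finally show "suminf f \<le> M * S" .
  qed
  define K where "K = K1\<^sup>2 * C^3 * S + (K2\<^sup>2 * C * S + (K1 / pp 0)\<^sup>2 * L)"
  have Kp: "0 < K1\<^sup>2 * C^3 * S" "0 < K2\<^sup>2 * C * S" "0 \<le> (K1 / pp 0)\<^sup>2 * L"
    using K1 K2 C S L_pos by auto
  show ?thesis
  proof (rule that[of K])
    show "0 < K" using Kp by (simp add: K_def)
    fix r s :: real assume rs: "0 \<le> r" "r < 1" "0 \<le> s" "s < 1"
    have pr: "0 < p r" "p r \<le> L" using p_pos p_le_L rs by auto
    let ?e = "exp (- (A * \<bar>\<tau> r - \<tau> s\<bar>))"
    show "summable (kcoeff r s)"
      using summ[of "kcoeff r s" "K1 * C\<^sup>2 / (p r)\<^sup>2" "\<tau> r"] c_le[OF rs] kcoeff_nonneg rs K1(1) by auto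
    have "summable (\<lambda>n. (kcoeff r s n)\<^sup>2) \<and> (\<Sum>n. (kcoeff r s n)\<^sup>2) \<le> (K1\<^sup>2 * C^3 / (p r)^3 * ?e) * S"
      by (rule summ[OF _ c2_le[OF rs]]) (use C(1) pr in auto)
    moreover have "(K1\<^sup>2 * C^3 / (p r)^3 * ?e) * S \<le> K / (p r)^3 * ?e"
    proof -
      have "(K1\<^sup>2 * C^3 / (p r)^3 * ?e) * S = (K1\<^sup>2 * C^3 * S) / (p r)^3 * ?e" by simp
      also have "\<dots> \<le> K / (p r)^3 * ?e" using Kp pr
        by (intro mult_right_mono divide_right_mono) (auto simp: K_def)
      finally show ?thesis .
    qed
    ultimately show "summable (\<lambda>n. (kcoeff r s n)\<^sup>2) \<and> (\<Sum>n. (kcoeff r s n)\<^sup>2) \<le> K / (p r)^3 * ?e" by auto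
    have "summable (\<lambda>n. (kcoeff r s (Suc n) - kcoeff r s n)\<^sup>2) \<and> (\<Sum>n. (kcoeff r s (Suc n) - kcoeff r s n)\<^sup>2) \<le> (K2\<^sup>2 * C / p r * ?e) * S"
      by (rule summ[OF _ d2_le[OF rs]]) (use C(1) pr in auto)
    \<comment> \<open>The boundary term carries the exponential but no power of
      \<open>1 / p r\<close>; \<open>p r \<le> L\<close> allows one to be inserted.\<close>
    moreover have "(kcoeff r s 0)\<^sup>2 \<le> (K1 / pp 0)\<^sup>2 * (L / p r) * ?e"
    proof -
      have "(kcoeff r s 0)\<^sup>2 \<le> (K1 / pp 0)\<^sup>2 * 1 * ?e" using c0_le[OF rs, of 0] by simp
      also have "\<dots> \<le> (K1 / pp 0)\<^sup>2 * (L / p r) * ?e"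
        using pr by (intro mult_right_mono mult_left_mono) auto
      finally show ?thesis .
    qed
    moreover have "(K2\<^sup>2 * C / p r * ?e) * S + (K1 / pp 0)\<^sup>2 * (L / p r) * ?e \<le> K / p r * ?e"
    proof -
      have "(K2\<^sup>2 * C / p r * ?e) * S + (K1 / pp 0)\<^sup>2 * (L / p r) * ?e = (K2\<^sup>2 * C * S + (K1 / pp 0)\<^sup>2 * L) / p r * ?e"
        by (simp add: add_divide_distrib distrib_right)
      also have "\<dots> \<le> K / p r * ?e" using Kp pr
        by (intro mult_right_mono divide_right_mono) (auto simp: K_def)
      finally show ?thesis .
    qed
    ultimately show "summable (\<lambda>n. (kcoeff r s (Suc n) - kcoeff r s n)\<^sup>2) \<and>
       (kcoeff r s 0)\<^sup>2 + (\<Sum>n. (kcoeff r s (Suc n) - kcoeff r s n)\<^sup>2) \<le> K / p r * ?e" by auto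
  qed
qed

end

section \<open>Integral means of Fourier series\<close>

lemma cos_multiple_has_integral:
  fixes k :: int
  shows "((\<lambda>\<theta>. cos (of_int k * \<theta>)) has_integral (if k = 0 then 2 * pi else 0)) {-pi..pi}"
proof (cases "k = 0")
  case True
  then show ?thesis using has_integral_const_real[of "1::real" "-pi" pi] by simp
next
  case False
  have "((\<lambda>\<theta>. cos (of_int k * \<theta>)) has_integral (sin (of_int k * pi) / of_int k - sin (of_int k * (-pi)) / of_int k)) {-pi..pi}"
    by (rule fundamental_theorem_of_calculus)
       (use False in \<open>auto intro!: derivative_eq_intros simp: has_real_derivative_iff_has_vector_derivative[symmetric]\<close>)
  moreover have "sin (of_int k * pi) = 0" by (simp add: mult.commute)
  ultimately show ?thesis using False by simp
qed

lemma trig_poly_norm_has_integral: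
  fixes c :: "nat \<Rightarrow> real"
  shows "((\<lambda>\<theta>. (norm (\<Sum>n<N. of_real (c n) * cis (real n * \<theta>)))\<^sup>2) has_integral 2 * pi * (\<Sum>n<N. (c n)\<^sup>2)) {-pi..pi}"
proof -
  have eq: "(norm (\<Sum>n<N. of_real (c n) * cis (real n * \<theta>)))\<^sup>2 =
      (\<Sum>n<N. \<Sum>m<N. c n * c m * cos (of_int (int n - int m) * \<theta>))" for \<theta>
  proof -
    have "(norm (\<Sum>n<N. of_real (c n) * cis (real n * \<theta>)))\<^sup>2 =
        (\<Sum>n<N. c n * cos (real n * \<theta>))\<^sup>2 + (\<Sum>n<N. c n * sin (real n * \<theta>))\<^sup>2"
      by (simp add: cmod_power2 Re_sum Im_sum)
    also have "\<dots> = (\<Sum>n<N. \<Sum>m<N. c n * c m * (cos (real n * \<theta>) * cos (real m * \<theta>) + sin (real n * \<theta>) * sin (real m * \<theta>)))"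
      by (simp add: power2_eq_square sum_product flip: sum.distrib) (simp add: algebra_simps)
    also have "\<dots> = (\<Sum>n<N. \<Sum>m<N. c n * c m * cos (of_int (int n - int m) * \<theta>))"
      by (simp add: cos_diff left_diff_distrib)
    finally show ?thesis .
  qed
  have "((\<lambda>\<theta>. \<Sum>n<N. \<Sum>m<N. c n * c m * cos (of_int (int n - int m) * \<theta>)) has_integral
      (\<Sum>n<N. \<Sum>m<N. c n * c m * (if int n - int m = 0 then 2 * pi else 0))) {-pi..pi}"
    by (intro has_integral_sum has_integral_mult_right cos_multiple_has_integral) auto
  also have "(\<Sum>n<N. \<Sum>m<N. c n * c m * (if int n - int m = 0 then 2 * pi else 0)) =
      (\<Sum>n<N. \<Sum>m<N. if n = m then 2 * pi * (c n)\<^sup>2 else 0)"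
    by (intro sum.cong refl) (auto simp: power2_eq_square)
  also have "\<dots> = 2 * pi * (\<Sum>n<N. (c n)\<^sup>2)" by (simp add: sum_distrib_left)
  finally show ?thesis unfolding eq .
qed

lemma norm_of_real_cis [simp]: "norm (of_real a * cis t) = \<bar>a\<bar>"
  by (simp add: norm_mult)

text \<open>Parseval's identity holds for the partial sums, and Fatou's lemma passes the upper bound
  to the limit.\<close>

lemma Bessel_nn_integral:
  fixes c :: "nat \<Rightarrow> real"
  assumes c: "summable (\<lambda>n. \<bar>c n\<bar>)" "summable (\<lambda>n. (c n)\<^sup>2)"
  shows "(\<integral>\<^sup>+\<theta>\<in>{-pi..pi}. ennreal ((norm (\<Sum>n. of_real (c n) * cis (real n * \<theta>)))\<^sup>2) \<partial>lborel)
     \<le> ennreal (2 * pi * (\<Sum>n. (c n)\<^sup>2))"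
proof -
  let ?S = "\<lambda>N \<theta>. \<Sum>n<N. of_real (c n) * cis (real n * \<theta>)"
  have [measurable]: "?S N \<in> borel_measurable borel" for N
    by (intro borel_measurable_continuous_onI continuous_intros)
  have conv: "(\<lambda>N. ennreal ((norm (?S N \<theta>))\<^sup>2) * indicator {-pi..pi} \<theta>) \<longlonglongrightarrow>
      ennreal ((norm (\<Sum>n. of_real (c n) * cis (real n * \<theta>)))\<^sup>2) * indicator {-pi..pi} \<theta>" for \<theta>
  proof -
    have "summable (\<lambda>n. of_real (c n) * cis (real n * \<theta>) :: complex)"
      by (rule summable_norm_cancel) (simp add: c)
    then have "(\<lambda>N. ?S N \<theta>) \<longlonglongrightarrow> (\<Sum>n. of_real (c n) * cis (real n * \<theta>))" by (rule summable_LIMSEQ)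
    then show ?thesis
      by (cases "\<theta> \<in> {-pi..pi}") (auto intro!: tendsto_intros)
  qed
  have "(\<integral>\<^sup>+\<theta>\<in>{-pi..pi}. ennreal ((norm (\<Sum>n. of_real (c n) * cis (real n * \<theta>)))\<^sup>2) \<partial>lborel) =
      (\<integral>\<^sup>+\<theta>. liminf (\<lambda>N. ennreal ((norm (?S N \<theta>))\<^sup>2) * indicator {-pi..pi} \<theta>) \<partial>lborel)"
    by (intro nn_integral_cong lim_imp_Liminf[symmetric] conv) simp
  also have "\<dots> \<le> liminf (\<lambda>N. \<integral>\<^sup>+\<theta>\<in>{-pi..pi}. ennreal ((norm (?S N \<theta>))\<^sup>2) \<partial>lborel)"
    by (intro nn_integral_liminf) simp
  also have "\<dots> \<le> liminf (\<lambda>N. ennreal (2 * pi * (\<Sum>n. (c n)\<^sup>2)))"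
  proof (intro Liminf_mono always_eventually allI)
    fix N
    have "(\<integral>\<^sup>+\<theta>\<in>{-pi..pi}. ennreal ((norm (?S N \<theta>))\<^sup>2) \<partial>lborel) =
      (\<integral>\<^sup>+\<theta>. ennreal (indicator {-pi..pi} \<theta> * (norm (?S N \<theta>))\<^sup>2) \<partial>lborel)"
      by (intro nn_integral_cong) (auto split: split_indicator)
    also have "\<dots> = ennreal (2 * pi * (\<Sum>n<N. (c n)\<^sup>2))"
      by (rule nn_integral_has_integral_lebesgue[OF _ trig_poly_norm_has_integral]) auto
    also have "\<dots> \<le> ennreal (2 * pi * (\<Sum>n. (c n)\<^sup>2))"
      by (intro ennreal_leI mult_left_mono sum_le_suminf c) auto
    finally show "(\<integral>\<^sup>+\<theta>\<in>{-pi..pi}. ennreal ((norm (?S N \<theta>))\<^sup>2) \<partial>lborel) \<le> ennreal (2 * pi * (\<Sum>n. (c n)\<^sup>2))" .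
  qed
  also have "\<dots> = ennreal (2 * pi * (\<Sum>n. (c n)\<^sup>2))" by (simp add: Liminf_const)
  finally show ?thesis .
qed

text \<open>Up to \<open>pi / 3\<close> the derivative \<open>cos y - 1 / 2\<close> is nonnegative;
  beyond, \<open>sin x \<ge> sqrt 3 / 2 \<ge> 4 / 5\<close>, which exceeds
  \<open>pi / 4\<close>.\<close>

lemma sin_ge_half:
  assumes "0 \<le> x" "x \<le> pi / 2"
  shows "x / 2 \<le> sin x"
proof (cases "x \<le> pi / 3")
  case True
  have "sin 0 - 0 / 2 \<le> sin x - x / 2"
  proof (rule deriv_nonneg_imp_le[where f = "\<lambda>x. sin x - x / 2" and f' = "\<lambda>x. cos x - 1 / 2"])
    fix y assume y: "0 < y" "y < x"
    show "((\<lambda>x. sin x - x / 2) has_real_derivative cos y - 1 / 2) (at y)"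
      by (auto intro!: derivative_eq_intros)
    have "cos (pi / 3) \<le> cos y" using y True by (intro cos_monotone_0_pi_le) auto
    then show "0 \<le> cos y - 1 / 2" by (simp add: cos_60)
  qed (use assms in \<open>auto intro!: continuous_intros\<close>)
  then show ?thesis by simp
next
  case False
  have "sin (pi / 3) \<le> sin x" using False assms by (intro sin_monotone_2pi_le) auto
  moreover have "sqrt 3 / 2 \<ge> 4 / 5"
  proof -
    have "8 / 5 \<le> sqrt 3" by (rule real_le_rsqrt) (simp add: power2_eq_square)
    then show ?thesis by simp
  qed
  ultimately show ?thesis using assms pi_less_4 sin_60 pi_approx by simp
qed

text \<open>The norm equals \<open>2 * sin (\<bar>\<theta>\<bar> / 2)\<close>, and
  \<open>\<bar>\<theta>\<bar> / 2\<close> lies in the range of \<open>sin_ge_half\<close>.\<close>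

lemma norm_one_minus_cis_ge:
  assumes "\<theta> \<in> {-pi..pi}"
  shows "(\<theta> / 2)\<^sup>2 \<le> (norm (1 - cis \<theta>))\<^sup>2"
proof -
  have "(norm (1 - cis \<theta>))\<^sup>2 = (1 - cos \<theta>)\<^sup>2 + (sin \<theta>)\<^sup>2"
    by (simp add: cmod_power2)
  also have "\<dots> = 1 - 2 * cos \<theta> + ((sin \<theta>)\<^sup>2 + (cos \<theta>)\<^sup>2)"
    by (simp add: power2_eq_square algebra_simps)
  also have "\<dots> = 2 - 2 * cos \<theta>" by simp
  also have "\<dots> = 4 * (sin (\<theta> / 2))\<^sup>2"
    using cos_double_sin[of "\<theta> / 2"] by simp
  finally have e: "(norm (1 - cis \<theta>))\<^sup>2 = (2 * sin (\<bar>\<theta>\<bar> / 2))\<^sup>2"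
    by (cases "\<theta> \<ge> 0") (auto simp: power_mult_distrib)
  have "\<bar>\<theta>\<bar> / 2 / 2 \<le> sin (\<bar>\<theta>\<bar> / 2)" using assms by (intro sin_ge_half) auto
  then have "(\<bar>\<theta>\<bar> / 2)\<^sup>2 \<le> (2 * sin (\<bar>\<theta>\<bar> / 2))\<^sup>2" by (intro power_mono) auto
  then show ?thesis unfolding e by (simp add: power_divide)
qed

lemma ennreal_lincomb3:
  assumes "0 \<le> a" "0 \<le> b" "0 \<le> c" "0 \<le> x" "0 \<le> y" "0 \<le> z"
  shows "ennreal (a * x + b * y + c * z) = ennreal a * ennreal x + ennreal b * ennreal y + ennreal c * ennreal z"
  using assms by (simp add: ennreal_mult ennreal_plus)

text \<open>The inequality of Carlson and Beurling: AM-GM splits \<open>\<bar>F\<bar>\<close> into \<open>\<mu> \<bar>F\<bar>\<^sup>2 W / 2\<close> and \<open>1 / (2 \<mu> W)\<close> with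
  \<open>W \<theta> = 1 + \<bar>1 - cis \<theta>\<bar>\<^sup>2 / \<delta>\<^sup>2\<close>; multiplication by \<open>1 - cis \<theta>\<close> takes differences of the coefficients.\<close>

lemma fourier_L1_le:
  fixes c :: "nat \<Rightarrow> real"
  assumes c: "summable (\<lambda>n. \<bar>c n\<bar>)" "summable (\<lambda>n. (c n)\<^sup>2)" "summable (\<lambda>n. (c (Suc n) - c n)\<^sup>2)"
    and pos: "0 < \<delta>" "0 < \<mu>"
  shows "(\<integral>\<^sup>+\<theta>\<in>{-pi..pi}. ennreal (norm (\<Sum>n. of_real (c n) * cis (real n * \<theta>))) \<partial>lborel)
     \<le> ennreal (\<mu> * pi * ((\<Sum>n. (c n)\<^sup>2) + ((c 0)\<^sup>2 + (\<Sum>n. (c (Suc n) - c n)\<^sup>2)) / \<delta>\<^sup>2) + pi * \<delta> / \<mu>)"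
proof -
  \<comment> \<open>The coefficients of \<open>(1 - cis \<theta>) * F \<theta>\<close>; the entry at
    0 has no predecessor, hence the separate term \<open>(c 0)\<^sup>2\<close> in the bound.\<close>
  define b where "b n = (case n of 0 \<Rightarrow> c 0 | Suc m \<Rightarrow> c (Suc m) - c m)" for n
  define F where "F \<theta> = (\<Sum>n. of_real (c n) * cis (real n * \<theta>))" for \<theta>
  define G where "G \<theta> = (\<Sum>n. of_real (b n) * cis (real n * \<theta>))" for \<theta>
  have b_simps: "b 0 = c 0" "b (Suc n) = c (Suc n) - c n" for n by (auto simp: b_def)
  have c1: "summable (\<lambda>n. \<bar>c (Suc n)\<bar>)" using c(1) by (subst summable_Suc_iff)
  have "summable (\<lambda>n. \<bar>b (Suc n)\<bar>)"
    by (rule summable_comparison_test'[OF summable_add[OF c1 c(1)], of 0]) (auto simp: b_simps)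
  then have b1: "summable (\<lambda>n. \<bar>b n\<bar>)" by (subst (asm) summable_Suc_iff)
  have "summable (\<lambda>n. (b (Suc n))\<^sup>2)" using c(3) by (simp add: b_simps)
  then have b2: "summable (\<lambda>n. (b n)\<^sup>2)" by (subst (asm) summable_Suc_iff)
  have sumb2: "(\<Sum>n. (b n)\<^sup>2) = (c 0)\<^sup>2 + (\<Sum>n. (c (Suc n) - c n)\<^sup>2)"
    using suminf_split_head[OF b2] by (simp add: b_simps)
  have sF: "summable (\<lambda>n. of_real (c n) * cis (real n * \<theta>) :: complex)" for \<theta>
    by (rule summable_norm_cancel) (simp add: c)
  have sG: "summable (\<lambda>n. of_real (b n) * cis (real n * \<theta>) :: complex)" for \<theta>
    by (rule summable_norm_cancel) (simp add: b1)
  have GF: "G \<theta> = (1 - cis \<theta>) * F \<theta>" for \<theta>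
  proof -
    let ?f = "\<lambda>n. of_real (c n) * cis (real n * \<theta>) :: complex"
    have "G \<theta> = of_real (c 0) + (\<Sum>n. of_real (b (Suc n)) * cis (real (Suc n) * \<theta>))"
      using suminf_split_head[OF sG[of \<theta>]] by (simp add: G_def b_simps algebra_simps)
    also have "(\<lambda>n. of_real (b (Suc n)) * cis (real (Suc n) * \<theta>)) = (\<lambda>n. ?f (Suc n) - cis \<theta> * ?f n)"
      by (auto simp: b_simps algebra_simps cis_mult)
    also have "(\<Sum>n. ?f (Suc n) - cis \<theta> * ?f n) = (\<Sum>n. ?f (Suc n)) - cis \<theta> * F \<theta>"
      unfolding F_def suminf_mult[OF sF[of \<theta>], of "cis \<theta>", symmetric]
      by (rule suminf_diff[symmetric])
         (use sF[of \<theta>] summable_Suc_iff[of ?f] summable_mult[OF sF[of \<theta>]] in \<open>auto simp only:\<close>)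
    also have "(\<Sum>n. ?f (Suc n)) = F \<theta> - of_real (c 0)"
      unfolding F_def using suminf_split_head[OF sF[of \<theta>]] by simp
    finally show ?thesis by (simp add: algebra_simps)
  qed
  have Fm: "F \<in> borel_measurable borel" and Gm: "G \<in> borel_measurable borel"
    unfolding F_def G_def by (intro borel_measurable_suminf borel_measurable_continuous_onI continuous_intros)+
  have pt: "norm (F \<theta>) \<le> \<mu> / 2 * ((norm (F \<theta>))\<^sup>2 + (norm (G \<theta>))\<^sup>2 / \<delta>\<^sup>2) + 1 / (2 * \<mu>) * (1 / (1 + (\<theta> / (2 * \<delta>))\<^sup>2))"
    if "\<theta> \<in> {-pi..pi}" for \<theta>
  proof -
    define W where "W = 1 + (norm (1 - cis \<theta>))\<^sup>2 / \<delta>\<^sup>2"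
    have W: "0 < W" using pos by (auto simp: W_def intro!: add_pos_nonneg)
    define X where "X = \<mu> * W"
    have X: "0 < X" using W pos by (simp add: X_def)
    have "0 \<le> (X * norm (F \<theta>) - 1)\<^sup>2" by simp
    then have "2 * X * norm (F \<theta>) \<le> X\<^sup>2 * (norm (F \<theta>))\<^sup>2 + 1" by (simp add: power2_eq_square algebra_simps)
    then have "norm (F \<theta>) \<le> (X\<^sup>2 * (norm (F \<theta>))\<^sup>2 + 1) / (2 * X)" using X by (simp add: field_simps)
    also have "\<dots> = \<mu> / 2 * (W * (norm (F \<theta>))\<^sup>2) + 1 / (2 * \<mu>) * (1 / W)"
      using X W pos by (simp add: X_def field_simps power2_eq_square)
    also have "W * (norm (F \<theta>))\<^sup>2 = (norm (F \<theta>))\<^sup>2 + (norm (G \<theta>))\<^sup>2 / \<delta>\<^sup>2"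
      by (simp add: W_def GF norm_mult power_mult_distrib distrib_right)
    finally have up: "norm (F \<theta>) \<le> \<mu> / 2 * ((norm (F \<theta>))\<^sup>2 + (norm (G \<theta>))\<^sup>2 / \<delta>\<^sup>2) + 1 / (2 * \<mu>) * (1 / W)" .
    have "1 / W \<le> 1 / (1 + (\<theta> / (2 * \<delta>))\<^sup>2)"
    proof -
      have "(\<theta> / (2 * \<delta>))\<^sup>2 = (\<theta> / 2)\<^sup>2 / \<delta>\<^sup>2" by (simp add: power_divide power_mult_distrib)
      also have "\<dots> \<le> (norm (1 - cis \<theta>))\<^sup>2 / \<delta>\<^sup>2" using norm_one_minus_cis_ge[OF that] by (intro divide_right_mono) auto
      finally have "1 + (\<theta> / (2 * \<delta>))\<^sup>2 \<le> W" by (simp add: W_def)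
      then show ?thesis using W by (intro divide_left_mono) (auto intro!: mult_pos_pos add_pos_nonneg)
    qed
    then have "1 / (2 * \<mu>) * (1 / W) \<le> 1 / (2 * \<mu>) * (1 / (1 + (\<theta> / (2 * \<delta>))\<^sup>2))"
      using pos by (intro mult_left_mono) auto
    then show ?thesis using up by linarith
  qed
  let ?I = "indicator {-pi..pi} :: real \<Rightarrow> ennreal"
  have "(\<integral>\<^sup>+\<theta>\<in>{-pi..pi}. ennreal (norm (F \<theta>)) \<partial>lborel) \<le>
     (\<integral>\<^sup>+\<theta>. ennreal (\<mu> / 2) * (ennreal ((norm (F \<theta>))\<^sup>2) * ?I \<theta>) + ennreal (\<mu> / 2 / \<delta>\<^sup>2) * (ennreal ((norm (G \<theta>))\<^sup>2) * ?I \<theta>)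
        + ennreal (1 / (2 * \<mu>)) * (ennreal (1 / (1 + (\<theta> / (2 * \<delta>))\<^sup>2)) * ?I \<theta>) \<partial>lborel)"
  proof (rule nn_integral_mono)
    fix \<theta> :: real
    have le: "ennreal (norm (F \<theta>)) \<le> ennreal (\<mu> / 2) * ennreal ((norm (F \<theta>))\<^sup>2) + ennreal (\<mu> / 2 / \<delta>\<^sup>2) * ennreal ((norm (G \<theta>))\<^sup>2)
        + ennreal (1 / (2 * \<mu>)) * ennreal (1 / (1 + (\<theta> / (2 * \<delta>))\<^sup>2))" if "\<theta> \<in> {-pi..pi}"
    proof -
      have p1: "0 \<le> 1 / (1 + (\<theta> / (2 * \<delta>))\<^sup>2)" by (intro divide_nonneg_nonneg add_nonneg_nonneg) auto
      have "norm (F \<theta>) \<le> \<mu> / 2 * (norm (F \<theta>))\<^sup>2 + \<mu> / 2 / \<delta>\<^sup>2 * (norm (G \<theta>))\<^sup>2 + 1 / (2 * \<mu>) * (1 / (1 + (\<theta> / (2 * \<delta>))\<^sup>2))"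
        using pt[OF that] by (simp add: algebra_simps)
      then have "ennreal (norm (F \<theta>)) \<le> ennreal (\<mu> / 2 * (norm (F \<theta>))\<^sup>2 + \<mu> / 2 / \<delta>\<^sup>2 * (norm (G \<theta>))\<^sup>2 + 1 / (2 * \<mu>) * (1 / (1 + (\<theta> / (2 * \<delta>))\<^sup>2)))"
        by (rule ennreal_leI)
      also have "\<dots> = ennreal (\<mu> / 2) * ennreal ((norm (F \<theta>))\<^sup>2) + ennreal (\<mu> / 2 / \<delta>\<^sup>2) * ennreal ((norm (G \<theta>))\<^sup>2)
        + ennreal (1 / (2 * \<mu>)) * ennreal (1 / (1 + (\<theta> / (2 * \<delta>))\<^sup>2))"
        by (rule ennreal_lincomb3) (use pos p1 in auto)
      finally show ?thesis .
    qed
    show "ennreal (norm (F \<theta>)) * ?I \<theta> \<le> ennreal (\<mu> / 2) * (ennreal ((norm (F \<theta>))\<^sup>2) * ?I \<theta>) + ennreal (\<mu> / 2 / \<delta>\<^sup>2) * (ennreal ((norm (G \<theta>))\<^sup>2) * ?I \<theta>)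
        + ennreal (1 / (2 * \<mu>)) * (ennreal (1 / (1 + (\<theta> / (2 * \<delta>))\<^sup>2)) * ?I \<theta>)"
    proof (cases "\<theta> \<in> {-pi..pi}")
      case True
      show ?thesis using le[OF True] by (simp only: indicator_simps(1)[OF True] mult_1_right)
    next
      case False
      then show ?thesis by (simp only: indicator_simps(2)[OF False] mult_zero_right add_0_left order_refl)
    qed
  qed
  also have "\<dots> = ennreal (\<mu> / 2) * (\<integral>\<^sup>+\<theta>\<in>{-pi..pi}. ennreal ((norm (F \<theta>))\<^sup>2) \<partial>lborel)
      + ennreal (\<mu> / 2 / \<delta>\<^sup>2) * (\<integral>\<^sup>+\<theta>\<in>{-pi..pi}. ennreal ((norm (G \<theta>))\<^sup>2) \<partial>lborel)
      + ennreal (1 / (2 * \<mu>)) * (\<integral>\<^sup>+\<theta>\<in>{-pi..pi}. ennreal (1 / (1 + (\<theta> / (2 * \<delta>))\<^sup>2)) \<partial>lborel)"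
    using Fm Gm by (simp add: nn_integral_add nn_integral_cmult)
  also have "\<dots> \<le> ennreal (\<mu> / 2) * ennreal (2 * pi * (\<Sum>n. (c n)\<^sup>2))
      + ennreal (\<mu> / 2 / \<delta>\<^sup>2) * ennreal (2 * pi * (\<Sum>n. (b n)\<^sup>2)) + ennreal (1 / (2 * \<mu>)) * ennreal (2 * pi * \<delta>)"
  proof (intro add_mono mult_left_mono)
    show "(\<integral>\<^sup>+\<theta>\<in>{-pi..pi}. ennreal ((norm (F \<theta>))\<^sup>2) \<partial>lborel) \<le> ennreal (2 * pi * (\<Sum>n. (c n)\<^sup>2))"
      unfolding F_def by (rule Bessel_nn_integral[OF c(1,2)])
    show "(\<integral>\<^sup>+\<theta>\<in>{-pi..pi}. ennreal ((norm (G \<theta>))\<^sup>2) \<partial>lborel) \<le> ennreal (2 * pi * (\<Sum>n. (b n)\<^sup>2))"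
      unfolding G_def by (rule Bessel_nn_integral[OF b1 b2])
    have nz: "1 + (\<theta> / (2 * \<delta>))\<^sup>2 \<noteq> 0" for \<theta> using zero_le_power2[of "\<theta> / (2 * \<delta>)"] by linarith
    have "(\<integral>\<^sup>+\<theta>\<in>{-pi..pi}. ennreal (1 / (1 + (\<theta> / (2 * \<delta>))\<^sup>2)) \<partial>lborel) = ennreal (2 * \<delta> * arctan (pi / (2 * \<delta>)) - 2 * \<delta> * arctan (- pi / (2 * \<delta>)))"
    proof (rule nn_integral_FTC_Icc[where F = "\<lambda>\<theta>. 2 * \<delta> * arctan (\<theta> / (2 * \<delta>))"])
      fix x :: real
      show "((\<lambda>\<theta>. 2 * \<delta> * arctan (\<theta> / (2 * \<delta>))) has_real_derivative 1 / (1 + (x / (2 * \<delta>))\<^sup>2)) (at x)"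
        by (rule DERIV_cong[OF DERIV_cmult[OF DERIV_chain2[OF DERIV_arctan DERIV_cdivide[OF DERIV_ident]]]])
           (use pos in \<open>simp add: inverse_eq_divide\<close>)
    qed (use pos nz in \<open>auto intro!: add_nonneg_nonneg\<close>)
    also have "\<dots> \<le> ennreal (2 * pi * \<delta>)"
    proof (rule ennreal_leI)
      have "2 * \<delta> * (arctan (pi / (2 * \<delta>)) - arctan (- pi / (2 * \<delta>))) \<le> 2 * \<delta> * pi"
        using arctan_ubound[of "pi / (2 * \<delta>)"] arctan_lbound[of "- pi / (2 * \<delta>)"] pos by (intro mult_left_mono) auto
      then show "2 * \<delta> * arctan (pi / (2 * \<delta>)) - 2 * \<delta> * arctan (- pi / (2 * \<delta>)) \<le> 2 * pi * \<delta>"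
        by (simp add: right_diff_distrib mult_ac)
    qed
    finally show "(\<integral>\<^sup>+\<theta>\<in>{-pi..pi}. ennreal (1 / (1 + (\<theta> / (2 * \<delta>))\<^sup>2)) \<partial>lborel) \<le> ennreal (2 * pi * \<delta>)" .
  qed auto
  also have "\<dots> = ennreal (\<mu> / 2 * (2 * pi * (\<Sum>n. (c n)\<^sup>2)) + \<mu> / 2 / \<delta>\<^sup>2 * (2 * pi * (\<Sum>n. (b n)\<^sup>2)) + 1 / (2 * \<mu>) * (2 * pi * \<delta>))"
    by (rule ennreal_lincomb3[symmetric])
       (use pos suminf_nonneg[OF c(2)] suminf_nonneg[OF b2] in \<open>auto intro!: mult_nonneg_nonneg\<close>)
  also have "\<mu> / 2 * (2 * pi * (\<Sum>n. (c n)\<^sup>2)) + \<mu> / 2 / \<delta>\<^sup>2 * (2 * pi * (\<Sum>n. (b n)\<^sup>2)) + 1 / (2 * \<mu>) * (2 * pi * \<delta>) =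
     \<mu> * pi * ((\<Sum>n. (c n)\<^sup>2) + (\<Sum>n. (b n)\<^sup>2) / \<delta>\<^sup>2) + pi * \<delta> / \<mu>"
    by (simp add: distrib_left)
  finally show ?thesis unfolding F_def sumb2 .
qed

section \<open>Weighted integral means of the kernel\<close>

context radial_profile
begin

lemma exp_tau_measurable:
  "(\<lambda>s. ennreal (exp (- (a * \<bar>\<tau> s - T\<bar>)) / p s) * indicator {0<..<1} s) \<in> borel_measurable lborel"
proof -
  have "(\<lambda>s. indicator {0<..<1} s *\<^sub>R (exp (- (a * \<bar>\<tau> s - T\<bar>)) * (1 / p s))) \<in> borel_measurable borel"
    by (rule borel_measurable_continuous_on_indicator)
       (auto intro!: continuous_intros continuous_on_subset[OF tau_cont_Ico] inv_p_cont simp del: times_divide_eq_right)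
  then have "(\<lambda>s. ennreal (indicator {0<..<1} s *\<^sub>R (exp (- (a * \<bar>\<tau> s - T\<bar>)) * (1 / p s)))) \<in> borel_measurable lborel"
    by simp
  also have "(\<lambda>s. ennreal (indicator {0<..<1} s *\<^sub>R (exp (- (a * \<bar>\<tau> s - T\<bar>)) * (1 / p s)))) =
    (\<lambda>s. ennreal (exp (- (a * \<bar>\<tau> s - T\<bar>)) / p s) * indicator {0<..<1} s)"
    by (auto split: split_indicator)
  finally show ?thesis .
qed

text \<open>The angular scale \<open>\<delta> = p r\<close> balances the squares against the squared
  differences. The decay rate \<open>A\<close> of the two sums becomes \<open>A / 2\<close> because
  the bound of \<open>fourier_L1_le\<close>, optimized in \<open>\<mu>\<close>, is a geometric
  mean.\<close>

lemma kernel_circle_bound: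
  obtains K where "0 < K" "\<And>r s. 0 \<le> r \<Longrightarrow> r < 1 \<Longrightarrow> 0 \<le> s \<Longrightarrow> s < 1 \<Longrightarrow>
    (\<integral>\<^sup>+\<theta>\<in>{-pi..pi}. ennreal (norm (\<Sum>n. of_real (kcoeff r s n) * cis (real n * \<theta>))) \<partial>lborel)
      \<le> ennreal (K / p r * exp (- (A / 2 * \<bar>\<tau> r - \<tau> s\<bar>)))"
proof -
  obtain K where K: "0 < K"
    "\<And>r s. 0 \<le> r \<Longrightarrow> r < 1 \<Longrightarrow> 0 \<le> s \<Longrightarrow> s < 1 \<Longrightarrow> summable (kcoeff r s)"
    "\<And>r s. 0 \<le> r \<Longrightarrow> r < 1 \<Longrightarrow> 0 \<le> s \<Longrightarrow> s < 1 \<Longrightarrow> summable (\<lambda>n. (kcoeff r s n)\<^sup>2) \<and>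
       (\<Sum>n. (kcoeff r s n)\<^sup>2) \<le> K / (p r)^3 * exp (- (A * \<bar>\<tau> r - \<tau> s\<bar>))"
    "\<And>r s. 0 \<le> r \<Longrightarrow> r < 1 \<Longrightarrow> 0 \<le> s \<Longrightarrow> s < 1 \<Longrightarrow> summable (\<lambda>n. (kcoeff r s (Suc n) - kcoeff r s n)\<^sup>2) \<and>
       (kcoeff r s 0)\<^sup>2 + (\<Sum>n. (kcoeff r s (Suc n) - kcoeff r s n)\<^sup>2) \<le> K / p r * exp (- (A * \<bar>\<tau> r - \<tau> s\<bar>))"
    by (rule coeff_bounds, rule that)
  show ?thesis
  proof (rule that[of "2 * pi * K + pi"])
    show "0 < 2 * pi * K + pi" using K(1) by (intro add_pos_pos mult_pos_pos) auto
    fix r s :: real assume rs: "0 \<le> r" "r < 1" "0 \<le> s" "s < 1"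
    define E where "E = exp (A / 2 * \<bar>\<tau> r - \<tau> s\<bar>)"
    have E: "0 < E" "exp (- (A * \<bar>\<tau> r - \<tau> s\<bar>)) = 1 / (E * E)" "exp (- (A / 2 * \<bar>\<tau> r - \<tau> s\<bar>)) = 1 / E"
    proof -
      have "E * E = exp (A * \<bar>\<tau> r - \<tau> s\<bar>)" unfolding E_def exp_add[symmetric]
        by (simp only: distrib_right[symmetric] field_sum_of_halves)
      then show "exp (- (A * \<bar>\<tau> r - \<tau> s\<bar>)) = 1 / (E * E)" by (simp only: exp_minus inverse_eq_divide)
    qed (simp_all only: E_def exp_minus inverse_eq_divide exp_gt_zero)
    have pr: "0 < p r" using p_pos rs by auto
    \<comment> \<open>The value for which \<open>\<mu> / (p r)^3\<close> times the decay
      \<open>1 / (E * E)\<close> equals \<open>p r / \<mu>\<close>, both being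
      \<open>1 / (p r * E)\<close>.\<close>
    define \<mu> where "\<mu> = (p r)\<^sup>2 * E"
    have \<mu>: "0 < \<mu>" using pr E by (simp add: \<mu>_def)
    have "(\<integral>\<^sup>+\<theta>\<in>{-pi..pi}. ennreal (norm (\<Sum>n. of_real (kcoeff r s n) * cis (real n * \<theta>))) \<partial>lborel)
     \<le> ennreal (\<mu> * pi * ((\<Sum>n. (kcoeff r s n)\<^sup>2) + ((kcoeff r s 0)\<^sup>2 + (\<Sum>n. (kcoeff r s (Suc n) - kcoeff r s n)\<^sup>2)) / (p r)\<^sup>2) + pi * p r / \<mu>)"
      by (rule fourier_L1_le) (use K(2-4)[OF rs] pr \<mu> kcoeff_nonneg rs in auto)
    also have "\<dots> \<le> ennreal ((2 * pi * K + pi) / p r * exp (- (A / 2 * \<bar>\<tau> r - \<tau> s\<bar>)))"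
    proof (rule ennreal_leI)
      have "\<mu> * pi * ((\<Sum>n. (kcoeff r s n)\<^sup>2) + ((kcoeff r s 0)\<^sup>2 + (\<Sum>n. (kcoeff r s (Suc n) - kcoeff r s n)\<^sup>2)) / (p r)\<^sup>2) + pi * p r / \<mu>
        \<le> \<mu> * pi * (K / (p r)^3 * exp (- (A * \<bar>\<tau> r - \<tau> s\<bar>)) + (K / p r * exp (- (A * \<bar>\<tau> r - \<tau> s\<bar>))) / (p r)\<^sup>2) + pi * p r / \<mu>"
        using K(3,4)[OF rs] \<mu> by (intro add_mono mult_left_mono divide_right_mono) auto
      also have "\<dots> = (2 * pi * K + pi) / p r * exp (- (A / 2 * \<bar>\<tau> r - \<tau> s\<bar>))"
        unfolding E(2,3) \<mu>_def using pr E(1)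
        by (simp add: field_simps power2_eq_square power3_eq_cube)
      finally show "\<mu> * pi * ((\<Sum>n. (kcoeff r s n)\<^sup>2) + ((kcoeff r s 0)\<^sup>2 + (\<Sum>n. (kcoeff r s (Suc n) - kcoeff r s n)\<^sup>2)) / (p r)\<^sup>2) + pi * p r / \<mu>
        \<le> (2 * pi * K + pi) / p r * exp (- (A / 2 * \<bar>\<tau> r - \<tau> s\<bar>))" .
    qed
    finally show "(\<integral>\<^sup>+\<theta>\<in>{-pi..pi}. ennreal (norm (\<Sum>n. of_real (kcoeff r s n) * cis (real n * \<theta>))) \<partial>lborel)
      \<le> ennreal ((2 * pi * K + pi) / p r * exp (- (A / 2 * \<bar>\<tau> r - \<tau> s\<bar>)))" .
  qed
qed

text \<open>The factor \<open>1 / p r\<close> is moved to \<open>1 / p s\<close>, the density of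
  \<tau>. This and the quotient of \<open>H\<close> each cost a small rate, after which
  \<open>nn_integral_exp_tau_le\<close> gives a bound independent of \<open>r\<close>.\<close>

lemma kernel_weighted_bound:
  assumes H: "slow H"
  obtains K where "0 < K" "\<And>r. 0 \<le> r \<Longrightarrow> r < 1 \<Longrightarrow>
    (\<integral>\<^sup>+s\<in>{0<..<1}. (\<integral>\<^sup>+\<theta>\<in>{-pi..pi}. ennreal (norm (\<Sum>n. of_real (kcoeff r s n) * cis (real n * \<theta>))) \<partial>lborel)
        * ennreal (H r / H s) \<partial>lborel) \<le> ennreal K"
proof -
  \<comment> \<open>\<open>A / 2\<close> is \<open>4 * \<eta>\<close>: two units are spent on
    \<open>p\<close> and \<open>H\<close>, two remain for the integral.\<close>
  define \<eta> where "\<eta> = A / 8"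
  have \<eta>: "0 < \<eta>" using AB_pos by (simp add: \<eta>_def)
  obtain K1 where K1: "0 < K1" "\<And>r s. 0 \<le> r \<Longrightarrow> r < 1 \<Longrightarrow> 0 \<le> s \<Longrightarrow> s < 1 \<Longrightarrow>
    (\<integral>\<^sup>+\<theta>\<in>{-pi..pi}. ennreal (norm (\<Sum>n. of_real (kcoeff r s n) * cis (real n * \<theta>))) \<partial>lborel)
      \<le> ennreal (K1 / p r * exp (- (A / 2 * \<bar>\<tau> r - \<tau> s\<bar>)))" using kernel_circle_bound by blast
  obtain C where C: "0 < C" "\<And>r s. 0 \<le> r \<Longrightarrow> r < 1 \<Longrightarrow> 0 \<le> s \<Longrightarrow> s < 1 \<Longrightarrow> p r \<le> C * exp (\<eta> * \<bar>\<tau> r - \<tau> s\<bar>) * p s"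
    using slowE[OF slow_p \<eta>] by blast
  obtain C' where C': "0 < C'" "\<And>r s. 0 \<le> r \<Longrightarrow> r < 1 \<Longrightarrow> 0 \<le> s \<Longrightarrow> s < 1 \<Longrightarrow> H r \<le> C' * exp (\<eta> * \<bar>\<tau> r - \<tau> s\<bar>) * H s"
    using slowE[OF H \<eta>] by blast
  define K where "K = K1 * C * C'"
  have K: "0 < K" using K1(1) C(1) C'(1) by (simp add: K_def)
  show ?thesis
  proof (rule that[of "K * (4 / (2 * \<eta>))"])
    show "0 < K * (4 / (2 * \<eta>))" using K \<eta> by simp
    fix r :: real assume r: "0 \<le> r" "r < 1"
    have "(\<integral>\<^sup>+s\<in>{0<..<1}. (\<integral>\<^sup>+\<theta>\<in>{-pi..pi}. ennreal (norm (\<Sum>n. of_real (kcoeff r s n) * cis (real n * \<theta>))) \<partial>lborel)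
        * ennreal (H r / H s) \<partial>lborel)
      \<le> (\<integral>\<^sup>+s. ennreal K * (ennreal (exp (- (2 * \<eta> * \<bar>\<tau> s - \<tau> r\<bar>)) / p s) * indicator {0<..<1} s) \<partial>lborel)"
    proof (rule nn_integral_mono)
      fix s :: real
      let ?L = "(\<integral>\<^sup>+\<theta>\<in>{-pi..pi}. ennreal (norm (\<Sum>n. of_real (kcoeff r s n) * cis (real n * \<theta>))) \<partial>lborel)"
      show "?L * ennreal (H r / H s) * indicator {0<..<1} s \<le>
            ennreal K * (ennreal (exp (- (2 * \<eta> * \<bar>\<tau> s - \<tau> r\<bar>)) / p s) * indicator {0<..<1} s)"
      proof (cases "s \<in> {0<..<1}")
        case True
        then have s: "0 \<le> s" "s < 1" by auto
        let ?t = "\<bar>\<tau> r - \<tau> s\<bar>"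
        have pos: "0 < p r" "0 < p s" "0 < H r" "0 < H s" using p_pos slow_pos[OF H] r s by auto
        have h: "H r / H s \<le> C' * exp (\<eta> * ?t)" using C'(2)[OF r s] pos by (simp add: divide_le_eq)
        have ip: "1 / p r \<le> C * exp (\<eta> * ?t) / p s"
          using C(2)[OF s r] pos by (simp add: field_simps abs_minus_commute)
        have "K1 / p r * exp (- (A / 2 * ?t)) * (H r / H s) \<le>
            K1 * (C * exp (\<eta> * ?t) / p s) * exp (- (A / 2 * ?t)) * (C' * exp (\<eta> * ?t))"
        proof (rule mult_mono[OF mult_right_mono h])
          show "K1 / p r \<le> K1 * (C * exp (\<eta> * ?t) / p s)"
            using mult_left_mono[OF ip, of K1] K1(1) by simp
        qed (use K1(1) C(1) pos in auto)
        also have "\<dots> = K * ((exp (\<eta> * ?t) * exp (- (A / 2 * ?t)) * exp (\<eta> * ?t)) / p s)"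
          by (simp add: K_def)
        also have "exp (\<eta> * ?t) * exp (- (A / 2 * ?t)) * exp (\<eta> * ?t) = exp (- (2 * \<eta> * ?t))"
        proof -
          have "\<eta> * x + - (A / 2 * x) + \<eta> * x = - (2 * \<eta> * x)" for x by (simp add: \<eta>_def field_simps)
          then show ?thesis by (simp only: exp_add[symmetric])
        qed
        finally have le: "K1 / p r * exp (- (A / 2 * ?t)) * (H r / H s) \<le> K * (exp (- (2 * \<eta> * ?t)) / p s)" .
        have "?L * ennreal (H r / H s) \<le> ennreal (K1 / p r * exp (- (A / 2 * ?t))) * ennreal (H r / H s)"
          by (intro mult_right_mono K1(2) r s) auto
        also have "\<dots> = ennreal (K1 / p r * exp (- (A / 2 * ?t)) * (H r / H s))"
          using K1(1) pos by (intro ennreal_mult[symmetric]) auto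
        also have "\<dots> \<le> ennreal (K * (exp (- (2 * \<eta> * ?t)) / p s))" by (rule ennreal_leI[OF le])
        also have "\<dots> = ennreal K * ennreal (exp (- (2 * \<eta> * ?t)) / p s)"
          using K pos by (intro ennreal_mult) auto
        finally show ?thesis using True by (simp add: abs_minus_commute)
      qed simp
    qed
    also have "\<dots> = ennreal K * (\<integral>\<^sup>+s\<in>{0<..<1}. ennreal (exp (- (2 * \<eta> * \<bar>\<tau> s - \<tau> r\<bar>)) / p s) \<partial>lborel)"
      by (rule nn_integral_cmult[OF exp_tau_measurable])
    also have "\<dots> \<le> ennreal K * ennreal (4 / (2 * \<eta>))"
      using \<eta> by (intro mult_left_mono nn_integral_exp_tau_le) auto
    also have "\<dots> = ennreal (K * (4 / (2 * \<eta>)))" using K \<eta> by (intro ennreal_mult[symmetric]) auto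
    finally show "(\<integral>\<^sup>+s\<in>{0<..<1}. (\<integral>\<^sup>+\<theta>\<in>{-pi..pi}. ennreal (norm (\<Sum>n. of_real (kcoeff r s n) * cis (real n * \<theta>))) \<partial>lborel)
        * ennreal (H r / H s) \<partial>lborel) \<le> ennreal (K * (4 / (2 * \<eta>)))" .
  qed
qed

end

section \<open>Polar coordinates\<close>

text \<open>Both measures agree on open boxes. Planar integrals thereby become iterated integrals
  over real and imaginary part.\<close>

lemma lborel_complex_eq:
  "lborel = distr (lborel \<Otimes>\<^sub>M lborel) borel (\<lambda>(x, y). Complex x y)"
proof (rule lborel_eqI)
  have m: "(\<lambda>(x, y). Complex x y) \<in> borel \<rightarrow>\<^sub>M borel"
    unfolding case_prod_beta Complex_eq by (intro borel_measurable_continuous_onI continuous_intros)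
  then have m': "(\<lambda>(x, y). Complex x y) \<in> lborel \<Otimes>\<^sub>M lborel \<rightarrow>\<^sub>M borel" by (simp add: lborel_prod)
  fix l u :: complex assume lu: "\<And>b. b \<in> Basis \<Longrightarrow> l \<bullet> b \<le> u \<bullet> b"
  have le: "Re l \<le> Re u" "Im l \<le> Im u"
    using lu[of 1] lu[of \<i>] by (auto simp: Basis_complex_def inner_complex_def)
  have "emeasure (distr (lborel \<Otimes>\<^sub>M lborel) borel (\<lambda>(x, y). Complex x y)) (box l u) =
     emeasure (lborel \<Otimes>\<^sub>M lborel) ((\<lambda>(x, y). Complex x y) -` box l u \<inter> space (lborel \<Otimes>\<^sub>M lborel))"
    by (rule emeasure_distr[OF m']) simp
  also have "(\<lambda>(x, y). Complex x y) -` box l u \<inter> space (lborel \<Otimes>\<^sub>M lborel) = {Re l<..<Re u} \<times> {Im l<..<Im u}"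
    by (auto simp: space_pair_measure in_box_complex_iff)
  also have "emeasure (lborel \<Otimes>\<^sub>M lborel) \<dots> = emeasure lborel {Re l<..<Re u} * emeasure lborel {Im l<..<Im u}"
    by (intro sigma_finite_measure.emeasure_pair_measure_Times sigma_finite_lborel) auto
  also have "\<dots> = (\<Prod>b\<in>Basis. (u - l) \<bullet> b)"
    using le by (simp add: Basis_complex_def inner_complex_def ennreal_mult' prod_ennreal)
  finally show "emeasure (distr (lborel \<Otimes>\<^sub>M lborel) borel (\<lambda>(x, y). Complex x y)) (box l u) = (\<Prod>b\<in>Basis. (u - l) \<bullet> b)" .
qed simp

lemma nn_integral_complex:
  assumes [measurable]: "f \<in> borel_measurable borel"
  shows "(\<integral>\<^sup>+z. f z \<partial>lborel) = (\<integral>\<^sup>+x. \<integral>\<^sup>+y. f (Complex x y) \<partial>lborel \<partial>lborel)"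
    and "(\<integral>\<^sup>+z. f z \<partial>lborel) = (\<integral>\<^sup>+y. \<integral>\<^sup>+x. f (Complex x y) \<partial>lborel \<partial>lborel)"
proof -
  have "(\<lambda>(x, y). Complex x y) \<in> borel \<rightarrow>\<^sub>M borel"
    unfolding case_prod_beta Complex_eq by (intro borel_measurable_continuous_onI continuous_intros)
  then have m': "(\<lambda>(x, y). Complex x y) \<in> lborel \<Otimes>\<^sub>M lborel \<rightarrow>\<^sub>M borel" by (simp add: lborel_prod)
  have m: "(\<lambda>(x, y). f (Complex x y)) \<in> borel_measurable (lborel \<Otimes>\<^sub>M lborel)"
    using measurable_compose[OF m' assms] by (simp add: case_prod_beta)
  have e: "(\<integral>\<^sup>+z. f z \<partial>lborel) = (\<integral>\<^sup>+w. (case w of (x, y) \<Rightarrow> f (Complex x y)) \<partial>(lborel \<Otimes>\<^sub>M lborel))"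
    by (subst lborel_complex_eq, subst nn_integral_distr[OF m']) (simp_all add: case_prod_beta')
  show "(\<integral>\<^sup>+z. f z \<partial>lborel) = (\<integral>\<^sup>+x. \<integral>\<^sup>+y. f (Complex x y) \<partial>lborel \<partial>lborel)"
    using lborel.nn_integral_fst[OF m] e by simp
  show "(\<integral>\<^sup>+z. f z \<partial>lborel) = (\<integral>\<^sup>+y. \<integral>\<^sup>+x. f (Complex x y) \<partial>lborel \<partial>lborel)"
    using lborel_pair.nn_integral_snd[OF m] e by simp
qed

lemma nn_integral_real_shift:
  fixes f :: "real \<Rightarrow> ennreal"
  assumes "f \<in> borel_measurable borel"
  shows "(\<integral>\<^sup>+x. f (x + a) \<partial>lborel) = (\<integral>\<^sup>+x. f x \<partial>lborel)"
  using nn_integral_real_affine[OF assms, of 1 a] by (simp add: add.commute)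

text \<open>For fixed imaginary part the shear is a translation of the real line.\<close>

lemma nn_integral_shear_Re:
  assumes [measurable]: "f \<in> borel_measurable borel"
  shows "(\<integral>\<^sup>+z. f (z + of_real (a * Im z)) \<partial>lborel) = (\<integral>\<^sup>+z. f z \<partial>lborel)"
proof -
  have [measurable]: "(\<lambda>z. f (z + of_real (a * Im z))) \<in> borel_measurable borel"
    by (rule measurable_compose[OF borel_measurable_continuous_onI assms]) (intro continuous_intros)
  have [measurable]: "(\<lambda>x. f (Complex x y)) \<in> borel_measurable borel" for y
    unfolding Complex_eq by (rule measurable_compose[OF borel_measurable_continuous_onI assms]) (intro continuous_intros)
  have "(\<integral>\<^sup>+z. f (z + of_real (a * Im z)) \<partial>lborel) = (\<integral>\<^sup>+y. \<integral>\<^sup>+x. f (Complex x y + of_real (a * y)) \<partial>lborel \<partial>lborel)"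
    by (subst nn_integral_complex(2)) auto
  also have "\<dots> = (\<integral>\<^sup>+y. \<integral>\<^sup>+x. f (Complex (x + a * y) y) \<partial>lborel \<partial>lborel)"
    by (intro nn_integral_cong arg_cong[where f = f]) (auto simp: complex_eq_iff)
  also have "\<dots> = (\<integral>\<^sup>+y. \<integral>\<^sup>+x. f (Complex x y) \<partial>lborel \<partial>lborel)"
    by (intro nn_integral_cong nn_integral_real_shift) auto
  also have "\<dots> = (\<integral>\<^sup>+z. f z \<partial>lborel)" by (rule nn_integral_complex(2)[symmetric]) auto
  finally show ?thesis .
qed

lemma nn_integral_shear_Im:
  assumes [measurable]: "f \<in> borel_measurable borel"
  shows "(\<integral>\<^sup>+z. f (z + \<i> * of_real (a * Re z)) \<partial>lborel) = (\<integral>\<^sup>+z. f z \<partial>lborel)"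
proof -
  have [measurable]: "(\<lambda>z. f (z + \<i> * of_real (a * Re z))) \<in> borel_measurable borel"
    by (rule measurable_compose[OF borel_measurable_continuous_onI assms]) (intro continuous_intros)
  have [measurable]: "(\<lambda>y. f (Complex x y)) \<in> borel_measurable borel" for x
    unfolding Complex_eq by (rule measurable_compose[OF borel_measurable_continuous_onI assms]) (intro continuous_intros)
  have "(\<integral>\<^sup>+z. f (z + \<i> * of_real (a * Re z)) \<partial>lborel) = (\<integral>\<^sup>+x. \<integral>\<^sup>+y. f (Complex x y + \<i> * of_real (a * x)) \<partial>lborel \<partial>lborel)"
    by (subst nn_integral_complex(1)) auto
  also have "\<dots> = (\<integral>\<^sup>+x. \<integral>\<^sup>+y. f (Complex x (y + a * x)) \<partial>lborel \<partial>lborel)"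
    by (intro nn_integral_cong arg_cong[where f = f]) (auto simp: complex_eq_iff)
  also have "\<dots> = (\<integral>\<^sup>+x. \<integral>\<^sup>+y. f (Complex x y) \<partial>lborel \<partial>lborel)"
    by (intro nn_integral_cong nn_integral_real_shift) auto
  also have "\<dots> = (\<integral>\<^sup>+z. f z \<partial>lborel)" by (rule nn_integral_complex(1)[symmetric]) auto
  finally show ?thesis .
qed

text \<open>A rotation by an angle other than \<open>\<pi>\<close> is a product of three shears.\<close>

lemma nn_integral_rotate:
  assumes [measurable]: "f \<in> borel_measurable borel" and \<theta>: "cos \<theta> \<noteq> -1"
  shows "(\<integral>\<^sup>+z. f (cis \<theta> * z) \<partial>lborel) = (\<integral>\<^sup>+z. f z \<partial>lborel)"
proof -
  \<comment> \<open>\<open>a\<close> is \<open>- tan (\<theta> / 2)\<close>, which explains the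
    excluded angle; shearing by \<open>a\<close>, \<open>b\<close> and \<open>a\<close> in turn
    produces the entries of the rotation matrix.\<close>
  define a where "a = - sin \<theta> / (1 + cos \<theta>)"
  define b where "b = sin \<theta>"
  have nz: "1 + cos \<theta> \<noteq> 0" using \<theta> by linarith
  have ab: "1 + a * b = cos \<theta>"
  proof -
    have "a * b = - ((sin \<theta>)\<^sup>2) / (1 + cos \<theta>)" by (simp add: a_def b_def power2_eq_square)
    also have "(sin \<theta>)\<^sup>2 = (1 - cos \<theta>) * (1 + cos \<theta>)" by (simp add: sin_squared_eq power2_eq_square algebra_simps)
    finally show ?thesis using nz by simp
  qed
  have aa: "a + a * (1 + a * b) = - sin \<theta>"
  proof -
    have "a * (1 + cos \<theta>) = - sin \<theta>" using nz by (simp add: a_def)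
    then show ?thesis unfolding ab by (simp add: distrib_left)
  qed
  let ?S = "\<lambda>z. z + of_real (a * Im z)"
  let ?T = "\<lambda>z. z + \<i> * of_real (b * Re z)"
  have eq: "cis \<theta> * z = ?S (?T (?S z))" for z
  proof -
    have "Im (?S (?T (?S z))) = b * Re z + (1 + a * b) * Im z" by (simp add: algebra_simps)
    moreover have "Re (?S (?T (?S z))) = (1 + a * b) * Re z + (a + a * (1 + a * b)) * Im z" by (simp add: algebra_simps)
    ultimately show ?thesis unfolding ab using aa[unfolded ab] by (simp add: complex_eq_iff b_def)
  qed
  have m1: "(\<lambda>z. f (?S z)) \<in> borel_measurable borel"
    by (rule measurable_compose[OF borel_measurable_continuous_onI assms(1)]) (intro continuous_intros)
  have m2: "(\<lambda>z. f (?S (?T z))) \<in> borel_measurable borel"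
    by (rule measurable_compose[OF borel_measurable_continuous_onI assms(1)]) (intro continuous_intros)
  have "(\<integral>\<^sup>+z. f (cis \<theta> * z) \<partial>lborel) = (\<integral>\<^sup>+z. f (?S (?T (?S z))) \<partial>lborel)" unfolding eq ..
  also have "\<dots> = (\<integral>\<^sup>+z. f (?S (?T z)) \<partial>lborel)" by (rule nn_integral_shear_Re[OF m2])
  also have "\<dots> = (\<integral>\<^sup>+z. f (?S z) \<partial>lborel)" by (rule nn_integral_shear_Im[OF m1])
  also have "\<dots> = (\<integral>\<^sup>+z. f z \<partial>lborel)" by (rule nn_integral_shear_Re[OF assms(1)])
  finally show ?thesis .
qed

text \<open>Tonelli exchanges the two integrals and each inner one is rotation invariant; the angles
  \<open>pi\<close> and \<open>- pi\<close>, which \<open>nn_integral_rotate\<close> excludes, form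
  a null set.\<close>

lemma nn_integral_circle_average:
  assumes f [measurable]: "f \<in> borel_measurable borel"
  shows "(\<integral>\<^sup>+z. (\<integral>\<^sup>+\<theta>\<in>{-pi..pi}. f (cis \<theta> * z) \<partial>lborel) \<partial>lborel) = ennreal (2 * pi) * (\<integral>\<^sup>+z. f z \<partial>lborel)"
proof -
  have [measurable]: "(\<lambda>w. f (cis (snd w) * fst w) * indicator {-pi..pi} (snd w)) \<in> borel_measurable (lborel \<Otimes>\<^sub>M lborel)"
  proof -
    have "(\<lambda>w. cis (snd w) * fst w) \<in> borel_measurable (borel \<Otimes>\<^sub>M borel)"
      unfolding borel_prod by (intro borel_measurable_continuous_onI continuous_intros)
    then have [measurable]: "(\<lambda>w. f (cis (snd w) * fst w)) \<in> borel_measurable (borel \<Otimes>\<^sub>M borel)"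
      by (rule measurable_compose) (rule f)
    show ?thesis by measurable
  qed
  have "(\<integral>\<^sup>+z. (\<integral>\<^sup>+\<theta>\<in>{-pi..pi}. f (cis \<theta> * z) \<partial>lborel) \<partial>lborel)
     = (\<integral>\<^sup>+\<theta>. (\<integral>\<^sup>+z. f (cis \<theta> * z) * indicator {-pi..pi} \<theta> \<partial>lborel) \<partial>lborel)"
    by (rule lborel_pair.Fubini'[symmetric]) (simp add: case_prod_beta')
  also have "\<dots> = (\<integral>\<^sup>+\<theta>. (\<integral>\<^sup>+z. f z \<partial>lborel) * indicator {-pi..pi} \<theta> \<partial>lborel)"
  proof (rule nn_integral_cong_AE)
    have "AE \<theta> in lborel. \<theta> \<noteq> - pi \<and> \<theta> \<noteq> pi"
      by (intro AE_conjI AE_lborel_singleton)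
    then show "AE \<theta> in lborel. (\<integral>\<^sup>+z. f (cis \<theta> * z) * indicator {-pi..pi} \<theta> \<partial>lborel) = (\<integral>\<^sup>+z. f z \<partial>lborel) * indicator {-pi..pi} \<theta>"
    proof eventually_elim
      case (elim \<theta>)
      show ?case
      proof (cases "\<theta> \<in> {-pi..pi}")
        case True
        have "cos \<theta> \<noteq> -1"
        proof
          assume c: "cos \<theta> = -1"
          then have cc: "cos \<bar>\<theta>\<bar> = cos pi" by (simp add: abs_if)
          have "\<bar>\<theta>\<bar> \<le> pi" using True by (simp add: abs_le_iff)
          then have "\<bar>\<theta>\<bar> = pi" by (rule cos_inj_pi[OF abs_ge_zero _ pi_ge_zero order_refl cc])
          then show False using elim by linarith
        qed
        then show ?thesis using True nn_integral_rotate[OF f] by simp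
      qed simp
    qed
  qed
  also have "\<dots> = (\<integral>\<^sup>+z. f z \<partial>lborel) * ennreal (2 * pi)"
    by (subst nn_integral_cmult_indicator) auto
  finally show ?thesis by (simp add: mult.commute)
qed

text \<open>Half-lines form a generator stable under intersection, and on \<open>{..b}\<close> with
  \<open>b \<ge> 0\<close> both sides give the area \<open>pi * b\<^sup>2\<close> of a disc, the
  integral of \<open>2 * pi * r\<close>.\<close>

lemma distr_norm_lborel:
  "distr (lborel :: complex measure) borel norm = density lborel (\<lambda>r. ennreal (2 * pi * r) * indicator {0..} r)"
proof (rule measure_eqI_generator_eq)
  let ?E = "range (\<lambda>b::real. {..b})"
  show "Int_stable ?E" by (auto simp: Int_stable_def)
  show "?E \<subseteq> Pow UNIV" by simp
  show "sets (distr (lborel :: complex measure) borel norm) = sigma_sets UNIV ?E"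
    "sets (density lborel (\<lambda>r. ennreal (2 * pi * r) * indicator {0..} r)) = sigma_sets UNIV ?E"
    by (simp_all add: borel_eq_atMost)
  show "range (\<lambda>n::nat. {..real n}) \<subseteq> ?E" by auto
  show "(\<Union>n. {..real n}) = UNIV" using real_arch_simple by auto
  have e1: "emeasure (distr (lborel :: complex measure) borel norm) {..b} = ennreal (pi * b\<^sup>2)" if "0 \<le> b" for b
  proof -
    have "emeasure (distr (lborel :: complex measure) borel norm) {..b} = emeasure lborel (cball (0::complex) b)"
      by (subst emeasure_distr) (auto intro!: arg_cong[where f = "emeasure lborel"])
    also have "\<dots> = ennreal (pi * b\<^sup>2)"
      using that by (simp add: emeasure_cball unit_ball_vol_numeral)
    finally show ?thesis .
  qed
  show "emeasure (distr (lborel :: complex measure) borel norm) {..real n} \<noteq> \<infinity>" for n by (simp add: e1)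
  fix X assume "X \<in> ?E"
  then obtain b where X: "X = {..b}" by auto
  show "emeasure (distr (lborel :: complex measure) borel norm) X = emeasure (density lborel (\<lambda>r. ennreal (2 * pi * r) * indicator {0..} r)) X"
  proof (cases "0 \<le> b")
    case True
    have "emeasure (density lborel (\<lambda>r. ennreal (2 * pi * r) * indicator {0..} r)) X = (\<integral>\<^sup>+r\<in>{0..b}. ennreal (2 * pi * r) \<partial>lborel)"
      unfolding X by (subst emeasure_density) (auto intro!: nn_integral_cong split: split_indicator)
    also have "\<dots> = ennreal (pi * b\<^sup>2 - pi * 0\<^sup>2)"
      by (rule nn_integral_FTC_Icc[where F = "\<lambda>r. pi * r\<^sup>2"]) (use True in \<open>auto intro!: derivative_eq_intros\<close>)
    finally show ?thesis using e1[OF True] by (simp add: X)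
  next
    case False
    have z: "ennreal (2 * pi * r) * indicator {0..} r * indicator {..b} r = 0" for r
      using False by (auto split: split_indicator)
    have "emeasure (density lborel (\<lambda>r. ennreal (2 * pi * r) * indicator {0..} r)) X = 0"
      unfolding X by (subst emeasure_density) (simp_all only: z, auto)
    moreover have "norm -` {..b} = ({} :: complex set)" using False by (auto intro: order_trans[OF norm_ge_zero])
    ultimately show ?thesis unfolding X by (subst emeasure_distr) auto
  qed
qed

text \<open>By periodicity: the part of the shifted interval beyond \<open>pi\<close> is moved back
  by \<open>2 * pi\<close>, up to single points.\<close>

lemma nn_integral_cis_shift:
  assumes [measurable]: "g \<in> borel_measurable borel" and a: "0 \<le> a" "a \<le> 2 * pi"
  shows "(\<integral>\<^sup>+\<theta>\<in>{-pi..pi}. g (cis (\<theta> + a)) \<partial>lborel) = (\<integral>\<^sup>+\<theta>\<in>{-pi..pi}. g (cis \<theta>) \<partial>lborel)"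
proof -
  have "cis \<in> borel_measurable borel" by (intro borel_measurable_continuous_onI continuous_intros)
  then have [measurable]: "(\<lambda>\<theta>. g (cis \<theta>)) \<in> borel_measurable borel" by (rule measurable_compose) fact
  have "(\<integral>\<^sup>+\<theta>\<in>{-pi..pi}. g (cis (\<theta> + a)) \<partial>lborel) = (\<integral>\<^sup>+\<theta>. g (cis (\<theta> + a)) * indicator {a-pi..a+pi} (\<theta> + a) \<partial>lborel)"
    by (intro nn_integral_cong) (auto split: split_indicator)
  also have "\<dots> = (\<integral>\<^sup>+\<theta>\<in>{a-pi..a+pi}. g (cis \<theta>) \<partial>lborel)"
    by (rule nn_integral_real_shift) measurable
  also have "\<dots> = (\<integral>\<^sup>+\<theta>. g (cis \<theta>) * indicator {a-pi..pi} \<theta> + g (cis \<theta>) * indicator {pi<..a+pi} \<theta> \<partial>lborel)"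
    using a by (intro nn_integral_cong) (auto split: split_indicator)
  also have "\<dots> = (\<integral>\<^sup>+\<theta>\<in>{a-pi..pi}. g (cis \<theta>) \<partial>lborel) + (\<integral>\<^sup>+\<theta>\<in>{pi<..a+pi}. g (cis \<theta>) \<partial>lborel)"
    by (rule nn_integral_add) measurable
  also have "(\<integral>\<^sup>+\<theta>\<in>{pi<..a+pi}. g (cis \<theta>) \<partial>lborel) = (\<integral>\<^sup>+\<theta>. g (cis (\<theta> + 2 * pi)) * indicator {pi<..a+pi} (\<theta> + 2 * pi) \<partial>lborel)"
    by (rule nn_integral_real_shift[symmetric]) measurable
  also have "\<dots> = (\<integral>\<^sup>+\<theta>\<in>{-pi<..a-pi}. g (cis \<theta>) \<partial>lborel)"
    by (intro nn_integral_cong) (auto split: split_indicator simp: cis_mult[symmetric])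
  also have "(\<integral>\<^sup>+\<theta>\<in>{a-pi..pi}. g (cis \<theta>) \<partial>lborel) + \<dots> =
      (\<integral>\<^sup>+\<theta>. g (cis \<theta>) * indicator {a-pi..pi} \<theta> + g (cis \<theta>) * indicator {-pi<..a-pi} \<theta> \<partial>lborel)"
    by (rule nn_integral_add[symmetric]) measurable
  also have "\<dots> = (\<integral>\<^sup>+\<theta>\<in>{-pi..pi}. g (cis \<theta>) \<partial>lborel)"
  proof (rule nn_integral_cong_AE)
    have "AE \<theta> in lborel. \<theta> \<noteq> - pi \<and> \<theta> \<noteq> a - pi" by (intro AE_conjI AE_lborel_singleton)
    then show "AE \<theta> in lborel. g (cis \<theta>) * indicator {a-pi..pi} \<theta> + g (cis \<theta>) * indicator {-pi<..a-pi} \<theta> = g (cis \<theta>) * indicator {-pi..pi} \<theta>"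
      by eventually_elim (use a in \<open>auto split: split_indicator\<close>)
  qed
  finally show ?thesis .
qed

text \<open>Rotation invariance averages \<open>f\<close> over circles; the area of discs then gives the radial part.\<close>

lemma nn_integral_polar:
  assumes f [measurable]: "f \<in> borel_measurable borel"
  shows "(\<integral>\<^sup>+z. f z \<partial>lborel) = (\<integral>\<^sup>+r\<in>{0..}. ennreal r * (\<integral>\<^sup>+\<theta>\<in>{-pi..pi}. f (of_real r * cis \<theta>) \<partial>lborel) \<partial>lborel)"
proof -
  define M where "M r = (\<integral>\<^sup>+\<theta>\<in>{-pi..pi}. f (of_real r * cis \<theta>) \<partial>lborel)" for r
  have [measurable]: "M \<in> borel_measurable borel"
  proof -
    have "(\<lambda>w. of_real (fst w) * cis (snd w)) \<in> borel_measurable (borel \<Otimes>\<^sub>M borel)"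
      unfolding borel_prod by (intro borel_measurable_continuous_onI continuous_intros)
    then have [measurable]: "(\<lambda>w. f (of_real (fst w) * cis (snd w))) \<in> borel_measurable (borel \<Otimes>\<^sub>M borel)"
      by (rule measurable_compose) (rule f)
    have "(\<lambda>(r, \<theta>). f (of_real r * cis \<theta>) * indicator {-pi..pi} \<theta>) \<in> borel_measurable (borel \<Otimes>\<^sub>M lborel)"
      unfolding case_prod_beta' by measurable
    then show ?thesis unfolding M_def by (rule lborel.borel_measurable_nn_integral)
  qed
  \<comment> \<open>The circular mean sees \<open>z\<close> only through its norm: the argument of
    \<open>z\<close> is a shift of the angle.\<close>
  have rot: "(\<integral>\<^sup>+\<theta>\<in>{-pi..pi}. f (cis \<theta> * z) \<partial>lborel) = M (norm z)" for z
  proof -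
    define g where "g w = f (of_real (norm z) * w)" for w
    have g: "g \<in> borel_measurable borel"
      unfolding g_def by (rule measurable_compose[OF borel_measurable_continuous_onI f]) (intro continuous_intros)
    have "f (cis \<theta> * z) = g (cis (\<theta> + Arg2pi z))" for \<theta>
    proof -
      have zc: "of_real (norm z) * cis (Arg2pi z) = z" using Arg2pi_eq[of z] by (simp add: cis_conv_exp)
      have "of_real (norm z) * cis (\<theta> + Arg2pi z) = cis \<theta> * (of_real (norm z) * cis (Arg2pi z))"
        by (simp only: cis_mult[symmetric] mult_ac)
      then show ?thesis unfolding zc by (simp add: g_def)
    qed
    then have "(\<integral>\<^sup>+\<theta>\<in>{-pi..pi}. f (cis \<theta> * z) \<partial>lborel) = (\<integral>\<^sup>+\<theta>\<in>{-pi..pi}. g (cis (\<theta> + Arg2pi z)) \<partial>lborel)"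
      by simp
    also have "\<dots> = (\<integral>\<^sup>+\<theta>\<in>{-pi..pi}. g (cis \<theta>) \<partial>lborel)"
      using Arg2pi_ge_0[of z] Arg2pi_lt_2pi[of z] by (intro nn_integral_cis_shift g) auto
    finally show ?thesis by (simp add: M_def g_def)
  qed
  have "ennreal (2 * pi) * (\<integral>\<^sup>+z. f z \<partial>lborel) = (\<integral>\<^sup>+(z::complex). M (norm z) \<partial>lborel)"
    using nn_integral_circle_average[OF f] by (simp add: rot)
  also have "\<dots> = (\<integral>\<^sup>+r. M r \<partial>distr (lborel :: complex measure) borel norm)"
    by (subst nn_integral_distr) auto
  also have "\<dots> = (\<integral>\<^sup>+r. ennreal (2 * pi * r) * indicator {0..} r * M r \<partial>lborel)"
    unfolding distr_norm_lborel by (subst nn_integral_density) auto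
  also have "\<dots> = (\<integral>\<^sup>+r. ennreal (2 * pi) * (ennreal r * M r * indicator {0..} r) \<partial>lborel)"
    by (intro nn_integral_cong) (auto simp: ennreal_mult mult_ac split: split_indicator)
  also have "\<dots> = ennreal (2 * pi) * (\<integral>\<^sup>+r\<in>{0..}. ennreal r * M r \<partial>lborel)"
    by (rule nn_integral_cmult) auto
  finally show ?thesis unfolding M_def
    by (subst (asm) ennreal_mult_cancel_left) (auto simp: M_def)
qed

section \<open>Orthogonality of monomials for radial weights\<close>

lemma distr_rotate_lborel:
  assumes "cos \<theta> \<noteq> -1"
  shows "distr lborel borel (\<lambda>z. cis \<theta> * z) = lborel"
proof (rule measure_eqI)
  have m: "(\<lambda>z. cis \<theta> * z) \<in> borel \<rightarrow>\<^sub>M borel"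
    by (intro borel_measurable_continuous_onI continuous_intros)
  fix X assume "X \<in> sets (distr lborel borel (\<lambda>z. cis \<theta> * z))"
  then have X: "X \<in> sets borel" by simp
  have "emeasure (distr lborel borel (\<lambda>z. cis \<theta> * z)) X = (\<integral>\<^sup>+z. indicator X z \<partial>distr lborel borel (\<lambda>z. cis \<theta> * z))"
    using X by simp
  also have "\<dots> = (\<integral>\<^sup>+z. indicator X (cis \<theta> * z) \<partial>lborel)"
    using X m by (subst nn_integral_distr) auto
  also have "\<dots> = (\<integral>\<^sup>+z. indicator X z \<partial>lborel)" using X assms by (intro nn_integral_rotate) auto
  finally show "emeasure (distr lborel borel (\<lambda>z. cis \<theta> * z)) X = emeasure lborel X" using X by simp
qed simp

text \<open>Rotation by the angle \<open>1 / (m - k)\<close> leaves the integral fixed but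
  multiplies the integrand by \<open>cis 1\<close>, which is not 1.\<close>

lemma integral_monomial_radial_eq_0:
  fixes q :: "real \<Rightarrow> real"
  assumes mk: "m \<noteq> k" and q: "(\<lambda>z::complex. q (norm z)) \<in> borel_measurable borel"
  shows "(LINT z|lborel. z ^ m * cnj z ^ k * of_real (q (norm z))) = (0::complex)"
proof -
  define d where "d = real m - real k"
  have d: "1 \<le> \<bar>d\<bar>" using mk by (auto simp: d_def)
  \<comment> \<open>This angle satisfies \<open>\<bar>\<theta>\<bar> \<le> 1 < pi / 2\<close>, so
    its cosine is positive and \<open>distr_rotate_lborel\<close> applies.\<close>
  define \<theta> where "\<theta> = 1 / d"
  let ?f = "\<lambda>z::complex. z ^ m * cnj z ^ k * of_real (q (norm z))"
  have th: "\<bar>\<theta>\<bar> \<le> 1" using d by (simp add: \<theta>_def)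
  have "pi / 2 > 1" using pi_gt3 by simp
  then have "0 < cos \<theta>" using th by (intro cos_gt_zero_pi) auto
  then have c: "cos \<theta> \<noteq> -1" by linarith
  have m: "(\<lambda>z. cis \<theta> * z) \<in> borel \<rightarrow>\<^sub>M borel"
    by (intro borel_measurable_continuous_onI continuous_intros)
  have fm: "?f \<in> borel_measurable borel"
    using q by (intro borel_measurable_times borel_measurable_of_real) (auto intro!: borel_measurable_continuous_onI continuous_intros)
  have rot: "?f (cis \<theta> * z) = cis 1 * ?f z" for z
  proof -
    have "cis \<theta> ^ m * cnj (cis \<theta>) ^ k = cis (real m * \<theta> - real k * \<theta>)"
      by (simp only: Complex.DeMoivre cis_cnj cis_mult) simp
    also have "real m * \<theta> - real k * \<theta> = 1" using d by (auto simp: \<theta>_def d_def diff_divide_distrib[symmetric])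
    finally show ?thesis by (simp add: power_mult_distrib norm_mult mult_ac)
  qed
  have "(LINT z|lborel. ?f z) = (LINT z|distr lborel borel (\<lambda>z. cis \<theta> * z). ?f z)"
    unfolding distr_rotate_lborel[OF c] ..
  also have "\<dots> = (LINT z|lborel. ?f (cis \<theta> * z))"
    using m fm by (subst integral_distr) auto
  also have "\<dots> = cis 1 * (LINT z|lborel. ?f z)" unfolding rot by simp
  finally have "(1 - cis 1) * (LINT z|lborel. ?f z) = 0" by (simp add: left_diff_distrib)
  moreover have "cis 1 \<noteq> 1"
    using sin_gt_zero[of 1] pi_gt3 by (auto simp: complex_eq_iff)
  ultimately show ?thesis by simp
qed

section \<open>The Bergman projection of a radial weight\<close>

text \<open>\<open>v\<close> is assumed comparable to, rather than equal to, \<open>w\<close> times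
  a radial function, since a member of \<open>class_L0\<close> need not be radial. \<open>H\<close>
  stands for the factors other than \<open>w\<close>, taken along a radius.\<close>

locale radial_bergman = radial_profile +
  fixes w \<omega> v :: "complex \<Rightarrow> real" and H :: "real \<Rightarrow> real" and Cv :: real
  assumes w_eq: "\<And>z. z \<in> unit_disc \<Longrightarrow> w z = exp (- u (norm z))"
    and omega_eq: "\<And>z. z \<in> unit_disc \<Longrightarrow> \<omega> z = (w z)\<^sup>2"
    and H_slow: "slow H"
    and H_meas: "H \<in> borel_measurable borel"
    and v_meas: "(\<lambda>z. indicator unit_disc z * v z) \<in> borel_measurable borel"
    and Cv_pos: "0 < Cv"
    and v_lower: "\<And>z. z \<in> unit_disc \<Longrightarrow> w z * H (norm z) \<le> Cv * v z"
    and v_upper: "\<And>z. z \<in> unit_disc \<Longrightarrow> v z \<le> Cv * (w z * H (norm z))"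
begin

lemma H_pos: "z \<in> unit_disc \<Longrightarrow> 0 < H (norm z)"
  using slow_pos[OF H_slow, of "norm z"] by simp

lemma w_pos: "z \<in> unit_disc \<Longrightarrow> 0 < w z"
  by (simp add: w_eq)

lemma v_pos: "z \<in> unit_disc \<Longrightarrow> 0 < v z"
proof -
  assume z: "z \<in> unit_disc"
  have "0 < w z * H (norm z)" using w_pos[OF z] H_pos[OF z] by simp
  then have "0 < Cv * v z" using v_lower[OF z] by linarith
  then show ?thesis using Cv_pos by (simp add: zero_less_mult_iff)
qed

lemma exp_u_cont: "continuous_on unit_disc (\<lambda>z::complex. exp (- u (norm z)))"
  by (intro continuous_intros continuous_on_compose2[OF u_cont]) auto

text \<open>A Borel function on the whole plane that agrees with \<open>w\<close> on the disc;
  outside the disc \<open>w\<close> is arbitrary.\<close>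

definition W :: "complex \<Rightarrow> real" where "W z = indicator unit_disc z *\<^sub>R exp (- u (norm z))"

lemma W_eq: "z \<in> unit_disc \<Longrightarrow> W z = w z"
  by (simp add: W_def w_eq)

lemma W_meas [measurable]: "W \<in> borel_measurable borel"
  unfolding W_def by (rule borel_measurable_continuous_on_indicator[OF _ exp_u_cont]) auto

lemma moment_eq: "moment \<omega> (of_nat (2 * n + 1)) = mom n"
proof -
  have "indicator {0..<1} r *\<^sub>R (r powr (of_nat (2 * n + 1)) * \<omega> (of_real r)) = indicator {0<..<1} r *\<^sub>R exp (expo n r)" for r :: real
  proof (cases "0 < r \<and> r < 1")
    case True
    then have "r powr (of_nat (2 * n + 1)) * \<omega> (of_real r) = exp ((2 * real n + 1) * ln r) * (exp (- u r))\<^sup>2"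
      by (simp add: omega_eq w_eq powr_def)
    also have "\<dots> = exp (expo n r)" by (simp add: expo_def exp_double[symmetric] flip: exp_add)
    finally show ?thesis using True by simp
  \<comment> \<open>At \<open>r = 0\<close> the left side vanishes as well, because
    \<open>0 powr x = 0\<close>.\<close>
  qed (auto simp: indicator_def)
  then have "moment \<omega> (of_nat (2 * n + 1)) = (LINT r|lebesgue. indicator {0<..<1} r *\<^sub>R exp (expo n r))"
    unfolding moment_def set_lebesgue_integral_def by simp
  also have "\<dots> = mom n"
    unfolding mom_def set_lebesgue_integral_def
    using mom_int[of n] by (intro integral_completion) (simp add: set_integrable_def)
  finally show ?thesis .
qed

definition kern :: "complex \<Rightarrow> complex" where "kern x = (\<Sum>n. x ^ n / of_real (2 * mom n))"

lemma bergman_kernel_eq: "bergman_kernel \<omega> z \<zeta> = kern (cnj z * \<zeta>)"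
  unfolding bergman_kernel_def kern_def moment_eq ..

lemma kcoeff_summable:
  assumes "0 \<le> r" "r < 1" "0 \<le> s" "s < 1"
  shows "summable (kcoeff r s)"
proof (rule coeff_bounds, goal_cases)
  case (1 K)
  show ?case by (rule 1(2)[OF assms])
qed

text \<open>At \<open>r = s = sqrt x\<close> the numbers \<open>kcoeff r s n\<close> are these terms
  times the constant \<open>(exp (- u (sqrt x)))\<^sup>2\<close>, so summability comes from
  \<open>coeff_bounds\<close>.\<close>

lemma summable_mom:
  assumes "0 \<le> x" "x < 1"
  shows "summable (\<lambda>n. x ^ n / (2 * mom n))"
proof -
  have "summable (kcoeff (sqrt x) (sqrt x))" using assms by (intro kcoeff_summable) auto
  then have "summable (\<lambda>n. kcoeff (sqrt x) (sqrt x) n * (exp (u (sqrt x)))\<^sup>2)" by (rule summable_mult2)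
  moreover have "kcoeff (sqrt x) (sqrt x) n * (exp (u (sqrt x)))\<^sup>2 = x ^ n / (2 * mom n)" for n
  proof -
    have e: "exp (- u (sqrt x)) * exp (u (sqrt x)) = 1" by (simp flip: exp_add)
    have q: "sqrt x ^ n * sqrt x ^ n = x ^ n" using assms by (simp flip: power_mult_distrib)
    have "kcoeff (sqrt x) (sqrt x) n * (exp (u (sqrt x)))\<^sup>2 =
      (sqrt x ^ n * sqrt x ^ n) * (exp (- u (sqrt x)) * exp (u (sqrt x)))\<^sup>2 / (2 * mom n)"
      by (simp add: kcoeff_def power2_eq_square mult_ac)
    then show ?thesis unfolding e q by simp
  qed
  ultimately show ?thesis by simp
qed

lemma norm_kern_term: "norm (x ^ n / of_real (2 * mom n) :: complex) = norm x ^ n / (2 * mom n)"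
  using mom_pos[of n] by (simp add: norm_divide norm_power)

lemma kern_summable: "norm (x :: complex) < 1 \<Longrightarrow> summable (\<lambda>n. x ^ n / of_real (2 * mom n))"
  by (rule summable_norm_cancel) (simp only: norm_kern_term summable_mom norm_ge_zero)

lemma kern_holomorphic: "kern holomorphic_on unit_disc"
proof (rule power_series_holomorphic[where a = "\<lambda>n. 1 / of_real (2 * mom n)"])
  fix x :: complex assume "x \<in> unit_disc"
  then show "(\<lambda>n. 1 / of_real (2 * mom n) * (x - 0) ^ n) sums kern x"
    using summable_sums[OF kern_summable[of x]] by (simp add: kern_def)
qed

lemma mult_in_disc: "norm z < 1 \<Longrightarrow> norm \<zeta> < 1 \<Longrightarrow> norm (z * \<zeta> :: complex) < 1"
  using mult_strict_mono[of "norm z" 1 "norm \<zeta>" 1] by (simp add: norm_mult)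

lemma kern_meas:
  assumes "z \<in> unit_disc"
  shows "(\<lambda>\<zeta>. indicator unit_disc \<zeta> *\<^sub>R kern (cnj z * \<zeta>)) \<in> borel_measurable borel"
proof (rule borel_measurable_continuous_on_indicator)
  show "continuous_on unit_disc (\<lambda>\<zeta>. kern (cnj z * \<zeta>))"
    using assms mult_in_disc[of "cnj z"]
    by (intro continuous_on_compose2[OF holomorphic_on_imp_continuous_on[OF kern_holomorphic]] continuous_intros) auto
qed auto

text \<open>In polar coordinates the integral over the circle of radius \<open>s\<close> becomes,
  after a shift of the angle by the argument of \<open>cnj z\<close>, the mean treated in
  \<open>kernel_weighted_bound\<close>, with the weights \<open>w z\<close> and
  \<open>w \<zeta>\<close> absorbed into \<open>kcoeff\<close>.\<close>

lemma kernel_bound: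
  obtains K where "0 < K" "\<And>z. z \<in> unit_disc \<Longrightarrow>
    (\<integral>\<^sup>+\<zeta>\<in>unit_disc. ennreal (norm (kern (cnj z * \<zeta>)) * w \<zeta> / H (norm \<zeta>)) \<partial>lborel) \<le> ennreal (K / (w z * H (norm z)))"
proof -
  obtain K where K: "0 < K" "\<And>r. 0 \<le> r \<Longrightarrow> r < 1 \<Longrightarrow>
    (\<integral>\<^sup>+s\<in>{0<..<1}. (\<integral>\<^sup>+\<theta>\<in>{-pi..pi}. ennreal (norm (\<Sum>n. of_real (kcoeff r s n) * cis (real n * \<theta>))) \<partial>lborel)
        * ennreal (H r / H s) \<partial>lborel) \<le> ennreal K" using kernel_weighted_bound[OF H_slow] by blast
  show ?thesis
  proof (rule that[of K])
    fix z :: complex assume z: "z \<in> unit_disc"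
    define r where "r = norm z"
    have r: "0 \<le> r" "r < 1" using z by (auto simp: r_def)
    have wz: "w z = exp (- u r)" and Hr: "0 < H r" using w_eq[OF z] H_pos[OF z] by (auto simp: r_def)
    \<comment> \<open>The argument of \<open>cnj z\<close>, taken in \<open>[0, 2 * pi]\<close> as
      \<open>nn_integral_cis_shift\<close> requires.\<close>
    define a where "a = 2 * pi - Arg2pi z"
    have a: "0 \<le> a" "a \<le> 2 * pi" using Arg2pi_ge_0[of z] Arg2pi_lt_2pi[of z] by (auto simp: a_def)
    have cz: "cnj z = of_real r * cis a"
    proof -
      have "z = of_real r * cis (Arg2pi z)" using Arg2pi_eq[of z] by (simp add: cis_conv_exp r_def)
      then have "cnj z = cnj (of_real r * cis (Arg2pi z))" by (rule arg_cong)
      also have "\<dots> = of_real r * cis a" by (simp add: cis_cnj a_def cis_divide[symmetric] flip: cis_inverse) (simp add: divide_inverse)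
      finally show ?thesis .
    qed
    define c where "c = w z * H r"
    have c: "0 < c" using w_pos[OF z] Hr by (simp add: c_def)
    define k1 where "k1 \<zeta> = indicator unit_disc \<zeta> *\<^sub>R kern (cnj z * \<zeta>)" for \<zeta>
    define F where "F \<zeta> = ennreal (c * norm (k1 \<zeta>) * (W \<zeta> / H (norm \<zeta>)))" for \<zeta>
    have [measurable]: "k1 \<in> borel_measurable borel"
      unfolding k1_def by (rule kern_meas[OF z])
    note H_meas [measurable]
    have Fm: "F \<in> borel_measurable borel"
      unfolding F_def by measurable
    have F0: "F \<zeta> = 0" if "1 \<le> norm \<zeta>" for \<zeta> using that by (simp add: F_def k1_def)
    have "(\<integral>\<^sup>+\<zeta>. F \<zeta> \<partial>lborel) = (\<integral>\<^sup>+s\<in>{0..}. ennreal s * (\<integral>\<^sup>+\<theta>\<in>{-pi..pi}. F (of_real s * cis \<theta>) \<partial>lborel) \<partial>lborel)"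
      by (rule nn_integral_polar[OF Fm])
    also have "\<dots> \<le> (\<integral>\<^sup>+s\<in>{0<..<1}. (\<integral>\<^sup>+\<theta>\<in>{-pi..pi}. ennreal (norm (\<Sum>n. of_real (kcoeff r s n) * cis (real n * \<theta>))) \<partial>lborel)
        * ennreal (H r / H s) \<partial>lborel)"
    proof (rule nn_integral_mono)
      fix s :: real
      let ?L = "(\<integral>\<^sup>+\<theta>\<in>{-pi..pi}. ennreal (norm (\<Sum>n. of_real (kcoeff r s n) * cis (real n * \<theta>))) \<partial>lborel)"
      consider "s \<le> 0" | "1 \<le> s" | "0 < s" "s < 1" by linarith
      then show "ennreal s * (\<integral>\<^sup>+\<theta>\<in>{-pi..pi}. F (of_real s * cis \<theta>) \<partial>lborel) * indicator {0..} s \<le>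
         ?L * ennreal (H r / H s) * indicator {0<..<1} s"
      proof cases
        case 1
        then show ?thesis by (simp add: ennreal_neg)
      next
        case 2
        then have "F (of_real s * cis \<theta>) = 0" for \<theta> by (intro F0) (simp add: norm_mult)
        then show ?thesis by simp
      next
        case 3
        have Hs: "0 < H s" using slow_pos[OF H_slow] 3 by auto
        define g where "g x = ennreal (c * norm (kern (of_real (r * s) * x)) * (exp (- u s) / H s))" for x
        have rs: "0 \<le> r * s" "r * s < 1" using r 3 mult_strict_mono[of r 1 s 1] by auto
        \<comment> \<open>\<open>kern\<close> is controlled only inside the disc, so measurability
          is obtained after restricting \<open>x\<close> to the unit circle, where
          \<open>cis\<close> takes its values.\<close>
        have gm: "(\<lambda>x. indicator (sphere 0 1) x * g x) \<in> borel_measurable borel"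
        proof -
          have "continuous_on (sphere 0 1) (\<lambda>x. kern (of_real (r * s) * x))"
            using rs by (intro continuous_on_compose2[OF holomorphic_on_imp_continuous_on[OF kern_holomorphic]] continuous_intros)
              (auto simp: norm_mult)
          then have m: "(\<lambda>x. indicator (sphere 0 1) x *\<^sub>R kern (of_real (r * s) * x)) \<in> borel_measurable borel"
            by (intro borel_measurable_continuous_on_indicator) auto
          define k2 where "k2 x = indicator (sphere 0 1) x *\<^sub>R kern (of_real (r * s) * x)" for x
          have [measurable]: "k2 \<in> borel_measurable borel" unfolding k2_def by (rule m)
          have "(\<lambda>x. ennreal (c * norm (k2 x) * (exp (- u s) / H s))) \<in> borel_measurable borel"
            by measurable
          also have "(\<lambda>x. ennreal (c * norm (k2 x) * (exp (- u s) / H s))) =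
              (\<lambda>x. indicator (sphere 0 1) x * g x)" by (auto simp: g_def k2_def split: split_indicator)
          finally show ?thesis .
        qed
        have Fg: "F (of_real s * cis \<theta>) = g (cis (\<theta> + a))" for \<theta>
        proof -
          have "cnj z * (of_real s * cis \<theta>) = of_real (r * s) * cis (\<theta> + a)"
            unfolding cz by (simp only: cis_mult[symmetric] of_real_mult mult_ac)
          moreover have "F (of_real s * cis \<theta>) = ennreal (c * norm (kern (cnj z * (of_real s * cis \<theta>))) * (exp (- u s) / H s))"
            using 3 by (simp add: F_def W_def k1_def norm_mult)
          ultimately show ?thesis by (simp only: g_def)
        qed
        have eqk: "g (cis \<theta>) = ennreal (H r / H s) * ennreal (norm (\<Sum>n. of_real (kcoeff r s n) * cis (real n * \<theta>)))" for \<theta>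
        proof -
          have "norm (of_real (r * s) * cis \<theta>) < 1" using rs by (simp add: norm_mult)
          then have sm: "summable (\<lambda>n. (of_real (r * s) * cis \<theta>) ^ n / of_real (2 * mom n))" by (rule kern_summable)
          have "of_real (kcoeff r s n) * cis (real n * \<theta>) = of_real (exp (- u r) * exp (- u s)) * ((of_real (r * s) * cis \<theta>) ^ n / of_real (2 * mom n))" for n
            by (simp add: kcoeff_def power_mult_distrib Complex.DeMoivre mult_ac)
          then have "(\<Sum>n. of_real (kcoeff r s n) * cis (real n * \<theta>)) = of_real (exp (- u r) * exp (- u s)) * kern (of_real (r * s) * cis \<theta>)"
            unfolding kern_def using suminf_mult[OF sm] by simp
          then have "norm (\<Sum>n. of_real (kcoeff r s n) * cis (real n * \<theta>)) = w z * exp (- u s) * norm (kern (of_real (r * s) * cis \<theta>))"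
            by (simp add: norm_mult wz)
          then have "H r / H s * norm (\<Sum>n. of_real (kcoeff r s n) * cis (real n * \<theta>)) =
             c * norm (kern (of_real (r * s) * cis \<theta>)) * (exp (- u s) / H s)"
            by (simp add: c_def)
          then show ?thesis unfolding g_def using Hr Hs by (simp flip: ennreal_mult)
        qed
        have "(\<integral>\<^sup>+\<theta>\<in>{-pi..pi}. F (of_real s * cis \<theta>) \<partial>lborel) = (\<integral>\<^sup>+\<theta>\<in>{-pi..pi}. indicator (sphere 0 1) (cis (\<theta> + a)) * g (cis (\<theta> + a)) \<partial>lborel)"
          by (simp add: Fg)
        also have "\<dots> = (\<integral>\<^sup>+\<theta>\<in>{-pi..pi}. indicator (sphere 0 1) (cis \<theta>) * g (cis \<theta>) \<partial>lborel)"
          by (rule nn_integral_cis_shift[OF gm a])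
        also have "\<dots> = (\<integral>\<^sup>+\<theta>. ennreal (H r / H s) * (ennreal (norm (\<Sum>n. of_real (kcoeff r s n) * cis (real n * \<theta>))) * indicator {-pi..pi} \<theta>) \<partial>lborel)"
          by (intro nn_integral_cong) (simp add: eqk mult_ac)
        also have "\<dots> = ennreal (H r / H s) * ?L"
        proof (rule nn_integral_cmult)
          have [measurable]: "(\<lambda>\<theta>. \<Sum>n. of_real (kcoeff r s n) * cis (real n * \<theta>)) \<in> borel_measurable borel"
            by (intro borel_measurable_suminf borel_measurable_continuous_onI continuous_intros)
          show "(\<lambda>\<theta>. ennreal (norm (\<Sum>n. of_real (kcoeff r s n) * cis (real n * \<theta>))) * indicator {-pi..pi} \<theta>) \<in> borel_measurable lborel"
            by measurable
        qed
        \<comment> \<open>The Jacobian \<open>s\<close> is bounded by 1.\<close>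
        finally have "ennreal s * (\<integral>\<^sup>+\<theta>\<in>{-pi..pi}. F (of_real s * cis \<theta>) \<partial>lborel) \<le> 1 * (ennreal (H r / H s) * ?L)"
          using 3 by (intro mult_mono) auto
        then show ?thesis using 3 by (simp add: mult_ac)
      qed
    qed
    also have "\<dots> \<le> ennreal K" by (intro K r)
    finally have FK: "(\<integral>\<^sup>+\<zeta>. F \<zeta> \<partial>lborel) \<le> ennreal K" .
    have "(\<integral>\<^sup>+\<zeta>\<in>unit_disc. ennreal (norm (kern (cnj z * \<zeta>)) * w \<zeta> / H (norm \<zeta>)) \<partial>lborel) = (\<integral>\<^sup>+\<zeta>. ennreal (1 / c) * F \<zeta> \<partial>lborel)"
    proof (rule nn_integral_cong)
      fix \<zeta> :: complex
      show "ennreal (norm (kern (cnj z * \<zeta>)) * w \<zeta> / H (norm \<zeta>)) * indicator unit_disc \<zeta> = ennreal (1 / c) * F \<zeta>"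
        using c by (cases "\<zeta> \<in> unit_disc") (simp_all add: F_def k1_def W_eq flip: ennreal_mult')
    qed
    also have "\<dots> = ennreal (1 / c) * (\<integral>\<^sup>+\<zeta>. F \<zeta> \<partial>lborel)" using Fm by (intro nn_integral_cmult) auto
    also have "\<dots> \<le> ennreal (1 / c) * ennreal K" by (intro mult_left_mono FK) auto
    also have "\<dots> = ennreal (K / (w z * H r))" using c K(1) by (simp add: c_def flip: ennreal_mult')
    finally show "(\<integral>\<^sup>+\<zeta>\<in>unit_disc. ennreal (norm (kern (cnj z * \<zeta>)) * w \<zeta> / H (norm \<zeta>)) \<partial>lborel) \<le> ennreal (K / (w z * H (norm z)))"
      by (simp add: r_def)
  qed (rule K)
qed

lemma kern_0: "kern 0 = 1 / of_real (2 * mom 0)"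
  unfolding kern_def using powser_zero[of "\<lambda>n. 1 / of_real (2 * mom n) :: complex"] by simp

text \<open>The case \<open>z = 0\<close> of \<open>kernel_bound\<close>, where the kernel is a
  nonzero constant.\<close>

lemma weight_bound:
  obtains K where "0 \<le> K" "(\<integral>\<^sup>+\<zeta>\<in>unit_disc. ennreal (w \<zeta> / H (norm \<zeta>)) \<partial>lborel) \<le> ennreal K"
proof -
  obtain K where K: "0 < K" "\<And>z. z \<in> unit_disc \<Longrightarrow>
    (\<integral>\<^sup>+\<zeta>\<in>unit_disc. ennreal (norm (kern (cnj z * \<zeta>)) * w \<zeta> / H (norm \<zeta>)) \<partial>lborel) \<le> ennreal (K / (w z * H (norm z)))"
    using kernel_bound by blast
  define c where "c = 1 / (2 * mom 0)"
  have c: "0 < c" "norm (kern 0) = c" using mom_pos[of 0] by (auto simp: c_def kern_0 norm_divide)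
  define K' where "K' = K / (w 0 * H 0)"
  have K': "0 \<le> K'" using K(1) w_pos[of 0] H_pos[of 0] by (simp add: K'_def)
  have "(\<integral>\<^sup>+\<zeta>\<in>unit_disc. ennreal (w \<zeta> / H (norm \<zeta>)) \<partial>lborel) =
    (\<integral>\<^sup>+\<zeta>. ennreal (1 / c) * (ennreal (norm (kern (cnj 0 * \<zeta>)) * w \<zeta> / H (norm \<zeta>)) * indicator unit_disc \<zeta>) \<partial>lborel)"
    using c by (intro nn_integral_cong) (auto split: split_indicator simp flip: ennreal_mult')
  also have "\<dots> = ennreal (1 / c) * (\<integral>\<^sup>+\<zeta>\<in>unit_disc. ennreal (norm (kern (cnj 0 * \<zeta>)) * w \<zeta> / H (norm \<zeta>)) \<partial>lborel)"
  proof (rule nn_integral_cmult)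
    note H_meas [measurable]
    have "(\<lambda>\<zeta>. ennreal (c * W \<zeta> / H (norm \<zeta>))) \<in> borel_measurable borel" by measurable
    also have "(\<lambda>\<zeta>. ennreal (c * W \<zeta> / H (norm \<zeta>))) = (\<lambda>\<zeta>. ennreal (norm (kern (cnj 0 * \<zeta>)) * w \<zeta> / H (norm \<zeta>)) * indicator unit_disc \<zeta>)"
      using c by (auto simp: fun_eq_iff W_def w_eq split: split_indicator)
    finally show "(\<lambda>\<zeta>. ennreal (norm (kern (cnj 0 * \<zeta>)) * w \<zeta> / H (norm \<zeta>)) * indicator unit_disc \<zeta>) \<in> borel_measurable lborel" by simp
  qed
  also have "\<dots> \<le> ennreal (1 / c) * ennreal K'" using K(2)[of 0] by (intro mult_left_mono) (auto simp: K'_def)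
  also have "\<dots> = ennreal (1 / c * K')" using c K' by (intro ennreal_mult[symmetric]) auto
  finally show ?thesis using c K' by (intro that[of "1 / c * K'"]) auto
qed

text \<open>Turns the norm into a nonnegative real and passes from \<open>v\<close> to the radial
  majorant through \<open>v_lower\<close>. A negative essential supremum would force the disc to be
  a null set.\<close>

lemma Linf_bound:
  assumes "f \<in> Linf v"
  obtains N where "0 \<le> N" "Linf_norm v f = ereal N"
    "AE \<zeta> in lebesgue. \<zeta> \<in> unit_disc \<longrightarrow> norm (f \<zeta>) \<le> N * Cv / (w \<zeta> * H (norm \<zeta>))"
proof -
  have disc: "unit_disc \<inter> space lebesgue \<in> sets lebesgue" by simp
  have ae: "AE \<zeta> in lebesgue_on unit_disc. ereal (norm (f \<zeta>) * v \<zeta>) \<le> Linf_norm v f"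
    unfolding Linf_norm_def by (rule esssup_AE)
  then have ae': "AE \<zeta> in lebesgue. \<zeta> \<in> unit_disc \<longrightarrow> ereal (norm (f \<zeta>) * v \<zeta>) \<le> Linf_norm v f"
    by (subst (asm) AE_restrict_space_iff[OF disc])
  have nn: "0 \<le> Linf_norm v f"
  proof (rule ccontr)
    assume "\<not> 0 \<le> Linf_norm v f"
    then have neg: "Linf_norm v f < 0" by simp
    have "AE \<zeta> in lebesgue. \<zeta> \<notin> unit_disc"
      using ae'
    proof eventually_elim
      case (elim \<zeta>)
      show ?case
      proof
        assume z: "\<zeta> \<in> unit_disc"
        then have "ereal (norm (f \<zeta>) * v \<zeta>) < 0" using elim neg by (meson order.strict_trans1)
        moreover have "0 \<le> norm (f \<zeta>) * v \<zeta>" using v_pos[OF z] by simp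
        ultimately show False by simp
      qed
    qed
    then have "unit_disc \<in> null_sets lebesgue"
      using AE_iff_null_sets[of unit_disc "lebesgue :: complex measure"] by simp
    then have "emeasure lebesgue unit_disc = 0" by (rule null_setsD1)
    then show False by (simp add: emeasure_ball unit_ball_vol_numeral)
  qed
  define N where "N = real_of_ereal (Linf_norm v f)"
  have fin: "Linf_norm v f < \<infinity>" using assms by (simp add: Linf_def)
  have N: "Linf_norm v f = ereal N" using nn fin by (cases "Linf_norm v f") (auto simp: N_def)
  have N0: "0 \<le> N" using nn N by simp
  have "AE \<zeta> in lebesgue. \<zeta> \<in> unit_disc \<longrightarrow> norm (f \<zeta>) \<le> N * Cv / (w \<zeta> * H (norm \<zeta>))"
    using ae'
  proof eventually_elim
    case (elim \<zeta>)
    show ?case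
    proof
      assume z: "\<zeta> \<in> unit_disc"
      have "norm (f \<zeta>) * (w \<zeta> * H (norm \<zeta>)) \<le> norm (f \<zeta>) * (Cv * v \<zeta>)"
        by (intro mult_left_mono v_lower z) auto
      also have "\<dots> = Cv * (norm (f \<zeta>) * v \<zeta>)" by simp
      also have "\<dots> \<le> Cv * N" using elim z N Cv_pos by (intro mult_left_mono) auto
      finally show "norm (f \<zeta>) \<le> N * Cv / (w \<zeta> * H (norm \<zeta>))"
        using w_pos[OF z] H_pos[OF z] by (simp add: pos_le_divide_eq mult.commute)
    qed
  qed
  with N N0 that show ?thesis by blast
qed

lemma Linf_measurable:
  assumes "f \<in> Linf v"
  shows "(\<lambda>\<zeta>. indicator unit_disc \<zeta> *\<^sub>R f \<zeta>) \<in> borel_measurable lebesgue"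
proof -
  have "f \<in> borel_measurable (lebesgue_on unit_disc)" using assms by (simp add: Linf_def)
  then show ?thesis by (subst (asm) borel_measurable_restrict_space_iff) auto
qed

text \<open>The bound on \<open>f\<close> cancels one factor of \<open>\<omega> = w\<^sup>2\<close>
  and leaves \<open>w / H\<close>. It is applied with \<open>q\<close> the kernel for boundedness,
  and with \<open>q\<close> a monomial for the Taylor coefficients.\<close>

lemma Linf_pairing:
  assumes f: "f \<in> Linf v" and N: "0 \<le> N"
    "AE \<zeta> in lebesgue. \<zeta> \<in> unit_disc \<longrightarrow> norm (f \<zeta>) \<le> N * Cv / (w \<zeta> * H (norm \<zeta>))"
    and q: "(\<lambda>\<zeta>. indicator unit_disc \<zeta> *\<^sub>R q \<zeta>) \<in> borel_measurable borel"
    and Q: "0 \<le> Q" "(\<integral>\<^sup>+\<zeta>\<in>unit_disc. ennreal (norm (q \<zeta>) * w \<zeta> / H (norm \<zeta>)) \<partial>lborel) \<le> ennreal Q"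
  shows "set_integrable lebesgue unit_disc (\<lambda>\<zeta>. f \<zeta> * cnj (q \<zeta>) * of_real (\<omega> \<zeta>))"
    and "(LINT \<zeta>|lebesgue. norm (indicator unit_disc \<zeta> *\<^sub>R (f \<zeta> * cnj (q \<zeta>) * of_real (\<omega> \<zeta>)))) \<le> N * Cv * Q"
    and "norm (LINT \<zeta>:unit_disc|lebesgue. f \<zeta> * cnj (q \<zeta>) * of_real (\<omega> \<zeta>)) \<le> N * Cv * Q"
proof -
  define F where "F \<zeta> = indicator unit_disc \<zeta> *\<^sub>R (f \<zeta> * cnj (q \<zeta>) * of_real (\<omega> \<zeta>))" for \<zeta>
  define f1 where "f1 \<zeta> = indicator unit_disc \<zeta> *\<^sub>R f \<zeta>" for \<zeta>
  define q1 where "q1 \<zeta> = indicator unit_disc \<zeta> *\<^sub>R q \<zeta>" for \<zeta>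
  have [measurable]: "f1 \<in> borel_measurable lebesgue" unfolding f1_def by (rule Linf_measurable[OF f])
  have q1m [measurable]: "q1 \<in> borel_measurable borel" unfolding q1_def by (rule q)
  have q1m' [measurable]: "q1 \<in> borel_measurable lebesgue" using q1m by (simp add: measurable_completion)
  have [measurable]: "W \<in> borel_measurable lebesgue" using W_meas by (simp add: measurable_completion)
  have F_eq: "F = (\<lambda>\<zeta>. f1 \<zeta> * cnj (q1 \<zeta>) * of_real ((W \<zeta>)\<^sup>2))"
    by (auto simp: fun_eq_iff F_def f1_def q1_def W_eq omega_eq split: split_indicator)
  have cm: "cnj \<in> borel_measurable borel" by (intro borel_measurable_continuous_onI continuous_intros)
  have [measurable]: "(\<lambda>\<zeta>. cnj (q1 \<zeta>)) \<in> borel_measurable lebesgue" by (rule measurable_compose[OF q1m' cm])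
  have Fm [measurable]: "F \<in> borel_measurable lebesgue" unfolding F_eq by measurable
  have "(\<integral>\<^sup>+\<zeta>. ennreal (norm (F \<zeta>)) \<partial>lebesgue) \<le>
      (\<integral>\<^sup>+\<zeta>. ennreal (N * Cv) * (ennreal (norm (q \<zeta>) * w \<zeta> / H (norm \<zeta>)) * indicator unit_disc \<zeta>) \<partial>lebesgue)"
  proof (rule nn_integral_mono_AE)
    show "AE \<zeta> in lebesgue. ennreal (norm (F \<zeta>)) \<le> ennreal (N * Cv) * (ennreal (norm (q \<zeta>) * w \<zeta> / H (norm \<zeta>)) * indicator unit_disc \<zeta>)"
      using N(2)
    proof eventually_elim
      case (elim \<zeta>)
      show ?case
      proof (cases "\<zeta> \<in> unit_disc")
        case True
        have p: "0 < w \<zeta>" "0 < H (norm \<zeta>)" using w_pos H_pos True by auto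
        have "norm (F \<zeta>) = norm (f \<zeta>) * (norm (q \<zeta>) * (w \<zeta>)\<^sup>2)"
          using True p by (simp add: F_def norm_mult norm_power omega_eq)
        also have "\<dots> \<le> N * Cv / (w \<zeta> * H (norm \<zeta>)) * (norm (q \<zeta>) * (w \<zeta>)\<^sup>2)"
          using elim True by (intro mult_right_mono) auto
        also have "\<dots> = N * Cv * (norm (q \<zeta>) * w \<zeta> / H (norm \<zeta>))"
          using p by (simp add: power2_eq_square)
        finally have "ennreal (norm (F \<zeta>)) \<le> ennreal (N * Cv * (norm (q \<zeta>) * w \<zeta> / H (norm \<zeta>)))" by (rule ennreal_leI)
        also have "\<dots> = ennreal (N * Cv) * ennreal (norm (q \<zeta>) * w \<zeta> / H (norm \<zeta>))"
          using N(1) Cv_pos p by (intro ennreal_mult) auto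
        finally show ?thesis using True by simp
      qed (simp add: F_def)
    qed
  qed
  also have "\<dots> = ennreal (N * Cv) * (\<integral>\<^sup>+\<zeta>\<in>unit_disc. ennreal (norm (q \<zeta>) * w \<zeta> / H (norm \<zeta>)) \<partial>lborel)"
    unfolding nn_integral_completion
  proof (rule nn_integral_cmult)
    note H_meas [measurable]
    have "(\<lambda>\<zeta>. ennreal (norm (q1 \<zeta>) * W \<zeta> / H (norm \<zeta>))) \<in> borel_measurable borel" by measurable
    also have "(\<lambda>\<zeta>. ennreal (norm (q1 \<zeta>) * W \<zeta> / H (norm \<zeta>))) = (\<lambda>\<zeta>. ennreal (norm (q \<zeta>) * w \<zeta> / H (norm \<zeta>)) * indicator unit_disc \<zeta>)"
      by (auto simp: fun_eq_iff q1_def W_eq split: split_indicator)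
    finally show "(\<lambda>\<zeta>. ennreal (norm (q \<zeta>) * w \<zeta> / H (norm \<zeta>)) * indicator unit_disc \<zeta>) \<in> borel_measurable lborel" by simp
  qed
  also have "\<dots> \<le> ennreal (N * Cv) * ennreal Q" by (intro mult_left_mono Q) auto
  also have "\<dots> = ennreal (N * Cv * Q)" using N(1) Cv_pos Q by (intro ennreal_mult[symmetric]) auto
  finally have le: "(\<integral>\<^sup>+\<zeta>. ennreal (norm (F \<zeta>)) \<partial>lebesgue) \<le> ennreal (N * Cv * Q)" .
  have int: "integrable lebesgue F"
    by (rule integrableI_bounded[OF Fm]) (use le in \<open>auto intro: le_less_trans\<close>)
  then show "set_integrable lebesgue unit_disc (\<lambda>\<zeta>. f \<zeta> * cnj (q \<zeta>) * of_real (\<omega> \<zeta>))"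
    unfolding set_integrable_def F_def .
  have nn: "0 \<le> N * Cv * Q" using N(1) Cv_pos Q by simp
  have "ennreal (LINT \<zeta>|lebesgue. norm (F \<zeta>)) = (\<integral>\<^sup>+\<zeta>. ennreal (norm (F \<zeta>)) \<partial>lebesgue)"
    using int by (intro nn_integral_eq_integral[symmetric]) auto
  also note le
  finally have l1: "(LINT \<zeta>|lebesgue. norm (F \<zeta>)) \<le> N * Cv * Q" by (simp only: ennreal_le_iff[OF nn])
  then show "(LINT \<zeta>|lebesgue. norm (indicator unit_disc \<zeta> *\<^sub>R (f \<zeta> * cnj (q \<zeta>) * of_real (\<omega> \<zeta>)))) \<le> N * Cv * Q"
    unfolding F_def .
  have "norm (LINT \<zeta>|lebesgue. F \<zeta>) \<le> (LINT \<zeta>|lebesgue. norm (F \<zeta>))" by (rule integral_norm_bound)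
  then show "norm (LINT \<zeta>:unit_disc|lebesgue. f \<zeta> * cnj (q \<zeta>) * of_real (\<omega> \<zeta>)) \<le> N * Cv * Q"
    unfolding set_lebesgue_integral_def using l1 unfolding F_def by linarith
qed

definition coeffs :: "(complex \<Rightarrow> complex) \<Rightarrow> nat \<Rightarrow> complex" where
  "coeffs f k = (LINT \<zeta>:unit_disc|lebesgue. f \<zeta> * cnj (\<zeta> ^ k) * of_real (\<omega> \<zeta>))"

lemma power_measurable: "(\<lambda>\<zeta>::complex. indicator unit_disc \<zeta> *\<^sub>R \<zeta> ^ k) \<in> borel_measurable borel"
  by (rule borel_measurable_continuous_on_indicator) (auto intro!: continuous_intros)

lemma power_weight_bound:
  assumes "(\<integral>\<^sup>+\<zeta>\<in>unit_disc. ennreal (w \<zeta> / H (norm \<zeta>)) \<partial>lborel) \<le> ennreal K"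
  shows "(\<integral>\<^sup>+\<zeta>\<in>unit_disc. ennreal (norm (\<zeta> ^ k) * w \<zeta> / H (norm \<zeta>)) \<partial>lborel) \<le> ennreal K"
proof (rule order_trans[OF nn_integral_mono assms])
  fix \<zeta> :: complex
  show "ennreal (norm (\<zeta> ^ k) * w \<zeta> / H (norm \<zeta>)) * indicator unit_disc \<zeta> \<le> ennreal (w \<zeta> / H (norm \<zeta>)) * indicator unit_disc \<zeta>"
  proof (cases "\<zeta> \<in> unit_disc")
    case True
    have "norm (\<zeta> ^ k) * (w \<zeta> / H (norm \<zeta>)) \<le> 1 * (w \<zeta> / H (norm \<zeta>))"
      using True w_pos[OF True] H_pos[OF True] by (intro mult_right_mono) (auto simp: norm_power intro!: power_le_one)
    then show ?thesis using True by (simp add: ennreal_leI)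
  qed simp
qed

text \<open>Termwise integration of the kernel series: every pairing with a monomial is bounded by
  the same constant, so the series of \<open>norm z ^ k / (2 * mom k)\<close> dominates. The
  expansion yields holomorphy and, by comparison of coefficients, the reproducing property.\<close>

lemma bergman_proj_sums:
  assumes f: "f \<in> Linf v" and z: "z \<in> unit_disc"
  shows "(\<lambda>k. coeffs f k / of_real (2 * pi * mom k) * z ^ k) sums bergman_proj \<omega> f z"
proof -
  obtain N where N: "0 \<le> N" "Linf_norm v f = ereal N"
    "AE \<zeta> in lebesgue. \<zeta> \<in> unit_disc \<longrightarrow> norm (f \<zeta>) \<le> N * Cv / (w \<zeta> * H (norm \<zeta>))" using Linf_bound[OF f] by blast
  obtain K where K: "0 \<le> K" "(\<integral>\<^sup>+\<zeta>\<in>unit_disc. ennreal (w \<zeta> / H (norm \<zeta>)) \<partial>lborel) \<le> ennreal K" using weight_bound by blast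
  note pair = Linf_pairing[OF f N(1,3) power_measurable K(1) power_weight_bound[OF K(2)]]
  define h where "h k \<zeta> = indicator unit_disc \<zeta> *\<^sub>R (f \<zeta> * cnj (\<zeta> ^ k) * of_real (\<omega> \<zeta>))" for k \<zeta>
  define c where "c k = z ^ k / of_real (2 * mom k)" for k
  have hi: "integrable lebesgue (h k)" for k using pair(1)[of k] unfolding h_def[abs_def] set_integrable_def .
  have hn: "(LINT \<zeta>|lebesgue. norm (h k \<zeta>)) \<le> N * Cv * K" for k using pair(2)[of k] by (simp add: h_def)
  have nz: "norm z < 1" using z by simp
  have sc: "summable (\<lambda>k. norm (c k))" unfolding c_def norm_kern_term by (rule summable_mom) (use nz in auto)
  have hk: "norm (h k \<zeta>) \<le> norm (h 0 \<zeta>)" for k \<zeta>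
    by (auto simp: h_def norm_mult norm_power power_le_one mult_left_le mult_right_mono split: split_indicator)
  have "(\<lambda>k. LINT \<zeta>|lebesgue. c k * h k \<zeta>) sums (LINT \<zeta>|lebesgue. (\<Sum>k. c k * h k \<zeta>))"
  proof (rule sums_integral)
    show "integrable lebesgue (\<lambda>\<zeta>. c k * h k \<zeta>)" for k using hi by simp
    show "AE \<zeta> in lebesgue. summable (\<lambda>k. norm (c k * h k \<zeta>))"
    proof (rule AE_I2)
      fix \<zeta>
      show "summable (\<lambda>k. norm (c k * h k \<zeta>))"
        by (rule summable_comparison_test'[OF summable_mult2[OF sc, of "norm (h 0 \<zeta>)"], of 0])
           (simp add: norm_mult hk mult_left_mono)
    qed
    show "summable (\<lambda>k. LINT \<zeta>|lebesgue. norm (c k * h k \<zeta>))"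
    proof (rule summable_comparison_test'[OF summable_mult2[OF sc, of "N * Cv * K"], of 0])
      fix k
      have "norm (LINT \<zeta>|lebesgue. norm (c k * h k \<zeta>)) = norm (c k) * (LINT \<zeta>|lebesgue. norm (h k \<zeta>))"
        by (simp add: norm_mult integral_nonneg_AE)
      also have "\<dots> \<le> norm (c k) * (N * Cv * K)" by (intro mult_left_mono hn) auto
      finally show "norm (LINT \<zeta>|lebesgue. norm (c k * h k \<zeta>)) \<le> norm (c k) * (N * Cv * K)" .
    qed
  qed
  moreover have e1: "(LINT \<zeta>|lebesgue. c k * h k \<zeta>) = c k * coeffs f k" for k
    unfolding h_def[abs_def] coeffs_def set_lebesgue_integral_def by (rule integral_mult_right_zero)
  moreover have e2: "(\<Sum>k. c k * h k \<zeta>) = indicator unit_disc \<zeta> *\<^sub>R bergman_integrand \<omega> f z \<zeta>" for \<zeta>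
  proof (cases "\<zeta> \<in> unit_disc")
    case True
    have "norm (cnj z * \<zeta>) < 1" using True nz by (intro mult_in_disc) auto
    then have "(\<lambda>k. (cnj z * \<zeta>) ^ k / of_real (2 * mom k)) sums kern (cnj z * \<zeta>)"
      unfolding kern_def by (intro summable_sums kern_summable)
    then have "(\<lambda>k. cnj ((cnj z * \<zeta>) ^ k / of_real (2 * mom k))) sums cnj (kern (cnj z * \<zeta>))" by (simp only: sums_cnj)
    then have "(\<lambda>k. f \<zeta> * of_real (\<omega> \<zeta>) * cnj ((cnj z * \<zeta>) ^ k / of_real (2 * mom k))) sums (f \<zeta> * of_real (\<omega> \<zeta>) * cnj (kern (cnj z * \<zeta>)))"
      by (rule sums_mult)
    moreover have "f \<zeta> * of_real (\<omega> \<zeta>) * cnj ((cnj z * \<zeta>) ^ k / of_real (2 * mom k)) = c k * h k \<zeta>" for k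
      using True by (simp add: c_def h_def power_mult_distrib)
    ultimately show ?thesis using True by (simp add: sums_iff bergman_integrand_def bergman_kernel_eq)
  qed (simp add: h_def)
  ultimately have "(\<lambda>k. c k * coeffs f k) sums (LINT \<zeta>:unit_disc|lebesgue. bergman_integrand \<omega> f z \<zeta>)"
    by (simp only: e1 e2 set_lebesgue_integral_def)
  then have "(\<lambda>k. c k * coeffs f k / of_real pi) sums bergman_proj \<omega> f z"
    unfolding bergman_proj_def by (rule sums_divide)
  moreover have "c k * coeffs f k / of_real pi = coeffs f k / of_real (2 * pi * mom k) * z ^ k" for k
    by (simp add: c_def mult_ac)
  ultimately show ?thesis by simp
qed

lemma bergman_proj_holomorphic:
  assumes "f \<in> Linf v"
  shows "bergman_proj \<omega> f holomorphic_on unit_disc"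
  by (rule power_series_holomorphic[where a = "\<lambda>k. coeffs f k / of_real (2 * pi * mom k)"])
     (use bergman_proj_sums[OF assms] in simp)

text \<open>\<open>Linf_pairing\<close> with the kernel bounds the projection by a multiple of
  \<open>1 / (w z * H (norm z))\<close> at every point; \<open>v_lower\<close>, through
  \<open>Linf_bound\<close>, and \<open>v_upper\<close> contribute one \<open>Cv\<close>
  each.\<close>

lemma bergman_proj_bounded:
  obtains C where "0 \<le> C"
    "\<And>f z. f \<in> Linf v \<Longrightarrow> z \<in> unit_disc \<Longrightarrow> set_integrable lebesgue unit_disc (bergman_integrand \<omega> f z)"
    "\<And>f. f \<in> Linf v \<Longrightarrow> Linf_norm v (bergman_proj \<omega> f) \<le> ereal C * Linf_norm v f \<and> bergman_proj \<omega> f \<in> Hinf v"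
proof -
  obtain K where K: "0 < K" "\<And>z. z \<in> unit_disc \<Longrightarrow>
    (\<integral>\<^sup>+\<zeta>\<in>unit_disc. ennreal (norm (kern (cnj z * \<zeta>)) * w \<zeta> / H (norm \<zeta>)) \<partial>lborel) \<le> ennreal (K / (w z * H (norm z)))"
    using kernel_bound by blast
  have main: "set_integrable lebesgue unit_disc (bergman_integrand \<omega> f z) \<and>
     norm (bergman_proj \<omega> f z) * v z \<le> Cv\<^sup>2 * K / pi * N"
    if f: "f \<in> Linf v" and N: "0 \<le> N" "AE \<zeta> in lebesgue. \<zeta> \<in> unit_disc \<longrightarrow> norm (f \<zeta>) \<le> N * Cv / (w \<zeta> * H (norm \<zeta>))"
      and z: "z \<in> unit_disc" for f N z
  proof -
    have p: "0 < w z" "0 < H (norm z)" using w_pos[OF z] H_pos[OF z] by auto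
    have Q: "0 \<le> K / (w z * H (norm z))" using K(1) p by simp
    note pair = Linf_pairing[OF f N kern_meas[OF z] Q K(2)[OF z]]
    have bi: "bergman_integrand \<omega> f z = (\<lambda>\<zeta>. f \<zeta> * cnj (kern (cnj z * \<zeta>)) * of_real (\<omega> \<zeta>))"
      by (simp add: fun_eq_iff bergman_integrand_def bergman_kernel_eq)
    have "norm (bergman_proj \<omega> f z) \<le> N * Cv * (K / (w z * H (norm z))) / pi"
      unfolding bergman_proj_def bi using divide_right_mono[OF pair(3), of pi] by (simp add: norm_divide)
    then have "norm (bergman_proj \<omega> f z) * v z \<le> N * Cv * (K / (w z * H (norm z))) / pi * (Cv * (w z * H (norm z)))"
      using N(1) Cv_pos K(1) p v_upper[OF z] v_pos[OF z] by (intro mult_mono) auto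
    also have "\<dots> = Cv\<^sup>2 * K / pi * N" using p by (simp add: power2_eq_square)
    finally show ?thesis unfolding bi using pair(1) by simp
  qed
  show ?thesis
  proof (rule that[of "Cv\<^sup>2 * K / pi"])
    show "0 \<le> Cv\<^sup>2 * K / pi" using K(1) by simp
    fix f assume f: "f \<in> Linf v"
    obtain N where N: "0 \<le> N" "Linf_norm v f = ereal N"
      "AE \<zeta> in lebesgue. \<zeta> \<in> unit_disc \<longrightarrow> norm (f \<zeta>) \<le> N * Cv / (w \<zeta> * H (norm \<zeta>))" using Linf_bound[OF f] by blast
    show "set_integrable lebesgue unit_disc (bergman_integrand \<omega> f z)" if "z \<in> unit_disc" for z
      using main[OF f N(1,3) that] by simp
    have Pm: "bergman_proj \<omega> f \<in> borel_measurable (lebesgue_on unit_disc)"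
      by (intro continuous_imp_measurable_on_sets_lebesgue holomorphic_on_imp_continuous_on bergman_proj_holomorphic f) auto
    have "(\<lambda>z. indicator unit_disc z *\<^sub>R v z) \<in> borel_measurable lebesgue"
      using v_meas by (simp add: measurable_completion)
    then have vm: "v \<in> borel_measurable (lebesgue_on unit_disc)"
      by (subst borel_measurable_restrict_space_iff) auto
    have "Linf_norm v (bergman_proj \<omega> f) \<le> ereal (Cv\<^sup>2 * K / pi * N)"
      unfolding Linf_norm_def
    proof (rule esssup_I)
      show "(\<lambda>z. ereal (norm (bergman_proj \<omega> f z) * v z)) \<in> borel_measurable (lebesgue_on unit_disc)"
        using Pm vm by measurable
      show "AE z in lebesgue_on unit_disc. ereal (norm (bergman_proj \<omega> f z) * v z) \<le> ereal (Cv\<^sup>2 * K / pi * N)"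
        using main[OF f N(1,3)] by (intro AE_I2) auto
    qed
    moreover have "bergman_proj \<omega> f holomorphic_on unit_disc" by (rule bergman_proj_holomorphic[OF f])
    ultimately show "Linf_norm v (bergman_proj \<omega> f) \<le> ereal (Cv\<^sup>2 * K / pi) * Linf_norm v f \<and> bergman_proj \<omega> f \<in> Hinf v"
      using Pm by (auto simp: N(2) Hinf_def Linf_def intro: le_less_trans)
  qed
qed

text \<open>
  The monomials in the power series of \<open>g\<close> can be integrated term by term only over smaller discs;
  letting \<open>R\<close> tend to \<open>1\<close> recovers the full weight \<open>trunc 1\<close>.
\<close>

definition trunc :: "real \<Rightarrow> real \<Rightarrow> real" where
  "trunc R r = (if r < R then (exp (- u r))\<^sup>2 else 0)"

lemma trunc_norm: "R \<le> 1 \<Longrightarrow> trunc R (norm z) = (W z)\<^sup>2 * indicator (ball 0 R) z"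
  by (auto simp: trunc_def W_def split: split_indicator)

lemma trunc_measurable: "R \<le> 1 \<Longrightarrow> (\<lambda>z::complex. trunc R (norm z)) \<in> borel_measurable borel"
  unfolding trunc_norm
  by (intro borel_measurable_times borel_measurable_power W_meas borel_measurable_indicator) simp

lemma trunc_nonneg: "0 \<le> trunc R r"
  by (simp add: trunc_def)

text \<open>The Jacobian \<open>r\<close> of polar coordinates turns \<open>r ^ (2 * k)\<close> into
  the odd power of \<open>mom k\<close>; this is why the kernel uses the moments of order
  \<open>2 * k + 1\<close>.\<close>

lemma nn_integral_trunc_1:
  "(\<integral>\<^sup>+\<zeta>. ennreal (norm (\<zeta>::complex) ^ (2 * k) * trunc 1 (norm \<zeta>)) \<partial>lborel) = ennreal (2 * pi * mom k)"
proof -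
  let ?f = "\<lambda>\<zeta>::complex. ennreal (norm \<zeta> ^ (2 * k) * trunc 1 (norm \<zeta>))"
  have m: "?f \<in> borel_measurable borel" using trunc_measurable[of 1] by measurable
  have "(\<integral>\<^sup>+\<zeta>. ?f \<zeta> \<partial>lborel) = (\<integral>\<^sup>+r\<in>{0..}. ennreal r * (\<integral>\<^sup>+\<theta>\<in>{-pi..pi}. ?f (of_real r * cis \<theta>) \<partial>lborel) \<partial>lborel)"
    by (rule nn_integral_polar[OF m])
  also have "\<dots> = (\<integral>\<^sup>+r. ennreal (2 * pi) * ennreal (indicator {0<..<1} r *\<^sub>R exp (expo k r)) \<partial>lborel)"
  proof (rule nn_integral_cong)
    fix r :: real
    consider "r \<le> 0" | "1 \<le> r" | "0 < r" "r < 1" by linarith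
    then show "ennreal r * (\<integral>\<^sup>+\<theta>\<in>{-pi..pi}. ?f (of_real r * cis \<theta>) \<partial>lborel) * indicator {0..} r =
      ennreal (2 * pi) * ennreal (indicator {0<..<1} r *\<^sub>R exp (expo k r))"
    proof cases
      case 1
      then show ?thesis by (simp add: ennreal_neg)
    next
      case 2
      then show ?thesis by (simp add: norm_mult trunc_def)
    next
      case 3
      have "?f (of_real r * cis \<theta>) = ennreal (r ^ (2 * k) * (exp (- u r))\<^sup>2)" for \<theta>
        using 3 by (simp add: norm_mult trunc_def)
      then have "(\<integral>\<^sup>+\<theta>\<in>{-pi..pi}. ?f (of_real r * cis \<theta>) \<partial>lborel) = (\<integral>\<^sup>+\<theta>\<in>{-pi..pi}. ennreal (r ^ (2 * k) * (exp (- u r))\<^sup>2) \<partial>lborel)"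
        by (simp only:)
      also have "\<dots> = ennreal (r ^ (2 * k) * (exp (- u r))\<^sup>2) * ennreal (2 * pi)"
        by (subst nn_integral_cmult_indicator) auto
      finally have "(\<integral>\<^sup>+\<theta>\<in>{-pi..pi}. ?f (of_real r * cis \<theta>) \<partial>lborel) = ennreal (r ^ (2 * k) * (exp (- u r))\<^sup>2) * ennreal (2 * pi)" .
      moreover have "exp (expo k r) = r * (r ^ (2 * k) * (exp (- u r))\<^sup>2)"
      proof -
        have "exp (expo k r) = exp (real (2 * k + 1) * ln r) * exp (- (2 * u r))"
          by (simp add: expo_def flip: exp_add)
        also have "exp (real (2 * k + 1) * ln r) = r ^ (2 * k + 1)" using 3 by (simp only: exp_of_nat_mult exp_ln)
        also have "exp (- (2 * u r)) = (exp (- u r))\<^sup>2" by (simp add: power2_eq_square flip: exp_add)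
        finally show ?thesis by simp
      qed
      ultimately show ?thesis using 3 by (simp add: ennreal_mult mult_ac)
    qed
  qed
  also have "\<dots> = ennreal (2 * pi) * (\<integral>\<^sup>+r. ennreal (indicator {0<..<1} r *\<^sub>R exp (expo k r)) \<partial>lborel)"
    using mom_int[of k] by (intro nn_integral_cmult) (auto simp: set_integrable_def)
  also have "(\<integral>\<^sup>+r. ennreal (indicator {0<..<1} r *\<^sub>R exp (expo k r)) \<partial>lborel) = ennreal (mom k)"
    unfolding mom_def set_lebesgue_integral_def
    using mom_int[of k] by (intro nn_integral_eq_integral) (auto simp: set_integrable_def)
  also have "ennreal (2 * pi) * ennreal (mom k) = ennreal (2 * pi * mom k)"
    using mom_pos[of k] by (intro ennreal_mult[symmetric]) auto
  finally show ?thesis .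
qed

lemma trunc_1_integral:
  "integrable lborel (\<lambda>\<zeta>::complex. norm \<zeta> ^ (2 * k) * trunc 1 (norm \<zeta>))"
  "(LINT \<zeta>::complex|lborel. norm \<zeta> ^ (2 * k) * trunc 1 (norm \<zeta>)) = 2 * pi * mom k"
proof -
  let ?f = "\<lambda>\<zeta>::complex. norm \<zeta> ^ (2 * k) * trunc 1 (norm \<zeta>)"
  have m: "?f \<in> borel_measurable lborel" using trunc_measurable[of 1] by measurable
  have nn: "0 \<le> ?f \<zeta>" for \<zeta> using trunc_nonneg by simp
  show i: "integrable lborel ?f"
    using nn_integral_trunc_1[of k] nn by (intro integrableI_nonneg m) auto
  have "ennreal (LINT \<zeta>|lborel. ?f \<zeta>) = ennreal (2 * pi * mom k)"
    using nn_integral_eq_integral[OF i] nn nn_integral_trunc_1[of k] by simp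
  then show "(LINT \<zeta>|lborel. ?f \<zeta>) = 2 * pi * mom k"
    using mom_pos[of k] nn by (subst (asm) ennreal_inj) (auto intro!: integral_nonneg_AE)
qed

lemma trunc_mono: "R \<le> 1 \<Longrightarrow> trunc R r \<le> trunc 1 r"
  by (simp add: trunc_def)

lemma trunc_integrable:
  assumes "R \<le> 1"
  shows "integrable lborel (\<lambda>\<zeta>::complex. norm \<zeta> ^ (2 * k) * trunc R (norm \<zeta>))"
proof (rule Bochner_Integration.integrable_bound[OF trunc_1_integral(1)[of k]])
  show "(\<lambda>\<zeta>::complex. norm \<zeta> ^ (2 * k) * trunc R (norm \<zeta>)) \<in> borel_measurable lborel"
    using trunc_measurable[OF assms] by measurable
qed (use trunc_mono[OF assms] trunc_nonneg in \<open>auto simp: abs_mult intro!: mult_left_mono\<close>)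

text \<open>On \<open>norm \<zeta> < R\<close> the Taylor series is dominated by the terms
  \<open>norm (b m) * R ^ m\<close>, so it may be integrated termwise against the truncated weight;
  only \<open>m = k\<close> survives the rotation symmetry.\<close>

lemma integral_holomorphic_trunc:
  assumes g: "g holomorphic_on unit_disc" and R: "0 < R" "R < 1"
  shows "(LINT \<zeta>|lborel. g \<zeta> * cnj (\<zeta> ^ k) * of_real (trunc R (norm \<zeta>))) =
    (deriv ^^ k) g 0 / fact k * of_real (LINT \<zeta>::complex|lborel. norm \<zeta> ^ (2 * k) * trunc R (norm \<zeta>))"
proof -
  define b where "b m = (deriv ^^ m) g 0 / fact m" for m
  have gs: "(\<lambda>m. b m * \<zeta> ^ m) sums g \<zeta>" if "norm \<zeta> < 1" for \<zeta>
    using holomorphic_power_series[OF g, of \<zeta>] that by (simp add: b_def)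
  have sb: "summable (\<lambda>m. norm (b m) * R ^ m)"
  proof -
    \<comment> \<open>Convergence at the larger radius \<open>(1 + R) / 2\<close> gives absolute
      convergence at \<open>R\<close>.\<close>
    have "summable (\<lambda>m. b m * (of_real ((1 + R) / 2)) ^ m)"
      using gs[of "of_real ((1 + R) / 2)"] R by (intro sums_summable) (auto simp del: of_real_divide of_real_add)
    then have "summable (\<lambda>m. norm (b m * (of_real R) ^ m))"
      by (rule powser_insidea) (use R in \<open>simp del: of_real_divide of_real_add\<close>)
    then show ?thesis using R by (simp add: norm_mult norm_power)
  qed
  define h where "h m \<zeta> = \<zeta> ^ m * cnj \<zeta> ^ k * of_real (trunc R (norm \<zeta>))" for m and \<zeta> :: complex
  have hm: "h m \<in> borel_measurable lborel" for m
    unfolding h_def[abs_def] using trunc_measurable[of R] R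
    by (intro borel_measurable_times borel_measurable_of_real) (auto intro!: borel_measurable_continuous_onI continuous_intros)
  have hn: "norm (h m \<zeta>) \<le> R ^ m * trunc R (norm \<zeta>)" for m \<zeta>
  proof (cases "norm \<zeta> < R")
    case True
    have "norm \<zeta> ^ m * norm \<zeta> ^ k \<le> R ^ m * 1"
      using True R by (intro mult_mono power_mono power_le_one) auto
    then have "norm \<zeta> ^ m * norm \<zeta> ^ k * trunc R (norm \<zeta>) \<le> R ^ m * 1 * trunc R (norm \<zeta>)"
      by (intro mult_right_mono trunc_nonneg)
    then show ?thesis by (simp add: h_def norm_mult norm_power trunc_nonneg)
  qed (simp add: h_def trunc_def)
  have ti: "integrable lborel (\<lambda>\<zeta>::complex. trunc R (norm \<zeta>))"
    using trunc_integrable[of R 0] R by simp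
  have hi: "integrable lborel (h m)" for m
  proof (rule Bochner_Integration.integrable_bound[OF _ hm])
    show "integrable lborel (\<lambda>\<zeta>::complex. R ^ m * trunc R (norm \<zeta>))" using ti by simp
  qed (use hn R in \<open>auto simp: trunc_nonneg\<close>)
  define T where "T = (LINT \<zeta>::complex|lborel. trunc R (norm \<zeta>))"
  have hint: "(LINT \<zeta>|lborel. norm (h m \<zeta>)) \<le> R ^ m * T" for m
  proof -
    have "(LINT \<zeta>|lborel. norm (h m \<zeta>)) \<le> (LINT \<zeta>::complex|lborel. R ^ m * trunc R (norm \<zeta>))"
      by (intro integral_mono hn integrable_norm hi integrable_mult_right ti)
    then show ?thesis by (simp add: T_def)
  qed
  have S0: "(\<lambda>m. LINT \<zeta>|lborel. b m * h m \<zeta>) sums (LINT \<zeta>|lborel. (\<Sum>m. b m * h m \<zeta>))"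
  proof (rule sums_integral)
    show "integrable lborel (\<lambda>\<zeta>. b m * h m \<zeta>)" for m using hi by simp
    show "AE \<zeta> in lborel. summable (\<lambda>m. norm (b m * h m \<zeta>))"
    proof (rule AE_I2)
      fix \<zeta> :: complex
      show "summable (\<lambda>m. norm (b m * h m \<zeta>))"
      proof (rule summable_comparison_test'[OF summable_mult2[OF sb, of "trunc R (norm \<zeta>)"], of 0])
        fix m
        have "norm (b m) * norm (h m \<zeta>) \<le> norm (b m) * (R ^ m * trunc R (norm \<zeta>))"
          by (intro mult_left_mono hn) auto
        then show "norm (norm (b m * h m \<zeta>)) \<le> norm (b m) * R ^ m * trunc R (norm \<zeta>)"
          by (simp add: norm_mult mult_ac)
      qed
    qed
    show "summable (\<lambda>m. LINT \<zeta>|lborel. norm (b m * h m \<zeta>))"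
    proof (rule summable_comparison_test'[OF summable_mult2[OF sb, of T], of 0])
      fix m
      have "norm (LINT \<zeta>|lborel. norm (b m * h m \<zeta>)) = norm (b m) * (LINT \<zeta>|lborel. norm (h m \<zeta>))"
        by (simp add: norm_mult integral_nonneg_AE)
      also have "\<dots> \<le> norm (b m) * (R ^ m * T)" by (intro mult_left_mono hint) auto
      finally show "norm (LINT \<zeta>|lborel. norm (b m * h m \<zeta>)) \<le> norm (b m) * R ^ m * T" by (simp add: mult_ac)
    qed
  qed
  have e1: "(LINT \<zeta>|lborel. b m * h m \<zeta>) = (if m = k then b k * (LINT \<zeta>|lborel. h k \<zeta>) else 0)" for m
  proof (cases "m = k")
    case False
    have "(LINT \<zeta>|lborel. h m \<zeta>) = 0"
      unfolding h_def[abs_def]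
      by (rule integral_monomial_radial_eq_0[OF False trunc_measurable]) (use R in simp)
    then show ?thesis using False by simp
  qed simp
  have e2: "(\<Sum>m. b m * h m \<zeta>) = g \<zeta> * cnj (\<zeta> ^ k) * of_real (trunc R (norm \<zeta>))" for \<zeta>
  proof (cases "norm \<zeta> < R")
    case True
    then have "(\<lambda>m. b m * \<zeta> ^ m) sums g \<zeta>" using gs R by auto
    then have "(\<lambda>m. b m * \<zeta> ^ m * (cnj (\<zeta> ^ k) * of_real (trunc R (norm \<zeta>)))) sums (g \<zeta> * (cnj (\<zeta> ^ k) * of_real (trunc R (norm \<zeta>))))"
      by (rule sums_mult2)
    then show ?thesis by (simp add: sums_iff h_def mult_ac)
  qed (simp add: h_def trunc_def)
  have "(\<lambda>m. if m = k then b k * (LINT \<zeta>|lborel. h k \<zeta>) else 0) sums (b k * (LINT \<zeta>|lborel. h k \<zeta>))"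
    using sums_single[of k "\<lambda>_. b k * (LINT \<zeta>|lborel. h k \<zeta>)"] by simp
  with S0[unfolded e1 e2] have "(LINT \<zeta>|lborel. g \<zeta> * cnj (\<zeta> ^ k) * of_real (trunc R (norm \<zeta>))) = b k * (LINT \<zeta>|lborel. h k \<zeta>)"
    by (rule sums_unique2)
  also have "(LINT \<zeta>|lborel. h k \<zeta>) = (LINT \<zeta>::complex|lborel. of_real (norm \<zeta> ^ (2 * k) * trunc R (norm \<zeta>)))"
  proof (rule Bochner_Integration.integral_cong)
    fix \<zeta> :: complex
    have "\<zeta> ^ k * cnj \<zeta> ^ k = of_real (norm \<zeta> ^ (2 * k))"
      by (simp add: complex_norm_square[symmetric] power_mult flip: power_mult_distrib)
    then show "h k \<zeta> = of_real (norm \<zeta> ^ (2 * k) * trunc R (norm \<zeta>))" by (simp add: h_def)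
  qed simp
  also have "\<dots> = of_real (LINT \<zeta>::complex|lborel. norm \<zeta> ^ (2 * k) * trunc R (norm \<zeta>))"
    by (rule integral_complex_of_real)
  finally show ?thesis by (simp add: b_def)
qed

text \<open>Both sides of \<open>integral_holomorphic_trunc\<close> converge as \<open>R\<close>
  tends to 1: the left is dominated by the untruncated integrand, integrable by
  \<open>Linf_pairing\<close>, the right by the integrand of
  \<open>trunc_1_integral\<close>.\<close>

lemma coeffs_holomorphic:
  assumes gL: "g \<in> Linf v" and g: "g holomorphic_on unit_disc"
  shows "coeffs g k = (deriv ^^ k) g 0 / fact k * of_real (2 * pi * mom k)"
proof -
  obtain N where N: "0 \<le> N" "Linf_norm v g = ereal N"
    "AE \<zeta> in lebesgue. \<zeta> \<in> unit_disc \<longrightarrow> norm (g \<zeta>) \<le> N * Cv / (w \<zeta> * H (norm \<zeta>))" using Linf_bound[OF gL] by blast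
  obtain K where K: "0 \<le> K" "(\<integral>\<^sup>+\<zeta>\<in>unit_disc. ennreal (w \<zeta> / H (norm \<zeta>)) \<partial>lborel) \<le> ennreal K" using weight_bound by blast
  define G where "G \<zeta> = indicator unit_disc \<zeta> *\<^sub>R g \<zeta>" for \<zeta>
  have [measurable]: "G \<in> borel_measurable borel"
    unfolding G_def by (rule borel_measurable_continuous_on_indicator[OF _ holomorphic_on_imp_continuous_on[OF g]]) auto
  have [measurable]: "(\<lambda>\<zeta>. cnj (\<zeta> ^ k)) \<in> borel_measurable borel" by (intro borel_measurable_continuous_onI continuous_intros)
  define f where "f R \<zeta> = g \<zeta> * cnj (\<zeta> ^ k) * of_real (trunc R (norm \<zeta>))" for R \<zeta>
  have fm: "f R \<in> borel_measurable lborel" if "R \<le> 1" for R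
  proof -
    have [measurable]: "(\<lambda>z::complex. trunc R (norm z)) \<in> borel_measurable borel" by (rule trunc_measurable[OF that])
    have eq: "f R = (\<lambda>\<zeta>. G \<zeta> * cnj (\<zeta> ^ k) * of_real (trunc R (norm \<zeta>)))"
      using that by (auto simp: fun_eq_iff f_def G_def trunc_def split: split_indicator)
    have "(\<lambda>\<zeta>. G \<zeta> * cnj (\<zeta> ^ k) * of_real (trunc R (norm \<zeta>))) \<in> borel_measurable borel" by measurable
    then show ?thesis unfolding eq measurable_lborel2 .
  qed
  have f1: "f 1 \<zeta> = indicator unit_disc \<zeta> *\<^sub>R (g \<zeta> * cnj (\<zeta> ^ k) * of_real (\<omega> \<zeta>))" for \<zeta>
    by (auto simp: f_def trunc_def omega_eq w_eq split: split_indicator)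
  have "integrable lebesgue (f 1)"
    using Linf_pairing(1)[OF gL N(1,3) power_measurable K(1) power_weight_bound[OF K(2)], of k]
    unfolding set_integrable_def f1[abs_def] .
  then have fi: "integrable lborel (f 1)" using fm[of 1] by (simp add: integrable_completion)
  define R where "R j = 1 - inverse (real (Suc j)) / 2" for j :: nat
  have R: "0 < R j" "R j < 1" for j by (auto simp: R_def field_simps)
  have Rlim: "R \<longlonglongrightarrow> 1"
  proof -
    have "(\<lambda>j. 1 - inverse (real (Suc j)) / 2) \<longlonglongrightarrow> 1 - 0 / 2"
      by (rule tendsto_diff[OF tendsto_const tendsto_divide[OF LIMSEQ_inverse_real_of_nat tendsto_const]]) simp
    then show ?thesis unfolding R_def[abs_def] by (simp only: div_0 diff_zero)
  qed
  have tl: "(\<lambda>j. trunc (R j) r) \<longlonglongrightarrow> trunc 1 r" for r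
  proof (cases "r < 1")
    case True
    have "\<forall>\<^sub>F j in sequentially. r < R j" by (rule order_tendstoD(1)[OF Rlim True])
    then have "\<forall>\<^sub>F j in sequentially. trunc (R j) r = trunc 1 r"
    proof eventually_elim
      case (elim j)
      then show ?case using True by (simp only: trunc_def if_True)
    qed
    then show ?thesis by (rule tendsto_eventually[of "\<lambda>j. trunc (R j) r" "trunc 1 r" sequentially])
  next
    case False
    then have "trunc (R j) r = trunc 1 r" for j using R[of j] by (simp add: trunc_def)
    then show ?thesis by simp
  qed
  have "(\<lambda>j. LINT \<zeta>|lborel. f (R j) \<zeta>) \<longlonglongrightarrow> (LINT \<zeta>|lborel. f 1 \<zeta>)"
  proof (rule integral_dominated_convergence[where w = "\<lambda>\<zeta>. norm (f 1 \<zeta>)"])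
    show "AE \<zeta> in lborel. (\<lambda>j. f (R j) \<zeta>) \<longlonglongrightarrow> f 1 \<zeta>"
      unfolding f_def by (intro AE_I2 tendsto_intros tl)
    show "AE \<zeta> in lborel. norm (f (R j) \<zeta>) \<le> norm (f 1 \<zeta>)" for j
      using trunc_mono[of "R j"] R[of j] trunc_nonneg
      by (intro AE_I2) (auto simp: f_def norm_mult intro!: mult_left_mono)
  qed (use fi fm R in \<open>auto intro: less_imp_le\<close>)
  moreover have "(LINT \<zeta>|lborel. f (R j) \<zeta>) = (deriv ^^ k) g 0 / fact k * of_real (LINT \<zeta>::complex|lborel. norm \<zeta> ^ (2 * k) * trunc (R j) (norm \<zeta>))" for j
    unfolding f_def by (rule integral_holomorphic_trunc[OF g R])
  moreover have "(\<lambda>j. LINT \<zeta>::complex|lborel. norm \<zeta> ^ (2 * k) * trunc (R j) (norm \<zeta>)) \<longlonglongrightarrow>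
      (LINT \<zeta>::complex|lborel. norm \<zeta> ^ (2 * k) * trunc 1 (norm \<zeta>))"
  proof (rule integral_dominated_convergence[where w = "\<lambda>\<zeta>. norm \<zeta> ^ (2 * k) * trunc 1 (norm \<zeta>)"])
    show "AE \<zeta> in lborel. (\<lambda>j. norm (\<zeta>::complex) ^ (2 * k) * trunc (R j) (norm \<zeta>)) \<longlonglongrightarrow> norm \<zeta> ^ (2 * k) * trunc 1 (norm \<zeta>)"
      by (intro AE_I2 tendsto_intros tl)
    show "AE \<zeta> in lborel. norm (norm (\<zeta>::complex) ^ (2 * k) * trunc (R j) (norm \<zeta>)) \<le> norm \<zeta> ^ (2 * k) * trunc 1 (norm \<zeta>)" for j
      using trunc_mono[of "R j"] R[of j] trunc_nonneg
      by (intro AE_I2) (auto simp: abs_mult intro!: mult_left_mono)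
    show "(\<lambda>\<zeta>::complex. norm \<zeta> ^ (2 * k) * trunc (R j) (norm \<zeta>)) \<in> borel_measurable lborel" for j
      using trunc_measurable[of "R j"] R[of j] by simp
    show "(\<lambda>\<zeta>::complex. norm \<zeta> ^ (2 * k) * trunc 1 (norm \<zeta>)) \<in> borel_measurable lborel"
      using trunc_measurable[of 1] by simp
  qed (rule trunc_1_integral)
  then have "(\<lambda>j. (deriv ^^ k) g 0 / fact k * of_real (LINT \<zeta>::complex|lborel. norm \<zeta> ^ (2 * k) * trunc (R j) (norm \<zeta>)))
      \<longlonglongrightarrow> (deriv ^^ k) g 0 / fact k * of_real (2 * pi * mom k)"
    unfolding trunc_1_integral(2) by (intro tendsto_intros)
  ultimately have "(LINT \<zeta>|lborel. f 1 \<zeta>) = (deriv ^^ k) g 0 / fact k * of_real (2 * pi * mom k)"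
    by (simp only: LIMSEQ_unique)
  moreover have "coeffs g k = (LINT \<zeta>|lebesgue. f 1 \<zeta>)"
    unfolding coeffs_def set_lebesgue_integral_def f1 ..
  moreover have "(LINT \<zeta>|lebesgue. f 1 \<zeta>) = (LINT \<zeta>|lborel. f 1 \<zeta>)"
    by (rule integral_completion[OF fm]) simp
  ultimately show ?thesis by simp
qed

lemma bergman_proj_reproducing:
  assumes "g \<in> Hinf v" "z \<in> unit_disc"
  shows "bergman_proj \<omega> g z = g z"
proof -
  have gL: "g \<in> Linf v" and g: "g holomorphic_on unit_disc" using assms by (auto simp: Hinf_def)
  have "(\<lambda>k. coeffs g k / of_real (2 * pi * mom k) * z ^ k) sums bergman_proj \<omega> g z"
    by (rule bergman_proj_sums[OF gL assms(2)])
  moreover have "coeffs g k / of_real (2 * pi * mom k) = (deriv ^^ k) g 0 / fact k" for k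
    unfolding coeffs_holomorphic[OF gL g] using mom_pos[of k] by simp
  moreover have "(\<lambda>k. (deriv ^^ k) g 0 / fact k * (z - 0) ^ k) sums g z"
    by (rule holomorphic_power_series[OF g assms(2)])
  ultimately show ?thesis by (simp only: diff_zero sums_unique2)
qed

theorem bergman_proj_bounded_onto_radial: "bergman_proj_bounded_onto \<omega> v"
proof (rule bergman_proj_bounded, goal_cases)
  case (1 C)
  show ?case
    unfolding bergman_proj_bounded_onto_def
  proof (intro conjI ballI)
    show "\<exists>C. \<forall>f\<in>Linf v. Linf_norm v (bergman_proj \<omega> f) \<le> ereal C * Linf_norm v f" using 1(3) by blast
    show "\<exists>f\<in>Linf v. \<forall>z\<in>unit_disc. bergman_proj \<omega> f z = g z" if "g \<in> Hinf v" for g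
      using bergman_proj_reproducing[OF that] that by (intro bexI[of _ g]) (auto simp: Hinf_def)
  qed (use 1 in blast)+
qed

end

section \<open>Radial functions and doubling tails\<close>

lemma mult_unit_disc: "norm c = 1 \<Longrightarrow> z \<in> unit_disc \<Longrightarrow> c * z \<in> unit_disc"
  by (simp add: norm_mult)

locale radial_C2 =
  fixes \<phi> :: "complex \<Rightarrow> real"
  assumes C2: "C2_on unit_disc \<phi>" and rad: "radial \<phi>"
begin

abbreviation D1 :: "complex \<Rightarrow> complex \<Rightarrow> real" where "D1 z \<equiv> frechet_derivative \<phi> (at z)"

abbreviation D2 :: "complex \<Rightarrow> complex \<Rightarrow> complex \<Rightarrow> real" where
  "D2 z h \<equiv> frechet_derivative (\<lambda>w. D1 w h) (at z)"

lemma D1: "z \<in> unit_disc \<Longrightarrow> (\<phi> has_derivative D1 z) (at z)"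
  using C2 by (auto simp: C2_on_def C1_on_def frechet_derivative_works)

lemma D2: "z \<in> unit_disc \<Longrightarrow> ((\<lambda>w. D1 w h) has_derivative D2 z h) (at z)"
  using C2 by (auto simp: C2_on_def C1_on_def frechet_derivative_works)

lemma D1_cont: "continuous_on unit_disc (\<lambda>z. D1 z h)"
  using C2 by (auto simp: C2_on_def C1_on_def)

lemma phi_cont: "continuous_on unit_disc \<phi>"
  using D1 by (meson continuous_at_imp_continuous_on has_derivative_continuous)

lemma rotate:
  assumes "norm c = 1" "z \<in> unit_disc"
  shows "\<phi> (c * z) = \<phi> z"
proof -
  have "\<phi> (c * z) = \<phi> (of_real (norm (c * z)))" "\<phi> z = \<phi> (of_real (norm z))"
    using rad mult_unit_disc[OF assms] assms(2) unfolding radial_def by blast+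
  then show ?thesis using assms by (simp add: norm_mult)
qed

lemma mult_has_derivative: "((\<lambda>w. c * w) has_derivative (\<lambda>h. c * h)) (at z)" for c :: complex
  by (auto intro!: derivative_eq_intros)

text \<open>Differentiates the identity \<open>\<phi> (c * w) = \<phi> w\<close>; differentiating
  once more gives \<open>D2_rotate\<close>.\<close>

lemma D1_rotate:
  assumes c: "norm c = 1" and z: "z \<in> unit_disc"
  shows "D1 (c * z) (c * h) = D1 z h"
proof -
  have "((\<lambda>w. \<phi> (c * w)) has_derivative (\<lambda>h. D1 (c * z) (c * h))) (at z)"
    by (rule has_derivative_compose[OF mult_has_derivative D1[OF mult_unit_disc[OF c z]]])
  then have "(\<phi> has_derivative (\<lambda>h. D1 (c * z) (c * h))) (at z)"
    by (rule has_derivative_transform_within_open[OF _ open_ball z]) (rule rotate[OF c])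
  then have "(\<lambda>h. D1 (c * z) (c * h)) = D1 z" by (rule frechet_derivative_at)
  then show ?thesis by (rule fun_cong)
qed

lemma D2_rotate:
  assumes c: "norm c = 1" and z: "z \<in> unit_disc"
  shows "D2 (c * z) (c * h) (c * k) = D2 z h k"
proof -
  have "((\<lambda>w. D1 (c * w) (c * h)) has_derivative (\<lambda>k. D2 (c * z) (c * h) (c * k))) (at z)"
    by (rule has_derivative_compose[OF mult_has_derivative D2[OF mult_unit_disc[OF c z]]])
  then have "((\<lambda>w. D1 w h) has_derivative (\<lambda>k. D2 (c * z) (c * h) (c * k))) (at z)"
    by (rule has_derivative_transform_within_open[OF _ open_ball z]) (rule D1_rotate[OF c])
  then have "(\<lambda>k. D2 (c * z) (c * h) (c * k)) = D2 z h" by (rule frechet_derivative_at)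
  then show ?thesis by (rule fun_cong)
qed

lemma D1_linear:
  assumes "z \<in> unit_disc"
  shows "D1 z (of_real a * h + of_real b * h') = a * D1 z h + b * D1 z h'"
proof -
  interpret linear "D1 z" using D1[OF assms] has_derivative_linear by blast
  show ?thesis using add[of "a *\<^sub>R h" "b *\<^sub>R h'"] scale[of a h] scale[of b h'] by (simp add: scaleR_conv_of_real)
qed

text \<open>Linearity in the first direction is not automatic, since \<open>h\<close> is a parameter
  of the differentiated function; it follows by differentiating \<open>D1_linear\<close>.\<close>

lemma D2_linear:
  assumes z: "z \<in> unit_disc"
  shows "D2 z (of_real a * h + of_real b * h') k = a * D2 z h k + b * D2 z h' k"
    and "D2 z h (of_real a * k + of_real b * k') = a * D2 z h k + b * D2 z h k'"
proof -
  have "((\<lambda>w. a * D1 w h + b * D1 w h') has_derivative (\<lambda>k. a * D2 z h k + b * D2 z h' k)) (at z)"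
    by (intro has_derivative_add has_derivative_mult_right D2 z)
  then have "((\<lambda>w. D1 w (of_real a * h + of_real b * h')) has_derivative (\<lambda>k. a * D2 z h k + b * D2 z h' k)) (at z)"
    by (rule has_derivative_transform_within_open[OF _ open_ball z]) (simp only: D1_linear)
  then have "(\<lambda>k. a * D2 z h k + b * D2 z h' k) = D2 z (of_real a * h + of_real b * h')" by (rule frechet_derivative_at)
  then show "D2 z (of_real a * h + of_real b * h') k = a * D2 z h k + b * D2 z h' k" by (rule fun_cong[symmetric])
  interpret linear "D2 z h" using D2[OF z] has_derivative_linear by blast
  show "D2 z h (of_real a * k + of_real b * k') = a * D2 z h k + b * D2 z h k'"
    using add[of "a *\<^sub>R k" "b *\<^sub>R k'"] scale[of a k] scale[of b k'] by (simp add: scaleR_conv_of_real)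
qed

text \<open>Invariance of the trace under the orthogonal map \<open>c\<close>: the frame
  \<open>1\<close>, \<open>\<i>\<close> is the image under \<open>c\<close> of an orthonormal frame,
  and the mixed terms of the two diagonal entries cancel.\<close>

lemma laplacian_rotate:
  assumes c: "norm c = 1" and z: "z \<in> unit_disc"
  shows "laplacian \<phi> (c * z) = laplacian \<phi> z"
proof -
  define a b where "a = Re c" and "b = Im c"
  have ab: "a * a + b * b = 1" using c by (simp add: a_def b_def cmod_def power2_eq_square)
  have cc: "c * (of_real a * 1 + of_real (- b) * \<i>) = 1" "c * (of_real b * 1 + of_real a * \<i>) = \<i>"
    using ab by (auto simp: complex_eq_iff a_def b_def algebra_simps)
  have "D2 (c * z) 1 1 = D2 z (of_real a * 1 + of_real (- b) * \<i>) (of_real a * 1 + of_real (- b) * \<i>)"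
    using D2_rotate[OF c z, of "of_real a * 1 + of_real (- b) * \<i>" "of_real a * 1 + of_real (- b) * \<i>"] unfolding cc .
  also have "\<dots> = a * a * D2 z 1 1 - a * b * D2 z 1 \<i> - a * b * D2 z \<i> 1 + b * b * D2 z \<i> \<i>"
    unfolding D2_linear[OF z] by (simp add: algebra_simps)
  finally have 1: "D2 (c * z) 1 1 = \<dots>" .
  have "D2 (c * z) \<i> \<i> = D2 z (of_real b * 1 + of_real a * \<i>) (of_real b * 1 + of_real a * \<i>)"
    using D2_rotate[OF c z, of "of_real b * 1 + of_real a * \<i>" "of_real b * 1 + of_real a * \<i>"] unfolding cc .
  also have "\<dots> = b * b * D2 z 1 1 + a * b * D2 z 1 \<i> + a * b * D2 z \<i> 1 + a * a * D2 z \<i> \<i>"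
    unfolding D2_linear[OF z] by (simp add: algebra_simps)
  finally have "D2 (c * z) 1 1 + D2 (c * z) \<i> \<i> = (a * a + b * b) * (D2 z 1 1 + D2 z \<i> \<i>)"
    unfolding 1 by (simp add: algebra_simps)
  then show ?thesis unfolding laplacian_def ab by simp
qed

lemma laplacian_radial:
  assumes "z \<in> unit_disc"
  shows "laplacian \<phi> z = laplacian \<phi> (of_real (norm z))"
proof -
  have "z = cis (Arg2pi z) * of_real (norm z)" using Arg2pi_eq[of z] by (simp add: cis_conv_exp mult.commute)
  then show ?thesis using laplacian_rotate[of "cis (Arg2pi z)" "of_real (norm z)"] assms by simp
qed

lemma deriv_real:
  fixes f :: "complex \<Rightarrow> real"
  assumes "z = of_real r" "z \<in> unit_disc" "(f has_derivative f') (at z)"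
  shows "((\<lambda>r. f (of_real r)) has_real_derivative f' 1) (at r)"
proof -
  have "((\<lambda>r. f (of_real r)) has_derivative (\<lambda>h. f' (of_real h))) (at r)"
  proof -
    have "(of_real has_derivative (of_real :: real \<Rightarrow> complex)) (at r)" by (auto intro!: derivative_eq_intros)
    then show ?thesis by (rule has_derivative_compose) (use assms in simp)
  qed
  moreover have "f' (of_real h) = f' 1 * h" for h
  proof -
    interpret linear f' using assms(3) has_derivative_linear by blast
    show ?thesis using scale[of h 1] by (simp add: scaleR_conv_of_real)
  qed
  ultimately show ?thesis by (simp add: has_field_derivative_def)
qed

text \<open>\<open>D1 w (\<i> * w) = 0\<close> along the circle \<open>w = r cis \<theta>\<close>; differentiating in \<open>\<theta>\<close> gives the angular part of the Laplacian.\<close>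

lemma D2_angular:
  assumes r: "0 < r" "r < 1"
  shows "r * D2 (of_real r) \<i> \<i> = D1 (of_real r) 1"
proof -
  define c where "c = (\<lambda>\<theta>. of_real r * cis \<theta>)"
  have cd: "c \<theta> \<in> unit_disc" for \<theta> using r by (simp add: c_def norm_mult)
  have c': "(c has_derivative (\<lambda>h. of_real h * (of_real r * \<i>))) (at 0)"
  proof -
    have "((\<lambda>\<theta>. of_real r * (of_real (cos \<theta>) + \<i> * of_real (sin \<theta>))) has_derivative (\<lambda>h. of_real h * (of_real r * \<i>))) (at (0::real))"
      by (rule derivative_eq_intros | simp add: mult_ac)+
    moreover have "of_real r * (of_real (cos \<theta>) + \<i> * of_real (sin \<theta>)) = c \<theta>" for \<theta>
      by (simp add: c_def complex_eq_iff)
    ultimately show ?thesis by simp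
  qed
  have c0: "c 0 = of_real r" by (simp add: c_def)
  \<comment> \<open>\<open>\<phi>\<close> is constant on the circle, so its tangential derivative
    vanishes.\<close>
  have tang: "D1 (of_real r) \<i> = 0"
  proof -
    have d1: "((\<lambda>\<theta>. \<phi> (c \<theta>)) has_derivative (\<lambda>h. D1 (c 0) (of_real h * (of_real r * \<i>)))) (at 0)"
      by (rule has_derivative_compose[OF c' D1[OF cd]])
    have const: "\<phi> (c \<theta>) = \<phi> (of_real r)" for \<theta>
      using rotate[of "cis \<theta>" "of_real r"] r by (simp add: c_def mult.commute)
    have "((\<lambda>\<theta>. \<phi> (of_real r)) has_derivative (\<lambda>h::real. 0)) (at 0)" by (rule has_derivative_const)
    from has_derivative_unique[OF d1[unfolded const] this]
    have "(\<lambda>h. D1 (c 0) (of_real h * (of_real r * \<i>))) = (\<lambda>h. 0)" .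
    then have "D1 (c 0) (of_real 1 * (of_real r * \<i>)) = 0" by (rule fun_cong)
    then have "D1 (of_real r) (of_real r * \<i>) = 0" by (simp add: c0)
    then show ?thesis using D1_linear[of "of_real r" r \<i> 0 0] r by simp
  qed
  \<comment> \<open>The rotated tangent is expanded in the fixed directions \<open>\<i>\<close> and
    \<open>1\<close>, so that the identity can be differentiated in \<theta> by means of
    \<open>D2\<close>.\<close>
  have zero: "cos \<theta> * D1 (c \<theta>) \<i> + - sin \<theta> * D1 (c \<theta>) 1 = 0" for \<theta>
  proof -
    have "D1 (cis \<theta> * of_real r) (cis \<theta> * \<i>) = 0"
      using D1_rotate[of "cis \<theta>" "of_real r" \<i>] tang r by simp
    moreover have "cis \<theta> * \<i> = of_real (cos \<theta>) * \<i> + of_real (- sin \<theta>) * 1" by (simp add: complex_eq_iff)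
    moreover have "cis \<theta> * of_real r = c \<theta>" by (simp add: c_def mult.commute)
    ultimately show ?thesis using D1_linear[OF cd, of \<theta> "cos \<theta>" \<i> "- sin \<theta>" 1] by simp
  qed
  have d: "((\<lambda>\<theta>. D1 (c \<theta>) h) has_real_derivative D2 (of_real r) h (of_real r * \<i>)) (at 0)" for h
  proof -
    have "((\<lambda>\<theta>. D1 (c \<theta>) h) has_derivative (\<lambda>k. D2 (c 0) h (of_real k * (of_real r * \<i>)))) (at 0)"
      by (rule has_derivative_compose[OF c' D2[OF cd]])
    moreover have "D2 (c 0) h (of_real k * (of_real r * \<i>)) = D2 (of_real r) h (of_real r * \<i>) * k" for k
    proof -
      have "D2 (c 0) h (of_real k * (of_real r * \<i>) + of_real 0 * 0) = k * D2 (c 0) h (of_real r * \<i>) + 0 * D2 (c 0) h 0"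
        by (rule D2_linear(2)[OF cd])
      then show ?thesis by (simp add: c0 mult.commute)
    qed
    ultimately show ?thesis by (simp add: has_field_derivative_def)
  qed
  have dA: "((\<lambda>\<theta>. cos \<theta> * D1 (c \<theta>) \<i> + - sin \<theta> * D1 (c \<theta>) 1) has_real_derivative
      D2 (of_real r) \<i> (of_real r * \<i>) - D1 (of_real r) 1) (at 0)"
    by (rule derivative_eq_intros d | simp add: c0)+
  have "D2 (of_real r) \<i> (of_real r * \<i>) - D1 (of_real r) 1 = 0"
    by (rule DERIV_unique[OF dA[unfolded zero] DERIV_const])
  moreover have "D2 (of_real r) \<i> (of_real r * \<i> + of_real 0 * 0) = r * D2 (of_real r) \<i> \<i> + 0 * D2 (of_real r) \<i> 0"
    by (rule D2_linear(2)) (use r in simp)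
  ultimately show ?thesis by simp
qed

text \<open>By \<open>D2_angular\<close>, \<open>r\<close> times the angular part of the Laplacian
  is the first radial derivative; the product rule then yields \<open>r\<close> times the whole
  Laplacian.\<close>

lemma psi_has_derivative:
  assumes r: "0 < r" "r < 1"
  shows "((\<lambda>r. r * D1 (of_real r) 1) has_real_derivative r * laplacian \<phi> (of_real r)) (at r)"
proof -
  have "((\<lambda>r. D1 (of_real r) 1) has_real_derivative D2 (of_real r) 1 1) (at r)"
    by (rule deriv_real[OF refl _ D2]) (use r in auto)
  then have "((\<lambda>r. r * D1 (of_real r) 1) has_real_derivative 1 * D1 (of_real r) 1 + D2 (of_real r) 1 1 * r) (at r)"
    by (intro DERIV_mult DERIV_ident)
  also have "1 * D1 (of_real r) 1 + D2 (of_real r) 1 1 * r = r * laplacian \<phi> (of_real r)"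
    using D2_angular[OF r] by (simp add: laplacian_def distrib_left mult.commute)
  finally show ?thesis .
qed

end

section \<open>Doubling tails are slow\<close>

context radial_profile
begin

text \<open>Each step moves \<open>r\<close> half of the way to 1, which halves
  \<open>1 - r\<close>; if that reaches or passes \<open>s\<close>, monotonicity finishes.\<close>

lemma doubling_iterate:
  fixes T :: "real \<Rightarrow> real"
  assumes anti: "\<And>r s. 0 \<le> r \<Longrightarrow> r \<le> s \<Longrightarrow> s < 1 \<Longrightarrow> T s \<le> T r" and pos: "\<And>r. 0 \<le> r \<Longrightarrow> r < 1 \<Longrightarrow> 0 < T r"
    and C: "1 \<le> C" and dbl: "\<And>r. R \<le> r \<Longrightarrow> r < 1 \<Longrightarrow> T r \<le> C * T ((1 + r) / 2)" and R: "0 \<le> R"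
  shows "R \<le> r \<Longrightarrow> r \<le> s \<Longrightarrow> s < 1 \<Longrightarrow> 1 - r \<le> 2 ^ k * (1 - s) \<Longrightarrow> T r \<le> C ^ k * T s"
proof (induction k arbitrary: r)
  case 0
  then have "r = s" by simp
  then show ?case by simp
next
  case (Suc k)
  have r: "T r \<le> C * T ((1 + r) / 2)" using Suc.prems by (intro dbl) auto
  have Ts: "0 < T s" using pos Suc.prems R by auto
  show ?case
  proof (cases "s \<le> (1 + r) / 2")
    case True
    have "T r \<le> T s * C"
    proof -
      have "T ((1 + r) / 2) \<le> T s" using True Suc.prems R by (intro anti) auto
      then have "C * T ((1 + r) / 2) \<le> C * T s" using C by (intro mult_left_mono) auto
      then show ?thesis using r by (simp add: mult.commute)
    qed
    also have "\<dots> \<le> T s * C ^ Suc k"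
      using C Ts self_le_power[OF C, of "Suc k"] by (intro mult_left_mono) auto
    finally show ?thesis by (simp add: mult.commute)
  next
    case False
    have "T ((1 + r) / 2) \<le> C ^ k * T s"
      using False Suc.prems by (intro Suc.IH) (auto simp: field_simps)
    then have "C * T ((1 + r) / 2) \<le> C * (C ^ k * T s)" using C by (intro mult_left_mono) auto
    then show ?thesis using r by simp
  qed
qed

text \<open>About \<open>log 2 q\<close> doubling steps lead from \<open>r\<close> to
  \<open>s\<close>, where \<open>q = (1 - r) / (1 - s)\<close>, at a cost of order
  \<open>q powr \<beta>\<close>. Since \<open>p x \<le> e * (1 - x)\<close> near 1,
  \<open>ln q\<close> is at most \<open>e\<close> times the \<tau>-distance, and
  \<open>e = \<eta> / \<beta>\<close> gives the rate \<open>\<eta>\<close>.\<close>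

lemma slow_doubling:
  fixes T :: "real \<Rightarrow> real"
  assumes anti: "\<And>r s. 0 \<le> r \<Longrightarrow> r \<le> s \<Longrightarrow> s < 1 \<Longrightarrow> T s \<le> T r" and pos: "\<And>r. 0 \<le> r \<Longrightarrow> r < 1 \<Longrightarrow> 0 < T r"
    and dbl: "0 < C" "\<forall>\<^sub>F r in at_left 1. T r \<le> C * T ((1 + r) / 2)"
  shows "slow T"
proof (rule slowI)
  fix R :: real assume "0 \<le> R" "R < 1"
  then show "\<exists>m M. 0 < m \<and> (\<forall>r\<in>{0..R}. m \<le> T r \<and> T r \<le> M)"
    using anti pos by (intro exI[of _ "T R"] exI[of _ "T 0"]) auto
next
  fix \<eta> :: real assume \<eta>: "0 < \<eta>"
  obtain R1 where R1: "R1 < 1" "\<And>r. R1 < r \<Longrightarrow> r < 1 \<Longrightarrow> T r \<le> C * T ((1 + r) / 2)"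
    using dbl(2) unfolding eventually_at_left_field by blast
  \<comment> \<open>\<open>C + 1\<close> instead of \<open>C\<close> makes \<open>ln c\<close>, and
    hence \<open>\<beta>\<close>, positive.\<close>
  define c where "c = C + 1"
  have c: "1 < c" using dbl(1) by (simp add: c_def)
  define \<beta> where "\<beta> = ln c / ln 2"
  have \<beta>: "0 < \<beta>" using c by (simp add: \<beta>_def)
  define e where "e = \<eta> / \<beta>"
  have e: "0 < e" using \<eta> \<beta> by (simp add: e_def)
  obtain R2 where R2: "0 \<le> R2" "R2 < 1" "\<And>r s. R2 \<le> r \<Longrightarrow> r < 1 \<Longrightarrow> R2 \<le> s \<Longrightarrow> s < 1 \<Longrightarrow> \<bar>p r - p s\<bar> \<le> e * \<bar>r - s\<bar>"
    using p_small_lip[OF e] by blast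
  \<comment> \<open>\<open>(1 + R1) / 2\<close> lies strictly between \<open>R1\<close> and 1; the
    doubling bound is available for \<open>r > R1\<close>.\<close>
  define R where "R = max R2 ((1 + R1) / 2)"
  have R: "0 \<le> R" "R < 1" "R2 \<le> R" "R1 < R"
  proof -
    have "R1 < (1 + R1) / 2" "(1 + R1) / 2 < 1" using R1(1) by simp_all
    then show "0 \<le> R" "R < 1" "R2 \<le> R" "R1 < R" using R2(1,2) unfolding R_def by linarith+
  qed
  have dbl': "T r \<le> c * T ((1 + r) / 2)" if "R \<le> r" "r < 1" for r
  proof -
    have "T r \<le> C * T ((1 + r) / 2)" using R1(2)[of r] that R by auto
    also have "\<dots> \<le> c * T ((1 + r) / 2)" using pos[of "(1 + r) / 2"] that R by (intro mult_right_mono) (auto simp: c_def)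
    finally show ?thesis .
  qed
  have main: "T r \<le> c * exp (\<eta> * (\<tau> s - \<tau> r)) * T s" if rs: "R \<le> r" "r \<le> s" "s < 1" for r s
  proof -
    have "e * \<tau> r + ln (1 - r) \<le> e * \<tau> s + ln (1 - s)"
    proof (rule deriv_nonneg_imp_le[where f = "\<lambda>x. e * \<tau> x + ln (1 - x)" and f' = "\<lambda>x. e * (1 / p x) - 1 / (1 - x)"])
      show "continuous_on {r..s} (\<lambda>x. e * \<tau> x + ln (1 - x))"
        using rs R by (intro continuous_intros tau_cont[of _ s]) auto
      fix x assume x: "r < x" "x < s"
      show "((\<lambda>x. e * \<tau> x + ln (1 - x)) has_real_derivative e * (1 / p x) - 1 / (1 - x)) (at x)"
        using x rs R by (auto intro!: derivative_eq_intros tau_deriv)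
      have "p x \<le> e * (1 - x)" by (rule p_le_if_lip[OF R2(1,3)]) (use x rs R in auto)
      then show "0 \<le> e * (1 / p x) - 1 / (1 - x)" using p_pos[of x] x rs R by (simp add: field_simps)
    qed (use rs in auto)
    then have l: "ln ((1 - r) / (1 - s)) \<le> e * (\<tau> s - \<tau> r)" using rs by (simp add: ln_div algebra_simps)
    define q where "q = (1 - r) / (1 - s)"
    have q: "1 \<le> q" using rs by (simp add: q_def)
    define k where "k = nat \<lceil>log 2 q\<rceil>"
    have lq: "0 \<le> log 2 q" using q by simp
    have k: "log 2 q \<le> real k" "real k \<le> log 2 q + 1" unfolding k_def using lq by linarith+
    have "q = 2 powr (log 2 q)" using q by simp
    also have "\<dots> \<le> 2 powr (real k)" using k by (intro powr_mono) auto
    finally have "q \<le> 2 ^ k" by (simp add: powr_realpow)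
    then have "1 - r \<le> 2 ^ k * (1 - s)" using rs by (simp add: q_def pos_divide_le_eq)
    then have qk: "1 - r \<le> 2 ^ k * (1 - s)" .
    have "T r \<le> c ^ k * T s"
      by (rule doubling_iterate[of T, OF anti pos less_imp_le[OF c] dbl' R(1) rs qk])
    moreover have "c ^ k \<le> c * exp (\<eta> * (\<tau> s - \<tau> r))"
    proof -
      have "\<beta> * ln q \<le> \<beta> * (e * (\<tau> s - \<tau> r))" using l \<beta> by (intro mult_left_mono) (auto simp: q_def)
      also have "\<beta> * (e * (\<tau> s - \<tau> r)) = \<eta> * (\<tau> s - \<tau> r)" using \<beta> by (simp add: e_def)
      finally have b: "\<beta> * ln q \<le> \<eta> * (\<tau> s - \<tau> r)" .
      have "c ^ k = exp (real k * ln c)" using c by (simp add: exp_of_nat_mult)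
      also have "\<dots> \<le> exp ((log 2 q + 1) * ln c)"
        unfolding exp_le_cancel_iff by (rule mult_right_mono) (use k c in auto)
      also have "(log 2 q + 1) * ln c = \<beta> * ln q + ln c" by (simp add: \<beta>_def log_def distrib_right)
      also have "exp \<dots> = c * exp (\<beta> * ln q)" using c by (simp add: exp_add)
      also have "\<dots> \<le> c * exp (\<eta> * (\<tau> s - \<tau> r))" using c b by (intro mult_left_mono) auto
      finally show ?thesis .
    qed
    then have "c ^ k * T s \<le> c * exp (\<eta> * (\<tau> s - \<tau> r)) * T s"
      using pos[of s] rs R by (intro mult_right_mono) auto
    ultimately show ?thesis by linarith
  qed
  have "T s \<le> c * exp (\<eta> * (\<tau> s - \<tau> r)) * T r" if rs: "R \<le> r" "r \<le> s" "s < 1" for r s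
  proof -
    have "T s \<le> 1 * T r" using anti rs R by auto
    also have "1 * T r \<le> c * exp (\<eta> * (\<tau> s - \<tau> r)) * T r"
    proof (rule mult_right_mono)
      have "1 * 1 \<le> c * exp (\<eta> * (\<tau> s - \<tau> r))" using c tau_mono[of r s] rs R \<eta> by (intro mult_mono) auto
      then show "1 \<le> c * exp (\<eta> * (\<tau> s - \<tau> r))" by simp
    qed (use pos[of r] rs R in auto)
    finally show ?thesis .
  qed
  with main show "\<exists>R C. 0 \<le> R \<and> R < 1 \<and> 0 < C \<and> (\<forall>r s. R \<le> r \<longrightarrow> r \<le> s \<longrightarrow> s < 1 \<longrightarrow>
              T r \<le> C * exp (\<eta> * (\<tau> s - \<tau> r)) * T s \<and> T s \<le> C * exp (\<eta> * (\<tau> s - \<tau> r)) * T r)"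
    using R c by (intro exI[of _ R] exI[of _ c]) auto
qed (rule pos)

end

context
  fixes \<nu> :: "complex \<Rightarrow> real"
  assumes \<nu>: "radial_weight \<nu>"
begin

lemma tail_antimono:
  assumes "0 \<le> r" "r \<le> s"
  shows "tail \<nu> (of_real s) \<le> tail \<nu> (of_real r)"
proof -
  have int: "set_integrable lebesgue {x..<1} (\<lambda>s. \<nu> (of_real s))" if "0 \<le> x" for x
    by (rule set_integrable_subset[of lebesgue "{0..<1}"]) (use \<nu> that in \<open>auto simp: radial_weight_def\<close>)
  show ?thesis
    unfolding tail_def set_lebesgue_integral_def
  proof (rule integral_mono)
    fix x :: real
    have "0 \<le> \<nu> (of_real x)" if "0 \<le> x" "x < 1" using \<nu> that by (auto simp: radial_weight_def)
    then show "indicator {norm (of_real s :: complex)..<1} x *\<^sub>R \<nu> (of_real x) \<le> indicator {norm (of_real r :: complex)..<1} x *\<^sub>R \<nu> (of_real x)"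
      using assms by (auto split: split_indicator)
  qed (use int assms in \<open>auto simp: set_integrable_def\<close>)
qed

text \<open>Monotone functions are Borel, and \<open>max 0 r\<close> extends the monotonicity of the
  tail to the whole line before \<open>\<bar>r\<bar>\<close> is substituted.\<close>

lemma tail_borel: "(\<lambda>r. tail \<nu> (of_real \<bar>r\<bar>)) \<in> borel_measurable borel"
proof -
  have "mono (\<lambda>r. - tail \<nu> (of_real (max 0 r)))"
    by (intro monoI) (auto intro!: tail_antimono)
  then have "(\<lambda>r. - tail \<nu> (of_real (max 0 r))) \<in> borel_measurable borel" by (rule borel_measurable_mono)
  then have m: "(\<lambda>r. - (- tail \<nu> (of_real (max 0 r)))) \<in> borel_measurable borel" by (rule borel_measurable_uminus)
  have "(\<lambda>r::real. \<bar>r\<bar>) \<in> borel_measurable borel" by simp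
  from measurable_compose[OF this m] show ?thesis by simp
qed

end

text \<open>For negative \<open>\<sigma>\<close> the two inequalities exchange their roles, hence
  the exponent \<open>\<bar>\<sigma>\<bar>\<close>.\<close>

lemma powr_comparable:
  fixes x y Q \<sigma> :: real
  assumes "0 < x" "0 < y" "1 \<le> Q" "x \<le> Q * y" "y \<le> Q * x"
  shows "x powr \<sigma> \<le> Q powr \<bar>\<sigma>\<bar> * y powr \<sigma>"
proof (cases "0 \<le> \<sigma>")
  case True
  then have "x powr \<sigma> \<le> (Q * y) powr \<sigma>" using assms by (intro powr_mono2) auto
  then show ?thesis using True assms by (simp add: powr_mult)
next
  case False
  have "y powr - \<sigma> \<le> (Q * x) powr - \<sigma>" using False assms by (intro powr_mono2) auto
  then have "y powr - \<sigma> \<le> Q powr - \<sigma> * x powr - \<sigma>" using assms by (simp add: powr_mult)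
  then have "inverse (y powr \<sigma>) \<le> Q powr - \<sigma> * inverse (x powr \<sigma>)" by (simp add: powr_minus)
  then have "x powr \<sigma> \<le> Q powr - \<sigma> * y powr \<sigma>" using assms by (simp add: field_simps)
  then show ?thesis using False by simp
qed

theorem theorem20:
  fixes \<phi> \<rho> w \<nu> \<omega> v :: "complex \<Rightarrow> real" and t :: int and \<sigma> :: real
  assumes "w \<in> class_E"
    and "\<phi> \<in> class_W0" and "radial \<phi>"
    and "\<And>z. z \<in> unit_disc \<Longrightarrow> w z = exp (- \<phi> z)"
    and "\<rho> \<in> class_L0"
    and "comparable_on unit_disc (\<lambda>z. 1 / sqrt (laplacian \<phi> z)) \<rho>"
    and "\<nu> \<in> class_D_hat"
    and "\<And>z. z \<in> unit_disc \<Longrightarrow> \<omega> z = (w z)^2"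
    and "t \<in> {-1, 0, 1}"
    and "\<And>z. z \<in> unit_disc \<Longrightarrow> v z = w z * tail \<nu> z powi t * \<rho> z powr \<sigma>"
  shows "bergman_proj_bounded_onto \<omega> v"
proof -
  note w = assms(4) and \<rho> = assms(5) and t = assms(9) and v = assms(10)
  have C2: "C2_on unit_disc \<phi>" and lap: "\<And>z. z \<in> unit_disc \<Longrightarrow> 0 < laplacian \<phi> z"
    using assms(2) by (auto simp: class_W0_def)
  interpret \<phi>: radial_C2 \<phi> using C2 assms(3) by unfold_locales
  obtain C where C: "1 \<le> C" "\<And>z. z \<in> unit_disc \<Longrightarrow> \<rho> z / C \<le> 1 / sqrt (laplacian \<phi> z)"
      "\<And>z. z \<in> unit_disc \<Longrightarrow> 1 / sqrt (laplacian \<phi> z) \<le> C * \<rho> z"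
    using assms(6) unfolding comparable_on_def by blast
  have \<rho>_pos: "0 < \<rho> z" if "z \<in> unit_disc" for z
  proof -
    have "0 < 1 / sqrt (laplacian \<phi> z)" using lap[OF that] by simp
    then have "0 < C * \<rho> z" using C(3)[OF that] by linarith
    then show ?thesis using C(1) by (simp add: zero_less_mult_iff)
  qed
  define p where "p r = \<rho> (of_real r)" for r :: real
  define u where "u r = \<phi> (of_real r)" for r :: real
  define D where "D r = laplacian \<phi> (of_real r)" for r :: real
  define \<psi> where "\<psi> r = r * \<phi>.D1 (of_real r) 1" for r :: real
  obtain L where L: "L-lipschitz_on unit_disc \<rho>" using \<rho> by (auto simp: class_L0_def)
  have L0: "0 \<le> L" using L by (rule lipschitz_on_nonneg)
  \<comment> \<open>\<open>L + 1\<close> makes the Lipschitz constant positive; squaring the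
    comparison of \<open>\<rho>\<close> with the Laplacian gives the constants
    \<open>1 / C\<^sup>2\<close> and \<open>C\<^sup>2\<close>.\<close>
  interpret radial_profile p u \<psi> D "L + 1" "1 / C\<^sup>2" "C\<^sup>2"
  proof
    show "0 < p r" if "0 \<le> r" "r < 1" for r using \<rho>_pos that by (simp add: p_def)
    show "0 < L + 1" using L0 by simp
    show "\<bar>p r - p s\<bar> \<le> (L + 1) * \<bar>r - s\<bar>" if "0 \<le> r" "r < 1" "0 \<le> s" "s < 1" for r s
    proof -
      have "dist (p r) (p s) \<le> L * dist (of_real r :: complex) (of_real s)"
        unfolding p_def using that by (intro lipschitz_onD[OF L]) auto
      then have "\<bar>p r - p s\<bar> \<le> L * \<bar>r - s\<bar>" by (simp add: dist_real_def dist_of_real)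
      also have "\<dots> \<le> (L + 1) * \<bar>r - s\<bar>" by (intro mult_right_mono) auto
      finally show ?thesis .
    qed
    have lim: "(\<rho> \<longlongrightarrow> 0) (filtercomap norm (at_left 1))" using \<rho> by (simp add: class_L0_def)
    have "filterlim (of_real :: real \<Rightarrow> complex) (filtercomap norm (at_left 1)) (at_left 1)"
      unfolding filterlim_filtercomap_iff o_def
    proof (rule filterlim_mono_eventually[OF filterlim_ident order_refl order_refl])
      have "\<forall>\<^sub>F x in at_left 1. x \<in> {0<..<1::real}" by (rule eventually_at_left_real) simp
      then show "\<forall>\<^sub>F x in at_left 1. x = norm (of_real x :: complex)" by eventually_elim auto
    qed
    from filterlim_compose[OF lim this] show "(p \<longlongrightarrow> 0) (at_left 1)" by (simp add: p_def[abs_def])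
    fix e :: real assume "0 < e"
    then obtain E where E: "compact E" "E \<subseteq> unit_disc" "e-lipschitz_on (unit_disc - E) \<rho>"
      using \<rho> by (auto simp: class_L0_def)
    \<comment> \<open>A compact subset of the open disc stays in a smaller disc, so its complement
      contains all radii close to 1.\<close>
    obtain R0 where R0: "R0 < 1" "\<And>z. z \<in> E \<Longrightarrow> norm z \<le> R0"
    proof (cases "E = {}")
      case False
      then obtain x where "x \<in> E" "\<And>y. y \<in> E \<Longrightarrow> norm y \<le> norm x"
        using continuous_attains_sup[OF E(1) False, of norm] by (auto intro: continuous_intros)
      then show ?thesis using E(2) by (intro that[of "norm x"]) auto
    qed (use that[of 0] in auto)
    define R where "R = max 0 ((1 + R0) / 2)"
    have R: "0 \<le> R" "R < 1" "R0 < R"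
    proof -
      have "R0 < (1 + R0) / 2" "(1 + R0) / 2 < 1" using R0(1) by simp_all
      then show "0 \<le> R" "R < 1" "R0 < R" unfolding R_def by linarith+
    qed
    show "\<exists>R\<ge>0. R < 1 \<and> (\<forall>r s. R \<le> r \<longrightarrow> r < 1 \<longrightarrow> R \<le> s \<longrightarrow> s < 1 \<longrightarrow> \<bar>p r - p s\<bar> \<le> e * \<bar>r - s\<bar>)"
    proof (intro exI[of _ R] conjI allI impI R(1,2))
      fix r s assume rs: "R \<le> r" "r < 1" "R \<le> s" "s < 1"
      have out: "of_real x \<in> unit_disc - E" if "R \<le> x" "x < 1" for x
        using R0(2)[of "of_real x"] that R by auto
      have "dist (p r) (p s) \<le> e * dist (of_real r :: complex) (of_real s)"
        unfolding p_def using rs out by (intro lipschitz_onD[OF E(3)]) auto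
      then show "\<bar>p r - p s\<bar> \<le> e * \<bar>r - s\<bar>" by (simp add: dist_real_def dist_of_real)
    qed
  next
    show "0 < 1 / C\<^sup>2" using C(1) by simp
    fix r :: real assume r: "0 \<le> r" "r < 1"
    have z: "of_real r \<in> unit_disc" using r by simp
    have D: "0 < D r" "0 < p r" using lap[OF z] \<rho>_pos[OF z] by (auto simp: D_def p_def)
    have "1 / sqrt (D r) \<le> C * p r" using C(3)[OF z] by (simp add: D_def p_def)
    then have "1 \<le> C * p r * sqrt (D r)" using D by (simp add: field_simps)
    then have "1\<^sup>2 \<le> (C * p r * sqrt (D r))\<^sup>2" by (intro power_mono) auto
    then show "1 / C\<^sup>2 / (p r)\<^sup>2 \<le> D r" using D C(1) by (simp add: power_mult_distrib field_simps)
    have "p r / C \<le> 1 / sqrt (D r)" using C(2)[OF z] by (simp add: D_def p_def)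
    then have "p r * sqrt (D r) \<le> C" using D C(1) by (simp add: field_simps)
    then have "(p r * sqrt (D r))\<^sup>2 \<le> C\<^sup>2" using D by (intro power_mono) auto
    then show "D r \<le> C\<^sup>2 / (p r)\<^sup>2" using D by (simp add: power_mult_distrib field_simps)
  next
    have img: "continuous_on {0..<1::real} (of_real :: real \<Rightarrow> complex)" "of_real ` {0..<1::real} \<subseteq> unit_disc"
      by (auto intro!: continuous_intros)
    show "continuous_on {0..<1} u"
      unfolding u_def by (rule continuous_on_compose2[OF \<phi>.phi_cont img])
    show "continuous_on {0..<1} \<psi>"
      unfolding \<psi>_def by (intro continuous_intros continuous_on_compose2[OF \<phi>.D1_cont img])
    show "\<psi> 0 = 0" by (simp add: \<psi>_def)
    fix r :: real assume r: "0 < r" "r < 1"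
    have "(u has_real_derivative \<phi>.D1 (of_real r) 1) (at r)"
      unfolding u_def by (rule \<phi>.deriv_real[OF refl _ \<phi>.D1]) (use r in auto)
    then show "(u has_real_derivative \<psi> r / r) (at r)" using r by (simp add: \<psi>_def)
    show "(\<psi> has_real_derivative r * D r) (at r)"
      unfolding \<psi>_def D_def by (rule \<phi>.psi_has_derivative[OF r])
  qed
  have \<nu>: "radial_weight \<nu>" using assms(7) by (simp add: class_D_hat_def)
  \<comment> \<open>The absolute value keeps the values on \<open>[0, 1)\<close> and gives the form
    covered by \<open>tail_borel\<close>.\<close>
  define T where "T r = tail \<nu> (of_real \<bar>r\<bar>)" for r :: real
  have T_pos: "0 < T r" if "0 \<le> r" "r < 1" for r using \<nu> that by (auto simp: T_def radial_weight_def)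
  have T_slow: "slow T"
  proof -
    obtain B where B: "0 < B" "\<forall>\<^sub>F r in at_left 1. tail \<nu> (of_real r) \<le> B * tail \<nu> (of_real ((1 + r) / 2))"
      using assms(7) by (auto simp: class_D_hat_def)
    have "\<forall>\<^sub>F r in at_left 1. r \<in> {0<..<1::real}" by (rule eventually_at_left_real) simp
    with B(2) have "\<forall>\<^sub>F r in at_left 1. T r \<le> B * T ((1 + r) / 2)"
      by eventually_elim (simp add: T_def)
    then show ?thesis using B(1) T_pos
      by (intro slow_doubling) (auto simp: T_def intro!: tail_antimono[OF \<nu>])
  qed
  \<comment> \<open>The default 1 outside \<open>[0, 1)\<close> makes \<open>H\<close> Borel on the
    line, whatever \<open>\<rho>\<close> is outside the disc.\<close>
  define H where "H r = (if 0 \<le> r \<and> r < 1 then T r powi t * p r powr \<sigma> else 1)" for r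
  have H_slow: "slow H"
  proof -
    have "slow (\<lambda>r. T r powi t)"
    proof -
      consider "t = -1" | "t = 0" | "t = 1" using t by auto
      then show ?thesis
        by cases (use slow_inverse[OF T_slow] slow_const[of 1] T_slow in \<open>auto simp: power_int_minus\<close>)
    qed
    then have "slow (\<lambda>r. T r powi t * p r powr \<sigma>)" by (intro slow_mult slow_powr slow_p)
    then show ?thesis using slow_cong[of H "\<lambda>r. T r powi t * p r powr \<sigma>"] by (simp add: H_def)
  qed
  have [measurable]: "T \<in> borel_measurable borel" unfolding T_def[abs_def] by (rule tail_borel[OF \<nu>])
  have Tt_meas [measurable]: "(\<lambda>r. T r powi t) \<in> borel_measurable borel"
  proof -
    consider "t = -1" | "t = 0" | "t = 1" using t by auto
    then show ?thesis by cases (auto simp: power_int_minus)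
  qed
  define p1 where "p1 r = indicator {0..<1} r *\<^sub>R p r" for r
  have [measurable]: "p1 \<in> borel_measurable borel"
    unfolding p1_def by (rule borel_measurable_continuous_on_indicator[OF _ p_cont]) auto
  have H_meas: "H \<in> borel_measurable borel"
  proof -
    have "H = (\<lambda>r. if 0 \<le> r \<and> r < 1 then T r powi t * p1 r powr \<sigma> else 1)"
      by (auto simp: H_def p1_def)
    also have "\<dots> \<in> borel_measurable borel" by measurable
    finally show ?thesis .
  qed
  \<comment> \<open>\<open>\<rho>\<close> itself need not be radial, but the Laplacian is, by
    \<open>laplacian_radial\<close>; passing through it costs one \<open>C\<close> on each
    side.\<close>
  have ratio: "\<rho> z \<le> C\<^sup>2 * p (norm z)" "p (norm z) \<le> C\<^sup>2 * \<rho> z" if z: "z \<in> unit_disc" for z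
  proof -
    have z': "of_real (norm z) \<in> unit_disc" using z by simp
    have "\<rho> z \<le> C * (1 / sqrt (laplacian \<phi> z))" "\<rho> (of_real (norm z)) \<le> C * (1 / sqrt (laplacian \<phi> z))"
      using C(2)[OF z] C(2)[OF z'] C(1) \<phi>.laplacian_radial[OF z] by (auto simp: pos_divide_le_eq mult.commute)
    moreover have "C * (1 / sqrt (laplacian \<phi> z)) \<le> C * (C * \<rho> z)" "C * (1 / sqrt (laplacian \<phi> z)) \<le> C * (C * \<rho> (of_real (norm z)))"
      using mult_left_mono[OF C(3)[OF z], of C] mult_left_mono[OF C(3)[OF z'], of C] C(1) \<phi>.laplacian_radial[OF z]
      by simp_all
    ultimately show "\<rho> z \<le> C\<^sup>2 * p (norm z)" "p (norm z) \<le> C\<^sup>2 * \<rho> z"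
      unfolding p_def power2_eq_square mult.assoc by linarith+
  qed
  define Cv where "Cv = (C\<^sup>2) powr \<bar>\<sigma>\<bar>"
  have Cv: "0 < Cv" using C(1) by (simp add: Cv_def)
  have C21: "1 \<le> C\<^sup>2" using C(1) by simp
  have v_eq: "v z = w z * T (norm z) powi t * \<rho> z powr \<sigma>" if "z \<in> unit_disc" for z
    using v[OF that] by (simp add: T_def tail_def)
  have wT: "0 < w z * T (norm z) powi t" if "z \<in> unit_disc" for z
    using w[OF that] T_pos[of "norm z"] that by (simp add: zero_less_power_int)
  have pn: "0 < p (norm z)" if "z \<in> unit_disc" for z using p_pos[of "norm z"] that by simp
  have H_eq: "H (norm z) = T (norm z) powi t * p (norm z) powr \<sigma>" if "z \<in> unit_disc" for z
    using that by (simp add: H_def)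
  interpret radial_bergman p u \<psi> D "L + 1" "1 / C\<^sup>2" "C\<^sup>2" w \<omega> v H Cv
  proof
    show "w z = exp (- u (norm z))" if "z \<in> unit_disc" for z
      using w[OF that] assms(3) that unfolding radial_def u_def by metis
    show "\<omega> z = (w z)\<^sup>2" if "z \<in> unit_disc" for z using assms(8)[OF that] .
    show "w z * H (norm z) \<le> Cv * v z" if z: "z \<in> unit_disc" for z
    proof -
      have "w z * T (norm z) powi t * p (norm z) powr \<sigma> \<le> w z * T (norm z) powi t * (Cv * \<rho> z powr \<sigma>)"
        unfolding Cv_def
        by (rule mult_left_mono[OF powr_comparable[OF pn[OF z] \<rho>_pos[OF z] C21 ratio(2)[OF z] ratio(1)[OF z]] less_imp_le[OF wT[OF z]]])
      then show ?thesis using v_eq[OF z] H_eq[OF z] by (simp add: mult_ac)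
    qed
    show "v z \<le> Cv * (w z * H (norm z))" if z: "z \<in> unit_disc" for z
    proof -
      have "w z * T (norm z) powi t * \<rho> z powr \<sigma> \<le> w z * T (norm z) powi t * (Cv * p (norm z) powr \<sigma>)"
        unfolding Cv_def
        by (rule mult_left_mono[OF powr_comparable[OF \<rho>_pos[OF z] pn[OF z] C21 ratio(1)[OF z] ratio(2)[OF z]] less_imp_le[OF wT[OF z]]])
      then show ?thesis using v_eq[OF z] H_eq[OF z] by (simp add: mult_ac)
    qed
    show "(\<lambda>z. indicator unit_disc z * v z) \<in> borel_measurable borel"
    proof -
      \<comment> \<open>\<open>w\<close> and \<open>\<rho>\<close> are arbitrary outside the disc,
        so both are cut off before measurability is shown.\<close>
      define w1 where "w1 z = indicator unit_disc z *\<^sub>R exp (- \<phi> z)" for z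
      define \<rho>1 where "\<rho>1 z = indicator unit_disc z *\<^sub>R \<rho> z" for z
      have [measurable]: "w1 \<in> borel_measurable borel" "\<rho>1 \<in> borel_measurable borel"
        unfolding w1_def \<rho>1_def using \<phi>.phi_cont \<rho>
        by (auto intro!: borel_measurable_continuous_on_indicator continuous_intros simp: class_L0_def simp del: real_scaleR_def)
      have [measurable]: "(\<lambda>z::complex. T (norm z) powi t) \<in> borel_measurable borel"
        by (rule measurable_compose[OF _ Tt_meas]) simp
      have "(\<lambda>z. w1 z * T (norm z) powi t * \<rho>1 z powr \<sigma>) \<in> borel_measurable borel" by measurable
      also have "(\<lambda>z. w1 z * T (norm z) powi t * \<rho>1 z powr \<sigma>) = (\<lambda>z. indicator unit_disc z * v z)"
        by (auto simp: fun_eq_iff w1_def \<rho>1_def v_eq w split: split_indicator)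
      finally show ?thesis .
    qed
  qed (fact H_slow H_meas Cv)+
  show ?thesis by (rule bergman_proj_bounded_onto_radial)
qed

end
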